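(* Let $p\in(2,6)$, $q\in(2,4)$, $\alpha,\beta>0$, $\varepsilon>0$, and let $V\subset\mathbb V_{\mathcal G_\varepsilon}$ be $\mathbb Z^2$-periodic. Then $\mathcal E_{\mathcal G_\varepsilon}(\mu)<0$ and a ground state of $E(\cdot,\mathcal G_\varepsilon)$ in $H^1_\mu(\mathcal G_\varepsilon)$ exists for every $\mu>0$.
   Context: For $\varepsilon>0$, $\mathcal G_\varepsilon$ is the metric graph embedded in $\mathbb R^2$ with vertex set $\mathbb V_{\mathcal G_\varepsilon}=\varepsilon\mathbb Z^2$ and an edge (a segment of length $\varepsilon$) joining every pair of vertices at Euclidean distance $\varepsilon$. $H^1(\mathcal G_\varepsilon)$ is the space of continuous functions $u:\mathcal G_\varepsilon\to\mathbb R$ whose restriction to each edge belongs to $H^1$ of that edge and with $\|u\|_{L^2(\mathcal G_\varepsilon)}^2+\|u'\|_{L^2(\mathcal G_\varepsilon)}^2<\infty$, where $L^r$ norms on $\mathcal G_\varepsilon$ are computed by summing the one-dimensional integrals over all edges. $H^1_\mu(\mathcal G_\varepsilon)=\{u\in H^1(\mathcal G_\varepsilon):\|u\|_{L^2(\mathcal G_\varepsilon)}^2=\mu\}$. For $V\subseteq\mathbb V_{\mathcal G_\varepsilon}$ and $\alpha,\beta>0$, $E(u,\mathcal G_\varepsilon)=\frac12\|u'\|_{L^2(\mathcal G_\varepsilon)}^2-\frac\alpha p\|u\|_{L^p(\mathcal G_\varepsilon)}^p-\frac\beta q\sum_{\mathrm v\in V}|u(\mathrm v)|^q$, and $\mathcal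 E_{\mathcal G_\varepsilon}(\mu)=\inf_{u\in H^1_\mu(\mathcal G_\varepsilon)}E(u,\mathcal G_\varepsilon)$. A ground state with mass $\mu$ is a $u\in H^1_\mu(\mathcal G_\varepsilon)$ with $E(u,\mathcal G_\varepsilon)=\mathcal E_{\mathcal G_\varepsilon}(\mu)$. $\mathbb Z^2$-periodic sets: a set $V'\subset\mathbb Z^2$ is $\mathbb Z^2$-periodic if there exist linearly independent $\vec v_1,\vec v_2\in\mathbb Z^2$ with $V'=V'+k_1\vec v_1+k_2\vec v_2$ for all $k_1,k_2\in\mathbb Z$. A set $V\subset\varepsilon\mathbb Z^2$ is $\mathbb Z^2$-periodic if $V=\varepsilon V'$ for some $\mathbb Z^2$-periodic $V'\subset\mathbb Z^2$.
   Formalization: The set V is assumed nonempty: the empty set is formally Z²-periodic, but then for p in [4,6) and small mass the energy is nonnegative by the two-dimensional Gagliardo–Nirenberg inequality, so the level is not negative. *)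

theory Defs
  imports "HOL-Analysis.Analysis"
begin

text \<open>The square grid metric graph G_eps embedded in the plane.
  Vertices: eps * Z^2.  Edges are indexed by (k, d) with k in Z^2 and d :: bool;
  d = True is the horizontal edge from eps*k to eps*(k + (1,0)),
  d = False is the vertical edge from eps*k to eps*(k + (0,1)).
  Every edge is parametrised by arclength t in [0, eps].\<close>

type_synonym grid_edge = "(int \<times> int) \<times> bool"

definition vtx :: "real \<Rightarrow> int \<times> int \<Rightarrow> real \<times> real" where
  "vtx eps k = (eps * of_int (fst k), eps * of_int (snd k))"

definition grid_vertices :: "real \<Rightarrow> (real \<times> real) set" where
  "grid_vertices eps = range (vtx eps)"

definition edge_pt :: "real \<Rightarrow> grid_edge \<Rightarrow> real \<Rightarrow> real \<times> real" where
  "edge_pt eps e t =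
     (if snd e then vtx eps (fst e) + (t, 0) else vtx eps (fst e) + (0, t))"

definition grid :: "real \<Rightarrow> (real \<times> real) set" where
  "grid eps = (\<Union>e. edge_pt eps e ` {0..eps})"

definition edge_fun :: "real \<Rightarrow> (real \<times> real \<Rightarrow> real) \<Rightarrow> grid_edge \<Rightarrow> real \<Rightarrow> real" where
  "edge_fun eps u e t = u (edge_pt eps e t)"

text \<open>g is the (weak) derivative of f on [a,b] with g in L^2(a,b):
  f is the absolutely continuous primitive of g (1-D characterisation of H^1).\<close>
definition weak_deriv :: "real \<Rightarrow> real \<Rightarrow> (real \<Rightarrow> real) \<Rightarrow> (real \<Rightarrow> real) \<Rightarrow> bool" where
  "weak_deriv a b f g \<longleftrightarrow>
     set_integrable lborel {a..b} g \<and>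
     set_integrable lborel {a..b} (\<lambda>t. (g t)\<^sup>2) \<and>
     (\<forall>t\<in>{a..b}. f t = f a + (LBINT s:{a..t}. g s))"

text \<open>Squared L^2 norm of u' on one edge (the weak derivative is unique a.e.).\<close>
definition edge_dnorm2 :: "real \<Rightarrow> (real \<times> real \<Rightarrow> real) \<Rightarrow> grid_edge \<Rightarrow> real" where
  "edge_dnorm2 eps u e =
     (LBINT t:{0..eps}. ((SOME g. weak_deriv 0 eps (edge_fun eps u e) g) t)\<^sup>2)"

definition edge_Lr :: "real \<Rightarrow> (real \<times> real \<Rightarrow> real) \<Rightarrow> real \<Rightarrow> grid_edge \<Rightarrow> real" where
  "edge_Lr eps u r e = (LBINT t:{0..eps}. \<bar>edge_fun eps u e t\<bar> powr r)"

definition Lr_pow :: "real \<Rightarrow> (real \<times> real \<Rightarrow> real) \<Rightarrow> real \<Rightarrow> real" where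
  "Lr_pow eps u r = (\<Sum>\<^sub>\<infinity>e. edge_Lr eps u r e)"

definition dnorm2 :: "real \<Rightarrow> (real \<times> real \<Rightarrow> real) \<Rightarrow> real" where
  "dnorm2 eps u = (\<Sum>\<^sub>\<infinity>e. edge_dnorm2 eps u e)"

definition H1 :: "real \<Rightarrow> (real \<times> real \<Rightarrow> real) set" where
  "H1 eps = {u. continuous_on (grid eps) u \<and>
                (\<forall>e. \<exists>g. weak_deriv 0 eps (edge_fun eps u e) g) \<and>
                (\<lambda>e. edge_Lr eps u 2 e) summable_on UNIV \<and>
                (\<lambda>e. edge_dnorm2 eps u e) summable_on UNIV}"

definition H1_mass :: "real \<Rightarrow> real \<Rightarrow> (real \<times> real \<Rightarrow> real) set" where
  "H1_mass eps \<mu> = {u \<in> H1 eps. Lr_pow eps u 2 = \<mu>}"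

definition energy ::
  "real \<Rightarrow> real \<Rightarrow> real \<Rightarrow> real \<Rightarrow> real \<Rightarrow> (real \<times> real) set \<Rightarrow> (real \<times> real \<Rightarrow> real) \<Rightarrow> real" where
  "energy eps p q \<alpha> \<beta> V u =
     dnorm2 eps u / 2 - \<alpha> / p * Lr_pow eps u p - \<beta> / q * (\<Sum>\<^sub>\<infinity>v\<in>V. \<bar>u v\<bar> powr q)"

definition ground_level ::
  "real \<Rightarrow> real \<Rightarrow> real \<Rightarrow> real \<Rightarrow> real \<Rightarrow> (real \<times> real) set \<Rightarrow> real \<Rightarrow> real" where
  "ground_level eps p q \<alpha> \<beta> V \<mu> = (INF u\<in>H1_mass eps \<mu>. energy eps p q \<alpha> \<beta> V u)"

definition ground_state ::
  "real \<Rightarrow> real \<Rightarrow> real \<Rightarrow> real \<Rightarrow> real \<Rightarrow> (real \<times> real) set \<Rightarrow> real \<Rightarrow> (real \<times> real \<Rightarrow> real) \<Rightarrow> bool" where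
  "ground_state eps p q \<alpha> \<beta> V \<mu> u \<longleftrightarrow>
     u \<in> H1_mass eps \<mu> \<and> energy eps p q \<alpha> \<beta> V u = ground_level eps p q \<alpha> \<beta> V \<mu>"

definition Z2_periodic :: "(int \<times> int) set \<Rightarrow> bool" where
  "Z2_periodic V' \<longleftrightarrow>
     (\<exists>v1 v2 :: int \<times> int. fst v1 * snd v2 - snd v1 * fst v2 \<noteq> 0 \<and>
        (\<forall>k1 k2 :: int. V' = (\<lambda>x. x + (k1 * fst v1 + k2 * fst v2, k1 * snd v1 + k2 * snd v2)) ` V'))"

definition grid_periodic :: "real \<Rightarrow> (real \<times> real) set \<Rightarrow> bool" where
  "grid_periodic eps V \<longleftrightarrow> (\<exists>V'. Z2_periodic V' \<and> V = vtx eps ` V')"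

end

theory Submission
  imports Defs "HOL-Complex_Analysis.Great_Picard"
begin

text \<open>
  The energy is coercive at fixed mass because \<open>p < 6\<close> and \<open>q < 4\<close>, and its infimum \<open>I\<close> is negative because
  a widely spread tent sees the vertex term as a two-dimensional power of exponent \<open>q < 4\<close>.
  Negativity forces some edge to carry a fixed amount of mass; translating by periods of \<open>V\<close> brings that edge
  into one cell. If mass escaped to infinity, some square annulus of width one would carry little \<open>H\<^sup>1\<close> norm, and
  cutting there would split the function into two pieces of almost the same total energy, while rescaling
  to mass \<open>\<mu>\<close> (\<open>p > 2\<close>) shows that this costs a fixed amount. So minimising sequences are tight and,
  along a subsequence, Cauchy in \<open>L\<^sup>2\<close>; no weak convergence is needed, since
  the parallelogram law applied to midpoints then makes the derivatives Cauchy in \<open>L\<^sup>2\<close> as well.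
\<close>

section \<open>Weak derivatives on an interval\<close>

text \<open>For p in [4,6) the term in \<open>P\<close> cannot make the energy negative on spread
  functions: a tent over n^2 periods, normalised to mass \<mu>, has \<open>P\<close> of order
  n^(2-p) against \<open>D\<close> of order n^(-2). Negativity has to come from the vertices, and
  this uses that V is nonempty. The strict gain under rescaling comes from \<open>P\<close> instead:
  an edge of mass \<delta> bounds \<open>P\<close> from below, whereas it says nothing about the
  values at the vertices of V. All perturbation estimates have the shape \<kappa> * (bounded) +
  (difference) / \<kappa> with \<kappa> free, so only squares have to be compared. Local compactness
  is obtained by hand: the values at the rational points of all edges converge along a diagonal
  subsequence, and the Hoelder-1/2 bound on each edge turns this into L^2 convergence there.
  Tightness is stated for every centred function of almost minimal energy rather than for sequences,
  so that one finite set of edges serves a whole tail.\<close>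

lemma weak_derivD:
  assumes "weak_deriv a b f g"
  shows "set_integrable lborel {a..b} g" "set_integrable lborel {a..b} (\<lambda>t. (g t)\<^sup>2)"
    "t \<in> {a..b} \<Longrightarrow> f t = f a + (LBINT s:{a..t}. g s)"
  using assms unfolding weak_deriv_def by blast+

text \<open>Since \<open>ennreal\<close> truncates negative numbers, \<open>ennreal (k t)\<close>
  and \<open>ennreal (- k t)\<close> are the positive and negative part of \<open>k\<close>. As
  densities they give measures that agree and are finite on all rays, hence coincide. At almost
  every point the two parts are then equal, and one of them is always 0.\<close>

lemma AE_eq_0_if_Ioi_integrals_0:
  fixes k :: "real \<Rightarrow> real"
  assumes int: "integrable lborel k"
    and zero: "\<And>x. (LBINT t:{x<..}. k t) = 0"
  shows "AE t in lborel. k t = 0"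
proof -
  have [measurable]: "k \<in> borel_measurable lborel" using int by auto
  have ind: "integrable lborel (\<lambda>t. indicator {x<..} t * max 0 (k t))"
            "integrable lborel (\<lambda>t. indicator {x<..} t * max 0 (- k t))" for x
    by (rule Bochner_Integration.integrable_bound[OF int]; auto simp: indicator_def)+
  have em: "emeasure (density lborel (\<lambda>t. ennreal (h t))) {x<..} = ennreal (LINT t|lborel. indicator {x<..} t * max 0 (h t))"
    if h[measurable]: "h \<in> borel_measurable lborel" and i: "integrable lborel (\<lambda>t. indicator {x<..} t * max 0 (h t))" for x and h :: "real \<Rightarrow> real"
  proof -
    have "emeasure (density lborel (\<lambda>t. ennreal (h t))) {x<..} = (\<integral>\<^sup>+ t. ennreal (h t) * indicator {x<..} t \<partial>lborel)"
      by (subst emeasure_density) auto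
    also have "\<dots> = (\<integral>\<^sup>+ t. ennreal (indicator {x<..} t * max 0 (h t)) \<partial>lborel)"
      by (intro nn_integral_cong) (auto simp: indicator_def max_def ennreal_neg)
    also have "\<dots> = ennreal (LINT t|lborel. indicator {x<..} t * max 0 (h t))"
      by (rule nn_integral_eq_integral[OF i]) auto
    finally show ?thesis .
  qed
  have eqd: "(LINT t|lborel. indicator {x<..} t * max 0 (k t)) = (LINT t|lborel. indicator {x<..} t * max 0 (- k t))" for x
  proof -
    have "(LINT t|lborel. indicator {x<..} t * max 0 (k t)) - (LINT t|lborel. indicator {x<..} t * max 0 (- k t))
       = (LINT t|lborel. indicator {x<..} t * max 0 (k t) - indicator {x<..} t * max 0 (- k t))"
      by (rule Bochner_Integration.integral_diff[symmetric, OF ind])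
    also have "\<dots> = (LBINT t:{x<..}. k t)"
      unfolding set_lebesgue_integral_def by (intro Bochner_Integration.integral_cong) (auto simp: indicator_def)
    finally show ?thesis using zero by simp
  qed
  have "density lborel (\<lambda>t. ennreal (k t)) = density lborel (\<lambda>t. ennreal (- k t))"
  proof (rule measure_eqI_lessThan)
    fix x show "emeasure (density lborel (\<lambda>t. ennreal (k t))) {x<..} < \<infinity>"
      by (subst em) (auto simp: ind)
    show "emeasure (density lborel (\<lambda>t. ennreal (k t))) {x<..} = emeasure (density lborel (\<lambda>t. ennreal (- k t))) {x<..}"
      by (subst (1 2) em) (auto simp: ind eqd)
  qed auto
  then have "AE t in lborel. ennreal (k t) = ennreal (- k t)"
    by (intro sigma_finite_measure.density_unique sigma_finite_lborel) auto
  then show ?thesis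
  proof eventually_elim
    case (elim t)
    then show ?case by (metis ennreal_eq_0_iff ennreal_neg linorder_le_cases neg_le_0_iff_le order_antisym)
  qed
qed

lemma set_integral_Icc_diff:
  fixes g :: "real \<Rightarrow> real"
  assumes g: "set_integrable lborel {a..b} g" and "a \<le> s" "s \<le> t" "t \<le> b"
  shows "(LBINT x:{a..t}. g x) - (LBINT x:{a..s}. g x) = (LBINT x:{s..t}. g x)"
proof -
  have i: "set_integrable lborel {a..t} g" "set_integrable lborel {a..s} g" "set_integrable lborel {s..t} g"
    using assms by (auto intro: set_integrable_subset[OF g])
  have "(LBINT x:{a..t}. g x) - (LBINT x:{a..s}. g x) = (LINT x|lborel. indicator {a..t} x *\<^sub>R g x - indicator {a..s} x *\<^sub>R g x)"
    unfolding set_lebesgue_integral_def using i by (subst Bochner_Integration.integral_diff) (auto simp: set_integrable_def)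
  also have "\<dots> = (LBINT x:{s..t}. g x)"
    unfolding set_lebesgue_integral_def
  proof (rule integral_cong_AE)
    show "AE x in lborel. indicator {a..t} x *\<^sub>R g x - indicator {a..s} x *\<^sub>R g x = indicator {s..t} x *\<^sub>R g x"
      using AE_lborel_singleton[of s] by eventually_elim (use assms in \<open>auto simp: indicator_def\<close>)
  qed (use i in \<open>auto simp: set_integrable_def\<close>)
  finally show ?thesis .
qed

lemma weak_deriv_increment:
  assumes "weak_deriv a b f g" "a \<le> s" "s \<le> t" "t \<le> b"
  shows "f t - f s = (LBINT x:{s..t}. g x)"
proof -
  have "f t = f a + (LBINT x:{a..t}. g x)" "f s = f a + (LBINT x:{a..s}. g x)"
    by (rule weak_derivD(3)[OF assms(1)]; use assms(2-) in simp)+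
  then show ?thesis using set_integral_Icc_diff[OF weak_derivD(1)[OF assms(1)] assms(2-)] by linarith
qed

text \<open>The difference of the two derivatives, set to 0 outside the interval, integrates to 0
  over every ray, because both integrals are the same increment of \<open>f\<close>.\<close>

lemma weak_deriv_AE_unique:
  assumes g: "weak_deriv a b f g" and h: "weak_deriv a b f h"
  shows "AE t in lborel. t \<in> {a..b} \<longrightarrow> g t = h t"
proof -
  define k where "k t = indicator {a..b} t *\<^sub>R g t - indicator {a..b} t *\<^sub>R h t" for t
  have i: "integrable lborel (\<lambda>t. indicator {a..b} t *\<^sub>R g t)" "integrable lborel (\<lambda>t. indicator {a..b} t *\<^sub>R h t)"
    using weak_derivD(1)[OF g] weak_derivD(1)[OF h] by (auto simp: set_integrable_def)
  have ik: "integrable lborel k"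
    unfolding k_def using i by auto
  have "(LBINT t:{x<..}. k t) = 0" for x
  proof -
    \<comment> \<open>Up to the single point \<open>x\<close>, the ray beyond \<open>x\<close> meets
      the interval in \<open>{c..b}\<close>, which is empty if \<open>c > b\<close>.\<close>
    define c where "c = max a x"
    have "(LBINT t:{x<..}. k t) = (LBINT t:{c..b}. g t) - (LBINT t:{c..b}. h t)"
    proof -
      have j: "set_integrable lborel {c..b} g" "set_integrable lborel {c..b} h"
        using weak_derivD(1)[OF g] weak_derivD(1)[OF h] by (auto simp: c_def intro: set_integrable_subset)
      have "(LBINT t:{c..b}. g t) - (LBINT t:{c..b}. h t) = (LBINT t:{c..b}. g t - h t)"
        using j by (simp add: set_integral_diff)
      also have "\<dots> = (LBINT t:{x<..}. k t)"
        unfolding set_lebesgue_integral_def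
      proof (rule integral_cong_AE)
        show "AE t in lborel. indicator {c..b} t *\<^sub>R (g t - h t) = indicator {x<..} t *\<^sub>R k t"
          using AE_lborel_singleton[of x] 
          by eventually_elim (auto simp: indicator_def c_def k_def)
        show "(\<lambda>t. indicator {c..b} t *\<^sub>R (g t - h t)) \<in> borel_measurable lborel"
          using set_integral_diff(1)[OF j] by (auto simp: set_integrable_def)
        show "(\<lambda>t. indicator {x<..} t *\<^sub>R k t) \<in> borel_measurable lborel"
          using ik by auto
      qed
      finally show ?thesis by simp
    qed
    also have "\<dots> = 0"
    proof (cases "c \<le> b")
      case True
      then show ?thesis using weak_deriv_increment[OF g, of c b] weak_deriv_increment[OF h, of c b]
        by (auto simp: c_def)
    qed (simp add: set_lebesgue_integral_def)
    finally show ?thesis .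
  qed
  from AE_eq_0_if_Ioi_integrals_0[OF ik this] show ?thesis
    by eventually_elim (auto simp: k_def indicator_def)
qed

text \<open>This makes \<open>edge_dnorm2\<close> independent of the derivative that
  \<open>SOME\<close> picks.\<close>

lemma weak_deriv_square_integral_unique:
  assumes g: "weak_deriv a b f g" and h: "weak_deriv a b f h"
  shows "(LBINT t:{a..b}. (g t)\<^sup>2) = (LBINT t:{a..b}. (h t)\<^sup>2)"
  unfolding set_lebesgue_integral_def
proof (rule integral_cong_AE)
  show "AE x in lborel. indicator {a..b} x *\<^sub>R (g x)\<^sup>2 = indicator {a..b} x *\<^sub>R (h x)\<^sup>2"
    using weak_deriv_AE_unique[OF g h] by eventually_elim (auto simp: indicator_def)
qed (use weak_derivD(2)[OF g] weak_derivD(2)[OF h] in \<open>auto simp: set_integrable_def\<close>)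

lemma weak_deriv_cong:
  assumes "\<And>t. t \<in> {a..b} \<Longrightarrow> f t = f' t"
  shows "weak_deriv a b f g \<longleftrightarrow> weak_deriv a b f' g"
proof (cases "a \<le> b")
  case True
  then have "(\<forall>t\<in>{a..b}. f t = f a + (LBINT s:{a..t}. g s)) \<longleftrightarrow> (\<forall>t\<in>{a..b}. f' t = f' a + (LBINT s:{a..t}. g s))"
    using assms by (intro ball_cong) auto
  then show ?thesis by (simp only: weak_deriv_def)
qed (simp add: weak_deriv_def)

text \<open>Integrability of \<open>g\<close> and \<open>h\<close> themselves is assumed for the
  sake of measurability: it cannot be read off from the squares.\<close>

lemma set_integrable_power2_add:
  fixes g h :: "real \<Rightarrow> real"
  assumes "set_integrable lborel A g" "set_integrable lborel A h"
   "set_integrable lborel A (\<lambda>t. (g t)\<^sup>2)" "set_integrable lborel A (\<lambda>t. (h t)\<^sup>2)"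
  shows "set_integrable lborel A (\<lambda>t. (g t + h t)\<^sup>2)"
proof -
  have "set_integrable lborel A (\<lambda>t. 2 * (g t)\<^sup>2 + 2 * (h t)\<^sup>2)"
    using assms by auto
  moreover have "set_borel_measurable lborel A (\<lambda>t. (g t + h t)\<^sup>2)"
  proof -
    have "(\<lambda>t. (indicator A t *\<^sub>R g t + indicator A t *\<^sub>R h t)\<^sup>2) \<in> borel_measurable lborel"
      using assms(1,2) unfolding set_integrable_def by (intro borel_measurable_power borel_measurable_add) auto
    moreover have "(\<lambda>t. (indicator A t *\<^sub>R g t + indicator A t *\<^sub>R h t)\<^sup>2) = (\<lambda>t. indicator A t *\<^sub>R (g t + h t)\<^sup>2)"
      by (auto simp: indicator_def)
    ultimately show ?thesis unfolding set_borel_measurable_def by simp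
  qed
  ultimately show ?thesis
  proof (rule set_integrable_bound)
    have "(g t + h t)\<^sup>2 \<le> 2 * (g t)\<^sup>2 + 2 * (h t)\<^sup>2" for t
      using sum_squares_bound[of "g t" "h t"] by (simp add: power2_sum)
    then show "AE x in lborel. x \<in> A \<longrightarrow> norm ((g x + h x)\<^sup>2) \<le> norm (2 * (g x)\<^sup>2 + 2 * (h x)\<^sup>2)"
      by auto
  qed
qed

lemma weak_deriv_linear:
  assumes f: "weak_deriv a b f f'" and h: "weak_deriv a b h h'"
  shows "weak_deriv a b (\<lambda>t. c * f t + d * h t) (\<lambda>t. c * f' t + d * h' t)"
proof -
  have i: "set_integrable lborel {a..t} f'" "set_integrable lborel {a..t} h'" if "t \<le> b" for t
    using weak_derivD(1)[OF f] weak_derivD(1)[OF h] that by (auto intro: set_integrable_subset)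
  have "set_integrable lborel {a..b} (\<lambda>t. (c * f' t)\<^sup>2)" "set_integrable lborel {a..b} (\<lambda>t. (d * h' t)\<^sup>2)"
    using weak_derivD(2)[OF f] weak_derivD(2)[OF h] by (auto simp: power_mult_distrib)
  then have "set_integrable lborel {a..b} (\<lambda>t. (c * f' t + d * h' t)\<^sup>2)"
    using weak_derivD(1)[OF f] weak_derivD(1)[OF h] by (intro set_integrable_power2_add) auto
  moreover have "c * f t + d * h t = (c * f a + d * h a) + (LBINT s:{a..t}. c * f' s + d * h' s)" if "t \<in> {a..b}" for t
  proof -
    have "(LBINT s:{a..t}. c * f' s + d * h' s) = c * (LBINT s:{a..t}. f' s) + d * (LBINT s:{a..t}. h' s)"
      using i[of t] that by (subst set_integral_add) auto
    moreover have "f t = f a + (LBINT s:{a..t}. f' s)" "h t = h a + (LBINT s:{a..t}. h' s)"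
      using weak_derivD(3)[OF f that] weak_derivD(3)[OF h that] by simp_all
    ultimately show ?thesis by (simp only: algebra_simps)
  qed
  moreover have "set_integrable lborel {a..b} (\<lambda>t. c * f' t + d * h' t)"
    using weak_derivD(1)[OF f] weak_derivD(1)[OF h] by auto
  ultimately show ?thesis unfolding weak_deriv_def by blast
qed

text \<open>Expand the nonnegative integral of \<open>(g x - c)\<^sup>2\<close> around the mean
  \<open>c\<close> of \<open>g\<close>.\<close>

lemma set_integral_cauchy_schwarz:
  fixes g :: "real \<Rightarrow> real"
  assumes g: "set_integrable lborel {s..t} g" and g2: "set_integrable lborel {s..t} (\<lambda>x. (g x)\<^sup>2)" and "s \<le> t"
  shows "(LBINT x:{s..t}. g x)\<^sup>2 \<le> (t - s) * (LBINT x:{s..t}. (g x)\<^sup>2)"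
proof (cases "s = t")
  case True
  then show ?thesis by (simp add: set_integral_at_point)
next
  case False
  define c where "c = (LBINT x:{s..t}. g x) / (t - s)"
  have k: "set_integrable lborel {s..t} (\<lambda>x. c\<^sup>2)" "(LBINT x:{s..t}. c\<^sup>2) = (t - s) * c\<^sup>2"
    using \<open>s \<le> t\<close> by (auto simp: set_lebesgue_integral_def set_integrable_def)
  have "0 \<le> (LBINT x:{s..t}. (g x - c)\<^sup>2)"
    unfolding set_lebesgue_integral_def by (intro Bochner_Integration.integral_nonneg) (auto simp: indicator_def)
  also have "(LBINT x:{s..t}. (g x - c)\<^sup>2) = (LBINT x:{s..t}. ((g x)\<^sup>2 - (2 * c) * g x) + c\<^sup>2)"
    by (simp add: power2_diff algebra_simps)
  also have "\<dots> = (LBINT x:{s..t}. (g x)\<^sup>2) - (2 * c) * (LBINT x:{s..t}. g x) + (t - s) * c\<^sup>2"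
    using g g2 k by (subst set_integral_add) (auto simp: set_integral_diff)
  also have "\<dots> = (LBINT x:{s..t}. (g x)\<^sup>2) - (LBINT x:{s..t}. g x)\<^sup>2 / (t - s)"
    using False by (simp add: c_def power2_eq_square)
  finally show ?thesis using False \<open>s \<le> t\<close> by (simp add: field_simps)
qed

lemma set_integral_nonneg_mono_set:
  fixes g :: "real \<Rightarrow> real"
  assumes "set_integrable lborel B g" "A \<subseteq> B" "A \<in> sets borel" "\<And>x. x \<in> B \<Longrightarrow> 0 \<le> g x"
  shows "(LBINT x:A. g x) \<le> (LBINT x:B. g x)"
  unfolding set_lebesgue_integral_def
proof (rule integral_mono)
  show "integrable lborel (\<lambda>x. indicator A x *\<^sub>R g x)"
    using set_integrable_subset[OF assms(1) _ assms(2)] assms(3) by (auto simp: set_integrable_def)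
qed (use assms in \<open>auto simp: set_integrable_def indicator_def\<close>)

text \<open>Hoelder continuity with exponent 1/2, in squared form. It is the only source of
  continuity and compactness on an edge.\<close>

lemma weak_deriv_holder:
  assumes w: "weak_deriv a b f g" and "s \<in> {a..b}" "t \<in> {a..b}"
  shows "(f t - f s)\<^sup>2 \<le> \<bar>t - s\<bar> * (LBINT x:{a..b}. (g x)\<^sup>2)"
proof -
  have *: "(f t - f s)\<^sup>2 \<le> (t - s) * (LBINT x:{a..b}. (g x)\<^sup>2)" if "a \<le> s" "s \<le> t" "t \<le> b" for s t
  proof -
    have "(f t - f s)\<^sup>2 \<le> (t - s) * (LBINT x:{s..t}. (g x)\<^sup>2)"
      unfolding weak_deriv_increment[OF w that]
      using weak_derivD(1,2)[OF w] that by (intro set_integral_cauchy_schwarz) (auto intro: set_integrable_subset)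
    also have "\<dots> \<le> (t - s) * (LBINT x:{a..b}. (g x)\<^sup>2)"
      using weak_derivD(2)[OF w] that by (intro mult_left_mono set_integral_nonneg_mono_set) auto
    finally show ?thesis .
  qed
  show ?thesis
  proof (cases "s \<le> t")
    case True then show ?thesis using *[of s t] assms by auto
  next
    case False then show ?thesis using *[of t s] assms by (auto simp: power2_commute)
  qed
qed

lemma weak_deriv_continuous_on:
  assumes w: "weak_deriv a b f g"
  shows "continuous_on {a..b} f"
proof -
  define d where "d = (LBINT x:{a..b}. (g x)\<^sup>2)"
  have d: "0 \<le> d"
    unfolding d_def set_lebesgue_integral_def by (intro Bochner_Integration.integral_nonneg) auto
  show ?thesis unfolding continuous_on_def
  proof
    fix s assume s: "s \<in> {a..b}"
    have "((\<lambda>t. f t - f s) \<longlongrightarrow> 0) (at s within {a..b})"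
    proof (rule Lim_null_comparison)
      show "\<forall>\<^sub>F t in at s within {a..b}. norm (f t - f s) \<le> sqrt (\<bar>t - s\<bar> * d)"
        unfolding eventually_at_filter
        using weak_deriv_holder[OF w s] by (auto simp: d_def intro!: always_eventually real_le_rsqrt)
      have "((\<lambda>t. sqrt (\<bar>t - s\<bar> * d)) \<longlongrightarrow> sqrt (\<bar>s - s\<bar> * d)) (at s within {a..b})"
        by (intro tendsto_intros)
      then show "((\<lambda>t. sqrt (\<bar>t - s\<bar> * d)) \<longlongrightarrow> 0) (at s within {a..b})" by simp
    qed
    then show "(f \<longlongrightarrow> f s) (at s within {a..b})" using LIM_zero_iff by blast
  qed
qed

lemma set_integrable_Icc_continuous:
  fixes f :: "real \<Rightarrow> real"
  assumes "continuous_on {a..b} f"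
  shows "set_integrable lborel {a..b} f"
  using borel_integrable_atLeastAtMost'[OF assms] .

lemma set_integral_Icc_const:
  fixes c :: real
  assumes "a \<le> b"
  shows "set_integrable lborel {a..b} (\<lambda>x. c)" "(LBINT x:{a..b}. c) = (b - a) * c"
  using assms by (auto simp: set_lebesgue_integral_def set_integrable_def)

text \<open>Compare \<open>f t\<close> with \<open>f x\<close> by the Hoelder estimate and average
  over x in a window of length \<open>l\<close>. The length stays free because its users balance
  mass against derivative differently: \<open>sup_coercive\<close> takes it of order
  \<open>1 / sqrt (1 + D u)\<close>, \<open>midpoint_estimate\<close> takes it as small as the
  distance requires.\<close>

lemma weak_deriv_sup_bound:
  assumes w: "weak_deriv a b f g" and t: "t \<in> {a..b}" and l: "0 < l" "l \<le> b - a"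
  shows "(f t)\<^sup>2 \<le> 2 * (LBINT x:{a..b}. (f x)\<^sup>2) / l + 2 * l * (LBINT x:{a..b}. (g x)\<^sup>2)"
proof -
  define d where "d = (LBINT x:{a..b}. (g x)\<^sup>2)"
  have d: "0 \<le> d"
    unfolding d_def set_lebesgue_integral_def by (intro Bochner_Integration.integral_nonneg) auto
  \<comment> \<open>The window \<open>{c..c+l}\<close> contains \<open>t\<close> and stays inside
    the interval, also when \<open>t\<close> is near an end.\<close>
  define c where "c = max a (t - l)"
  have c: "a \<le> c" "c + l \<le> b" "c \<le> t" "t \<le> c + l" using t l by (auto simp: c_def)
  have cf: "continuous_on {a..b} f" using weak_deriv_continuous_on[OF w] .
  have i: "set_integrable lborel {a..b} (\<lambda>x. (f x)\<^sup>2)"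
    by (intro set_integrable_Icc_continuous continuous_intros cf)
  then have i': "set_integrable lborel {c..c+l} (\<lambda>x. (f x)\<^sup>2)"
    by (rule set_integrable_subset) (use c in auto)
  have le: "(f t)\<^sup>2 \<le> 2 * (f x)\<^sup>2 + 2 * l * d" if "x \<in> {c..c+l}" for x
  proof -
    have "(f t - f x)\<^sup>2 \<le> \<bar>t - x\<bar> * d" unfolding d_def
      by (rule weak_deriv_holder[OF w]) (use that c t in auto)
    also have "\<dots> \<le> l * d" using that c by (intro mult_right_mono d) auto
    finally have "(f t - f x)\<^sup>2 \<le> l * d" .
    moreover have "(f t)\<^sup>2 \<le> 2 * (f x)\<^sup>2 + 2 * (f t - f x)\<^sup>2"
      using zero_le_power2[of "f t - 2 * f x"] by (simp add: power2_eq_square algebra_simps)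
    ultimately show ?thesis by linarith
  qed
  have "(f t)\<^sup>2 * l = (LBINT x:{c..c+l}. (f t)\<^sup>2)"
    using l by (simp add: set_integral_Icc_const)
  also have "\<dots> \<le> (LBINT x:{c..c+l}. 2 * (f x)\<^sup>2 + 2 * l * d)"
    using le i' l by (intro set_integral_mono) (auto simp: set_integral_Icc_const)
  also have "\<dots> = 2 * (LBINT x:{c..c+l}. (f x)\<^sup>2) + l * (2 * l * d)"
    using i' l by (subst set_integral_add) (auto simp: set_integral_Icc_const)
  also have "\<dots> \<le> 2 * (LBINT x:{a..b}. (f x)\<^sup>2) + l * (2 * l * d)"
    using set_integral_nonneg_mono_set[OF i, of "{c..c+l}"] c by auto
  finally show ?thesis using l unfolding d_def[symmetric] by (simp add: field_simps)
qed

section \<open>Limits of weak derivatives and gluing of edge functions\<close>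

text \<open>Completeness of L^2 by way of L^1: on a bounded interval an L^2-Cauchy sequence is
  L^1-Cauchy, hence has a subsequence converging almost everywhere. Fatou carries the L^2 bound over
  to the limit for the whole sequence, and Cauchy-Schwarz passes the primitive to the limit.\<close>

lemma weak_deriv_L2_limit:
  assumes ab: "a \<le> b"
    and w: "\<And>n. weak_deriv a b (F n) (G n)"
    and cauchy: "\<And>e. e > 0 \<Longrightarrow> \<exists>N. \<forall>m\<ge>N. \<forall>n\<ge>N. (LBINT x:{a..b}. (G m x - G n x)\<^sup>2) \<le> e"
    and lim: "\<And>t. t \<in> {a..b} \<Longrightarrow> (\<lambda>n. F n t) \<longlonglongrightarrow> f t"
  shows "\<exists>g. weak_deriv a b f g \<and> (\<lambda>n. LBINT x:{a..b}. (G n x - g x)\<^sup>2) \<longlonglongrightarrow> 0"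
proof -
  define s where "s n x = indicator {a..b} x * G n x" for n x
  have si: "integrable lborel (s n)" for n
    using weak_derivD(1)[OF w[of n]] unfolding set_integrable_def s_def[abs_def] by simp
  have [measurable]: "s n \<in> borel_measurable borel" for n using si[of n] by auto
  have sq: "(\<lambda>x. (s n x)\<^sup>2) = (\<lambda>x. indicator {a..b} x *\<^sub>R (G n x)\<^sup>2)" for n
    by (auto simp: s_def fun_eq_iff indicator_def)
  have s2i: "integrable lborel (\<lambda>x. (s n x)\<^sup>2)" for n
    using weak_derivD(2)[OF w[of n]] unfolding set_integrable_def sq .
  have di: "integrable lborel (\<lambda>x. (s m x - s n x)\<^sup>2)" for m n
  proof (rule Bochner_Integration.integrable_bound)
    show "integrable lborel (\<lambda>x. 2 * (s m x)\<^sup>2 + 2 * (s n x)\<^sup>2)"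
      using s2i[of m] s2i[of n] by auto
    have "(x - y)\<^sup>2 \<le> 2 * x\<^sup>2 + 2 * y\<^sup>2" for x y :: real
      using zero_le_power2[of "x + y"] by (simp add: power2_eq_square algebra_simps)
    then show "AE x in lborel. norm ((s m x - s n x)\<^sup>2) \<le> norm (2 * (s m x)\<^sup>2 + 2 * (s n x)\<^sup>2)"
      by auto
  qed auto
  have deq: "(LBINT x:{a..b}. (G m x - G n x)\<^sup>2) = (LINT x|lborel. (s m x - s n x)\<^sup>2)" for m n
    unfolding set_lebesgue_integral_def by (rule Bochner_Integration.integral_cong) (auto simp: s_def indicator_def)
  have "\<exists>N. \<forall>i\<ge>N. \<forall>j\<ge>N. (LINT x|lborel. norm (s i x - s j x)) < e" if "e > 0" for e
  proof -
    \<comment> \<open>Young's inequality in the form |h| \<le> c + h^2 / (4c). The constant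
      integrates to at most e/4 by the choice of \<open>c\<close>, and the square gives e/4 as soon
      as the L^2 distance is at most \<open>c * e\<close>.\<close>
    define c where "c = e / (4 * (b - a) + 4)"
    have c: "c > 0" "c * (b - a) \<le> e / 4"
      using \<open>e > 0\<close> ab by (auto simp: c_def field_simps add_pos_nonneg)
    obtain N where N: "\<And>m n. m \<ge> N \<Longrightarrow> n \<ge> N \<Longrightarrow> (LBINT x:{a..b}. (G m x - G n x)\<^sup>2) \<le> c * e"
      using cauchy[of "c * e"] c \<open>e > 0\<close> by auto
    have "(LINT x|lborel. norm (s i x - s j x)) < e" if "i \<ge> N" "j \<ge> N" for i j
    proof -
      have ii: "integrable lborel (\<lambda>x. c * indicator {a..b} x)" using ab by (intro integrable_mult_right) simp
      have "(LINT x|lborel. norm (s i x - s j x)) \<le> (LINT x|lborel. c * indicator {a..b} x + (s i x - s j x)\<^sup>2 / (4 * c))"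
      proof (rule integral_mono)
        show "integrable lborel (\<lambda>x. norm (s i x - s j x))" using si by auto
        show "integrable lborel (\<lambda>x. c * indicator {a..b} x + (s i x - s j x)\<^sup>2 / (4 * c))"
          using ii di[of i j] by auto
        fix x
        have "\<bar>h\<bar> \<le> c + h\<^sup>2 / (4 * c)" for h :: real
          using zero_le_power2[of "\<bar>h\<bar> - 2 * c"] c by (simp add: field_simps power2_eq_square)
        then show "norm (s i x - s j x) \<le> c * indicator {a..b} x + (s i x - s j x)\<^sup>2 / (4 * c)"
          by (auto simp: s_def indicator_def)
      qed
      also have "\<dots> = c * (b - a) + (LINT x|lborel. (s i x - s j x)\<^sup>2) / (4 * c)"
        using ii di[of i j] ab by (subst Bochner_Integration.integral_add) auto
      also have "\<dots> \<le> e / 4 + (c * e) / (4 * c)"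
        using c N[OF that] by (intro add_mono divide_right_mono) (auto simp: deq)
      also have "\<dots> < e" using c \<open>e > 0\<close> by simp
      finally show ?thesis .
    qed
    then show ?thesis by blast
  qed
  from cauchy_L1_AE_cauchy_subseq[OF si this] obtain r
    where r: "strict_mono r" and ae: "AE x in lborel. Cauchy (\<lambda>i. s (r i) x)" by blast
  define g where "g x = lim (\<lambda>i. s (r i) x)" for x
  have [measurable]: "g \<in> borel_measurable borel"
    unfolding g_def[abs_def] by measurable
  have aelim: "AE x in lborel. (\<lambda>i. s (r i) x) \<longlonglongrightarrow> g x"
    using ae unfolding g_def by eventually_elim (simp add: Cauchy_convergent_iff convergent_LIMSEQ_iff)
  have g0: "g x = 0" if "x \<notin> {a..b}" for x
    using that by (simp add: g_def s_def)
  \<comment> \<open>Fatou along the subsequence, with \<open>n\<close> fixed: a Cauchy bound between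
    the members beyond \<open>N\<close> becomes a bound on the distance to \<open>g\<close>.\<close>
  have fatou: "integrable lborel (\<lambda>x. (s n x - g x)\<^sup>2) \<and> (LINT x|lborel. (s n x - g x)\<^sup>2) \<le> c"
    if N: "\<And>m n. m \<ge> N \<Longrightarrow> n \<ge> N \<Longrightarrow> (LBINT x:{a..b}. (G m x - G n x)\<^sup>2) \<le> c" and n: "n \<ge> N" and c: "c \<ge> 0" for n N c
  proof -
    have "(\<integral>\<^sup>+x. ennreal ((s n x - g x)\<^sup>2) \<partial>lborel) = (\<integral>\<^sup>+x. liminf (\<lambda>i. ennreal ((s n x - s (r i) x)\<^sup>2)) \<partial>lborel)"
    proof (rule nn_integral_cong_AE)
      show "AE x in lborel. ennreal ((s n x - g x)\<^sup>2) = liminf (\<lambda>i. ennreal ((s n x - s (r i) x)\<^sup>2))"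
        using aelim
      proof eventually_elim
        case (elim x)
        then have "(\<lambda>i. ennreal ((s n x - s (r i) x)\<^sup>2)) \<longlonglongrightarrow> ennreal ((s n x - g x)\<^sup>2)"
          by (intro tendsto_ennrealI tendsto_intros)
        then show ?case by (metis lim_imp_Liminf sequentially_bot)
      qed
    qed
    also have "\<dots> \<le> liminf (\<lambda>i. \<integral>\<^sup>+x. ennreal ((s n x - s (r i) x)\<^sup>2) \<partial>lborel)"
      by (rule nn_integral_liminf) auto
    also have "\<dots> \<le> ennreal c"
    proof -
      have "eventually (\<lambda>i. (\<integral>\<^sup>+x. ennreal ((s n x - s (r i) x)\<^sup>2) \<partial>lborel) \<le> ennreal c) sequentially"
        using eventually_ge_at_top[of N]
      proof eventually_elim
        case (elim i)
        then have "r i \<ge> N" using seq_suble[OF r, of i] by simp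
        then have "(LINT x|lborel. (s n x - s (r i) x)\<^sup>2) \<le> c" using N[OF n] deq by metis
        then show ?case by (subst nn_integral_eq_integral[OF di]) (auto intro: ennreal_leI)
      qed
      then show ?thesis by (intro Liminf_le) auto
    qed
    finally have le: "(\<integral>\<^sup>+x. ennreal ((s n x - g x)\<^sup>2) \<partial>lborel) \<le> ennreal c" .
    have int: "integrable lborel (\<lambda>x. (s n x - g x)\<^sup>2)"
      using le by (intro integrableI_nonneg) (auto simp: top.extremum_strict less_top[symmetric] top_unique dest: order_trans)
    moreover have "(LINT x|lborel. (s n x - g x)\<^sup>2) \<le> c"
      using le c by (subst (asm) nn_integral_eq_integral[OF int]) auto
    ultimately show ?thesis by simp
  qed
  have fat: "eventually (\<lambda>n. integrable lborel (\<lambda>x. (s n x - g x)\<^sup>2) \<and> (LINT x|lborel. (s n x - g x)\<^sup>2) \<le> c) sequentially" if "c > 0" for c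
  proof -
    obtain N where "\<forall>m\<ge>N. \<forall>n\<ge>N. (LBINT x:{a..b}. (G m x - G n x)\<^sup>2) \<le> c" using cauchy[OF \<open>c > 0\<close>] by blast
    then show ?thesis using \<open>c > 0\<close> fatou[of N c] unfolding eventually_sequentially by (intro exI[of _ N]) auto
  qed
  obtain n0 where n0: "integrable lborel (\<lambda>x. (s n0 x - g x)\<^sup>2)"
    using fat[of 1] unfolding eventually_sequentially by auto
  have g2i: "integrable lborel (\<lambda>x. (g x)\<^sup>2)"
  proof (rule Bochner_Integration.integrable_bound)
    show "integrable lborel (\<lambda>x. 2 * (s n0 x)\<^sup>2 + 2 * (s n0 x - g x)\<^sup>2)"
      using s2i[of n0] n0 by auto
    have "y\<^sup>2 \<le> 2 * x\<^sup>2 + 2 * (x - y)\<^sup>2" for x y :: real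
      using zero_le_power2[of "y - 2 * x"] by (simp add: power2_eq_square algebra_simps)
    then show "AE x in lborel. norm ((g x)\<^sup>2) \<le> norm (2 * (s n0 x)\<^sup>2 + 2 * (s n0 x - g x)\<^sup>2)"
      by auto
  qed auto
  have gi: "integrable lborel g"
  proof (rule Bochner_Integration.integrable_bound)
    show "integrable lborel (\<lambda>x. indicator {a..b} x + (g x)\<^sup>2)" using g2i ab by (intro Bochner_Integration.integrable_add) simp_all
    have "\<bar>y\<bar> \<le> 1 + y\<^sup>2" for y :: real
      using zero_le_power2[of "\<bar>y\<bar> - 1"] zero_le_power2[of y] by (simp add: power2_eq_square algebra_simps)
    then show "AE x in lborel. norm (g x) \<le> norm (indicator {a..b} x + (g x)\<^sup>2)"
      using g0 by (auto simp: indicator_def)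
  qed auto
  have gset: "set_integrable lborel {a..b} g" "set_integrable lborel {a..b} (\<lambda>t. (g t)\<^sup>2)"
    unfolding set_integrable_def by (intro integrable_mult_indicator gi g2i; simp)+
  have lim0: "(\<lambda>n. LBINT x:{a..b}. (G n x - g x)\<^sup>2) \<longlonglongrightarrow> 0"
  proof -
    have eq: "(LBINT x:{a..b}. (G n x - g x)\<^sup>2) = (LINT x|lborel. (s n x - g x)\<^sup>2)" for n
      unfolding set_lebesgue_integral_def 
      by (rule Bochner_Integration.integral_cong) (use g0 in \<open>auto simp: s_def indicator_def\<close>)
    show ?thesis unfolding eq
    proof (rule order_tendstoI)
      fix c :: real assume "c < 0"
      have "0 \<le> (LINT x|lborel. (s n x - g x)\<^sup>2)" for n by (rule Bochner_Integration.integral_nonneg) auto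
      with \<open>c < 0\<close> show "\<forall>\<^sub>F n in sequentially. c < (LINT x|lborel. (s n x - g x)\<^sup>2)"
        by (intro always_eventually) (auto intro: less_le_trans)
    next
      fix c :: real assume "0 < c"
      then have "c / 2 > 0" by simp
      from fat[OF this] show "\<forall>\<^sub>F n in sequentially. (LINT x|lborel. (s n x - g x)\<^sup>2) < c"
        by eventually_elim (use \<open>0 < c\<close> in auto)
    qed
  qed
  have "f t = f a + (LBINT x:{a..t}. g x)" if t: "t \<in> {a..b}" for t
  proof -
    have Gi: "set_integrable lborel {a..t} (G n)" "set_integrable lborel {a..t} g" 
      "set_integrable lborel {a..b} (\<lambda>x. (G n x - g x)\<^sup>2)" for n
    proof -
      show "set_integrable lborel {a..t} (G n)" "set_integrable lborel {a..t} g"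
        using gset(1) weak_derivD(1)[OF w[of n]] t by (auto intro: set_integrable_subset)
      have "set_integrable lborel {a..b} (\<lambda>x. (G n x + (- g x))\<^sup>2)"
        using gset weak_derivD(1,2)[OF w[of n]] by (intro set_integrable_power2_add) (auto simp: set_integrable_def)
      then show "set_integrable lborel {a..b} (\<lambda>x. (G n x - g x)\<^sup>2)" by simp
    qed
    have "(\<lambda>n. (LBINT x:{a..t}. G n x) - (LBINT x:{a..t}. g x)) \<longlonglongrightarrow> 0"
    proof (rule Lim_null_comparison)
      show "\<forall>\<^sub>F n in sequentially. norm ((LBINT x:{a..t}. G n x) - (LBINT x:{a..t}. g x)) \<le> sqrt ((b - a) * (LBINT x:{a..b}. (G n x - g x)\<^sup>2))"
      proof (intro always_eventually allI)
        fix n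
        have "((LBINT x:{a..t}. G n x) - (LBINT x:{a..t}. g x))\<^sup>2 = (LBINT x:{a..t}. G n x - g x)\<^sup>2"
          using Gi by (simp add: set_integral_diff)
        also have "\<dots> \<le> (t - a) * (LBINT x:{a..t}. (G n x - g x)\<^sup>2)"
          using Gi t by (intro set_integral_cauchy_schwarz) (auto intro: set_integrable_subset[OF Gi(3)] simp: set_integral_diff)
        also have "\<dots> \<le> (b - a) * (LBINT x:{a..b}. (G n x - g x)\<^sup>2)"
          using t by (intro mult_mono set_integral_nonneg_mono_set Gi)
            (auto simp: set_lebesgue_integral_def intro!: Bochner_Integration.integral_nonneg)
        finally show "norm ((LBINT x:{a..t}. G n x) - (LBINT x:{a..t}. g x)) \<le> sqrt ((b - a) * (LBINT x:{a..b}. (G n x - g x)\<^sup>2))"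
          by (simp add: real_le_rsqrt)
      qed
      show "(\<lambda>n. sqrt ((b - a) * (LBINT x:{a..b}. (G n x - g x)\<^sup>2))) \<longlonglongrightarrow> 0"
        using tendsto_real_sqrt[OF tendsto_mult_left[OF lim0, of "b - a"]] by simp
    qed
    then have "(\<lambda>n. LBINT x:{a..t}. G n x) \<longlonglongrightarrow> (LBINT x:{a..t}. g x)"
      by (rule LIM_zero_cancel)
    moreover have "(\<lambda>n. F n a) \<longlonglongrightarrow> f a" using lim ab by simp
    ultimately have "(\<lambda>n. F n a + (LBINT x:{a..t}. G n x)) \<longlonglongrightarrow> f a + (LBINT x:{a..t}. g x)"
      by (rule tendsto_add[rotated])
    moreover have "F n a + (LBINT x:{a..t}. G n x) = F n t" for n
      using weak_derivD(3)[OF w t] by simp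
    ultimately show ?thesis using lim[OF t] LIMSEQ_unique by fastforce
  qed
  then have "weak_deriv a b f g" using gset unfolding weak_deriv_def by blast
  with lim0 show ?thesis by blast
qed

section \<open>Continuity on the grid and functions assembled from edges\<close>

lemma weak_deriv_affine:
  "weak_deriv a b (\<lambda>t. c + d * (t - a)) (\<lambda>_. d)"
proof -
  have "set_integrable lborel {a..b} (\<lambda>_. k)" for k :: real
    by (intro set_integrable_Icc_continuous continuous_intros)
  then show ?thesis unfolding weak_deriv_def by (auto simp: set_integral_Icc_const)
qed

text \<open>Each edge is closed and the grid is locally finite, so near any point the function is a
  pasting of finitely many continuous pieces on closed sets.\<close>

lemma continuous_on_grid:
  assumes eps: "eps > 0" and c: "\<And>e. continuous_on {0..eps} (edge_fun eps u e)"
  shows "continuous_on (grid eps) u"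
proof -
  define U where "U e = edge_pt eps e ` {0..eps}" for e
  have cU: "closed (U e)" for e
  proof -
    have "continuous_on {0..eps} (edge_pt eps e)"
      unfolding edge_pt_def by (cases "snd e") (auto simp: vtx_def intro!: continuous_intros)
    then show ?thesis unfolding U_def by (intro compact_imp_closed compact_continuous_image) auto
  qed
  have uU: "continuous_on (U e) u" for e
  proof -
    define \<tau> where "\<tau> x = (if snd e then fst x - eps * of_int (fst (fst e)) else snd x - eps * of_int (snd (fst e)))" for x :: "real \<times> real"
    have \<tau>: "\<tau> (edge_pt eps e t) = t" for t by (auto simp: \<tau>_def edge_pt_def vtx_def)
    have "continuous_on (U e) (\<lambda>x. edge_fun eps u e (\<tau> x))"
    proof (rule continuous_on_compose2[OF c])
      show "continuous_on (U e) \<tau>" unfolding \<tau>_def[abs_def] by (cases "snd e") (auto intro!: continuous_intros)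
      show "\<tau> ` U e \<subseteq> {0..eps}" using \<tau> by (auto simp: U_def)
    qed
    moreover have "edge_fun eps u e (\<tau> x) = u x" if "x \<in> U e" for x
      using that \<tau> by (auto simp: U_def edge_fun_def)
    ultimately show ?thesis by (simp cong: continuous_on_cong)
  qed
  show ?thesis unfolding continuous_on_eq_continuous_within
  proof
    fix x assume x: "x \<in> grid eps"
    define i where "i = \<lfloor>fst x / eps\<rfloor>" define j where "j = \<lfloor>snd x / eps\<rfloor>"
    \<comment> \<open>If an edge meets the ball of radius \<open>eps\<close> around
      \<open>x\<close>, its base vertex is within \<open>2 * eps\<close> of \<open>x\<close> in each
      coordinate. After rounding down, its index differs from \<open>(i, j)\<close> by at most
      3.\<close>
    define S :: "grid_edge set" where "S = ({i-3..i+3} \<times> {j-3..j+3}) \<times> UNIV"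
    have "continuous_on (\<Union>e\<in>S. U e) u"
      by (rule continuous_on_closed_Union) (auto simp: S_def cU uU)
    moreover have sub: "grid eps \<inter> ball x eps \<subseteq> (\<Union>e\<in>S. U e)"
    proof
      fix y assume y: "y \<in> grid eps \<inter> ball x eps"
      then obtain k d t where e: "y = edge_pt eps (k,d) t" "0 \<le> t" "t \<le> eps"
        by (auto simp: grid_def)
      have d1: "\<bar>fst x - fst y\<bar> < eps" "\<bar>snd x - snd y\<bar> < eps"
        using y dist_fst_le[of x y] dist_snd_le[of x y] by (auto simp: dist_real_def)
      have f: "\<bar>fst y - eps * of_int (fst k)\<bar> \<le> eps" "\<bar>snd y - eps * of_int (snd k)\<bar> \<le> eps"
        using e eps by (auto simp: edge_pt_def vtx_def)
      have q: "\<bar>m - \<lfloor>z / eps\<rfloor>\<bar> \<le> 3" if "\<bar>z - w\<bar> < eps" "\<bar>w - eps * of_int m\<bar> \<le> eps" for z w :: real and m :: int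
      proof -
        have "\<bar>z - eps * of_int m\<bar> < 2 * eps" using that by linarith
        moreover have "z - eps * of_int m = eps * (z / eps - of_int m)" using eps by (simp add: field_simps)
        ultimately have "eps * \<bar>z / eps - of_int m\<bar> < eps * 2" using eps by (simp add: abs_mult)
        then have "\<bar>z / eps - of_int m\<bar> < 2" using eps by (metis mult_less_cancel_left_pos)
        then show ?thesis by linarith
      qed
      have "(k, d) \<in> S" using q[OF d1(1) f(1)] q[OF d1(2) f(2)]
        unfolding S_def i_def j_def by (cases k) auto
      then show "y \<in> (\<Union>e\<in>S. U e)" using e by (intro UN_I[of "(k,d)"]) (auto simp: U_def)
    qed
    moreover have "x \<in> grid eps \<inter> ball x eps" using x eps by auto
    ultimately have "continuous (at x within (\<Union>e\<in>S. U e)) u"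
      by (auto simp: continuous_on_eq_continuous_within)
    then have "continuous (at x within grid eps \<inter> ball x eps) u"
      using sub by (rule continuous_within_subset)
    then show "continuous (at x within grid eps) u"
      using at_within_nhd[of x "ball x eps" "grid eps \<inter> ball x eps" "grid eps"] eps by simp
  qed
qed

definition edge_end :: "grid_edge \<Rightarrow> int \<times> int" where
  "edge_end e = (if snd e then (fst (fst e) + 1, snd (fst e)) else (fst (fst e), snd (fst e) + 1))"

lemma grid_gluing:
  fixes F :: "grid_edge \<Rightarrow> real \<Rightarrow> real" and \<phi> :: "int \<times> int \<Rightarrow> real"
  assumes eps: "eps > 0" and F0: "\<And>e. F e 0 = \<phi> (fst e)" and F1: "\<And>e. F e eps = \<phi> (edge_end e)"
  obtains u where "\<And>e t. t \<in> {0..eps} \<Longrightarrow> edge_fun eps u e t = F e t" "\<And>k. u (vtx eps k) = \<phi> k"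
proof -
  \<comment> \<open>Vertices fall into the horizontal case with parameter 0, so \<open>F0\<close>
    gives their value. An interior point of a vertical edge has a non-integral second coordinate and
    is thereby recognised. The values off the grid do not matter.\<close>
  define u where "u x = (let i = \<lfloor>fst x / eps\<rfloor>; j = \<lfloor>snd x / eps\<rfloor> in
    if snd x / eps \<in> \<int> then F ((i, j), True) (fst x - eps * i) else F ((i, j), False) (snd x - eps * j))" for x
  have vertex: "u (vtx eps k) = \<phi> k" for k
    using eps F0[of "(k, True)"] by (simp add: u_def vtx_def)
  have "edge_fun eps u e t = F e t" if t: "t \<in> {0..eps}" for e t
  proof -
    obtain i j b where e: "e = ((i, j), b)" by (metis surj_pair)
    consider "t = 0" | "t = eps" | "0 < t" "t < eps" using t by fastforce
    then show ?thesis
    proof cases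
      case 1
      then have "edge_pt eps e t = vtx eps (fst e)" by (simp add: edge_pt_def vtx_def)
      then show ?thesis using 1 F0[of e] by (simp add: edge_fun_def vertex)
    next
      case 2
      then have "edge_pt eps e t = vtx eps (edge_end e)" by (simp add: edge_pt_def vtx_def edge_end_def algebra_simps)
      then show ?thesis using 2 F1[of e] by (simp add: edge_fun_def vertex)
    next
      case 3
      have div: "(eps * of_int k + t) / eps = of_int k + t / eps" for k :: int using eps by (simp add: add_divide_distrib)
      have fl: "\<lfloor>t / eps\<rfloor> = 0" using 3 eps by (intro floor_unique) auto
      have "t / eps \<notin> \<int>" using 3 eps frac_eq_0_iff[of "t / eps"] fl by (simp add: frac_def)
      then show ?thesis using eps by (cases b) (simp_all add: edge_fun_def edge_pt_def vtx_def u_def e div fl)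
    qed
  qed
  then show ?thesis using that vertex by blast
qed

section \<open>Estimates on one edge\<close>

text \<open>The mean value theorem gives a factor \<open>a powr (r - 1)\<close>, of which
  \<open>a powr (r - 2)\<close> is absorbed by the bound \<open>S\<close>. The remaining a * (a - b)
  is split by Young's inequality, which leaves squares only. Summed over edges or vertices, this
  controls the changes of \<open>P\<close> and \<open>Q\<close> by those of \<open>M\<close> and
  \<open>Y\<close>.\<close>

lemma abs_powr_diff_le:
  fixes x y S r \<kappa> :: real
  assumes r: "2 \<le> r" and S: "\<bar>x\<bar> \<le> S" "\<bar>y\<bar> \<le> S" and \<kappa>: "\<kappa> > 0"
  shows "\<bar>\<bar>x\<bar> powr r - \<bar>y\<bar> powr r\<bar> \<le> r * S powr (r - 2) * (\<kappa> * (x\<^sup>2 + y\<^sup>2) + (x - y)\<^sup>2 / \<kappa>)"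
proof -
  have mvt: "a powr r - b powr r \<le> r * a powr (r - 1) * (a - b)" if "0 \<le> b" "b \<le> a" for a b :: real
  proof (cases "b = 0 \<or> a = b")
    case True
    have "a * a powr (r - 1) = a powr r" using that powr_mult_base[of a "r - 1"] by simp
    moreover have "a powr r \<le> r * a powr r" using r by (simp add: mult_le_cancel_right1)
    ultimately show ?thesis using True r by (auto simp: algebra_simps)
  next
    case False
    then have ab: "0 < b" "b < a" using that by auto
    have "\<exists>z. b < z \<and> z < a \<and> a powr r - b powr r = (a - b) * (r * z powr (r - 1))"
      using ab by (intro MVT2) (auto intro!: derivative_eq_intros simp: field_simps powr_diff)
    then obtain z where z: "b < z" "z < a" "a powr r - b powr r = (a - b) * (r * z powr (r - 1))" by blast
    have "z powr (r - 1) \<le> a powr (r - 1)" using z ab r by (intro powr_mono2) auto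
    then have "(a - b) * (r * z powr (r - 1)) \<le> (a - b) * (r * a powr (r - 1))"
      using ab r by (intro mult_left_mono) auto
    then show ?thesis using z by (simp add: algebra_simps)
  qed
  have main: "a powr r - b powr r \<le> r * S powr (r - 2) * (\<kappa> * (a\<^sup>2 + b\<^sup>2) + (a - b)\<^sup>2 / \<kappa>)" if "0 \<le> b" "b \<le> a" "a \<le> S" for a b
  proof -
    have "a powr (r - 1) = a * a powr (r - 2)" using that powr_mult_base[of a "r - 2"] by (simp add: algebra_simps)
    then have "a powr r - b powr r \<le> r * a powr (r - 2) * (a * (a - b))" using mvt[OF that(1,2)] by (simp add: mult_ac)
    also have "\<dots> \<le> r * S powr (r - 2) * (a * (a - b))"
      using that r by (intro mult_right_mono mult_left_mono powr_mono2) auto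
    also have "a * (a - b) \<le> \<kappa> * (a\<^sup>2 + b\<^sup>2) + (a - b)\<^sup>2 / \<kappa>"
    proof -
      have "0 \<le> (2 * \<kappa> * a - (a - b))\<^sup>2" by simp
      then have "4 * \<kappa> * (a * (a - b)) \<le> 4 * \<kappa>\<^sup>2 * a\<^sup>2 + (a - b)\<^sup>2" by (simp add: power2_eq_square algebra_simps)
      also have "\<dots> \<le> 4 * \<kappa> * (\<kappa> * (a\<^sup>2 + b\<^sup>2) + (a - b)\<^sup>2 / \<kappa>)"
      proof -
        have "0 \<le> 4 * \<kappa>\<^sup>2 * b\<^sup>2 + 3 * (a - b)\<^sup>2" by simp
        moreover have "4 * \<kappa> * (\<kappa> * (a\<^sup>2 + b\<^sup>2) + (a - b)\<^sup>2 / \<kappa>) = 4 * \<kappa>\<^sup>2 * a\<^sup>2 + (a - b)\<^sup>2 + (4 * \<kappa>\<^sup>2 * b\<^sup>2 + 3 * (a - b)\<^sup>2)"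
          using \<kappa> by (simp add: power2_eq_square field_simps)
        ultimately show ?thesis by linarith
      qed
      finally show ?thesis using \<kappa> by simp
    qed
    finally show ?thesis using r by (auto simp: mult_left_mono)
  qed
  have sq: "(\<bar>x\<bar> - \<bar>y\<bar>)\<^sup>2 \<le> (x - y)\<^sup>2"
    using abs_triangle_ineq3[of x y] abs_le_square_iff[of "\<bar>x\<bar> - \<bar>y\<bar>" "x - y"] by simp
  have sym: "(\<bar>y\<bar> - \<bar>x\<bar>)\<^sup>2 = (\<bar>x\<bar> - \<bar>y\<bar>)\<^sup>2" by (rule power2_commute)
  have "\<bar>\<bar>x\<bar> powr r - \<bar>y\<bar> powr r\<bar> \<le> r * S powr (r - 2) * (\<kappa> * (x\<^sup>2 + y\<^sup>2) + (\<bar>x\<bar> - \<bar>y\<bar>)\<^sup>2 / \<kappa>)"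
  proof (cases "\<bar>y\<bar> \<le> \<bar>x\<bar>")
    case True
    have "\<bar>y\<bar> powr r \<le> \<bar>x\<bar> powr r" using True r by (intro powr_mono2) auto
    with main[of "\<bar>y\<bar>" "\<bar>x\<bar>"] True S show ?thesis by simp
  next
    case False
    have "\<bar>x\<bar> powr r \<le> \<bar>y\<bar> powr r" using False r by (intro powr_mono2) auto
    with main[of "\<bar>x\<bar>" "\<bar>y\<bar>"] False S show ?thesis unfolding sym by (simp add: add.commute)
  qed
  also have "\<dots> \<le> r * S powr (r - 2) * (\<kappa> * (x\<^sup>2 + y\<^sup>2) + (x - y)\<^sup>2 / \<kappa>)"
    using r \<kappa> sq by (intro mult_left_mono add_left_mono divide_right_mono) auto
  finally show ?thesis .
qed

lemma abs_powr_2: "\<bar>x::real\<bar> powr 2 = x\<^sup>2"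
  by (cases "x = 0") auto

lemma abs_powr_le_square:
  fixes x S r :: real
  assumes "2 \<le> r" "\<bar>x\<bar> \<le> S"
  shows "\<bar>x\<bar> powr r \<le> S powr (r - 2) * x\<^sup>2"
proof -
  have "\<bar>x\<bar> powr r = \<bar>x\<bar> powr (r - 2) * x\<^sup>2"
  proof (cases "x = 0")
    case False
    have "\<bar>x\<bar> powr r = \<bar>x\<bar> powr (r - 2) * \<bar>x\<bar> powr 2" unfolding powr_add[symmetric] by simp
    then show ?thesis by (simp only: abs_powr_2)
  qed auto
  also have "\<dots> \<le> S powr (r - 2) * x\<^sup>2" using assms by (intro mult_right_mono powr_mono2) auto
  finally show ?thesis .
qed

section \<open>Mass and derivative norm of a single edge\<close>

locale grid_graph =
  fixes eps :: real
  assumes eps_pos: "0 < eps"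
begin

abbreviation "ef \<equiv> edge_fun eps"
abbreviation "em u \<equiv> edge_Lr eps u 2"
abbreviation "ed \<equiv> edge_dnorm2 eps"
abbreviation "M u \<equiv> Lr_pow eps u 2"
abbreviation "D \<equiv> dnorm2 eps"

definition edge_H1 :: "(real \<times> real \<Rightarrow> real) \<Rightarrow> bool" where
  "edge_H1 u \<longleftrightarrow> (\<forall>e. \<exists>g. weak_deriv 0 eps (ef u e) g)"

lemma edge_dnorm2_eq:
  assumes "weak_deriv 0 eps (ef u e) g"
  shows "ed u e = (LBINT t:{0..eps}. (g t)\<^sup>2)"
  unfolding edge_dnorm2_def
  by (rule weak_deriv_square_integral_unique[OF someI[of _ g] assms]) (rule assms)

lemma edge_mass_eq: "em u e = (LBINT t:{0..eps}. (ef u e t)\<^sup>2)"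
  unfolding edge_Lr_def by (simp only: abs_powr_2)

lemma edge_Lr_nonneg: "0 \<le> edge_Lr eps u r e"
  unfolding edge_Lr_def set_lebesgue_integral_def by (intro Bochner_Integration.integral_nonneg) auto

lemma edge_dnorm2_nonneg: "0 \<le> ed u e"
  unfolding edge_dnorm2_def set_lebesgue_integral_def by (intro Bochner_Integration.integral_nonneg) auto

lemma edge_Lr_cong:
  assumes "\<And>t. t \<in> {0..eps} \<Longrightarrow> ef u e t = ef v e' t"
  shows "edge_Lr eps u r e = edge_Lr eps v r e'"
  unfolding edge_Lr_def by (rule set_lebesgue_integral_cong) (auto simp: assms)

lemma edge_dnorm2_cong:
  assumes "\<And>t. t \<in> {0..eps} \<Longrightarrow> ef u e t = ef v e' t"
  shows "ed u e = ed v e'"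
proof -
  have "weak_deriv 0 eps (ef u e) = weak_deriv 0 eps (ef v e')"
    by (intro ext weak_deriv_cong) (rule assms)
  then show ?thesis unfolding edge_dnorm2_def by simp
qed

lemma edge_H1_continuous: "edge_H1 u \<Longrightarrow> continuous_on {0..eps} (ef u e)"
  unfolding edge_H1_def using weak_deriv_continuous_on by blast

text \<open>Continuity on the grid is automatic: \<open>u\<close> is one function on the plane, so
  its edge functions agree at common vertices, and a weak derivative makes each of them
  continuous.\<close>

lemma H1_iff:
  "u \<in> H1 eps \<longleftrightarrow> edge_H1 u \<and> em u summable_on UNIV \<and> ed u summable_on UNIV"
  unfolding H1_def using continuous_on_grid[OF eps_pos] edge_H1_continuous
  by (auto simp: edge_H1_def)

lemma ef_linear: "ef (\<lambda>x. c * u x + d * v x) e = (\<lambda>t. c * ef u e t + d * ef v e t)"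
  by (simp add: edge_fun_def fun_eq_iff)

lemma edge_H1_linear:
  assumes "edge_H1 u" "edge_H1 v"
  shows "edge_H1 (\<lambda>x. c * u x + d * v x)"
  unfolding edge_H1_def ef_linear using assms weak_deriv_linear unfolding edge_H1_def by blast

lemma edge_H1_add: "edge_H1 u \<Longrightarrow> edge_H1 v \<Longrightarrow> edge_H1 (\<lambda>x. u x + v x)"
  using edge_H1_linear[of u v 1 1] by simp

lemma edge_H1_diff: "edge_H1 u \<Longrightarrow> edge_H1 v \<Longrightarrow> edge_H1 (\<lambda>x. u x - v x)"
  using edge_H1_linear[of u v 1 "-1"] by simp

lemma edge_H1_scale: "edge_H1 u \<Longrightarrow> edge_H1 (\<lambda>x. c * u x)"
  using edge_H1_linear[of u u c 0] by simp

lemma ed_diff_eq: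
  assumes g: "weak_deriv 0 eps (ef u e) g" and h: "weak_deriv 0 eps (ef v e) h"
  shows "ed (\<lambda>x. u x - v x) e = (LBINT t:{0..eps}. (g t - h t)\<^sup>2)"
proof -
  have "weak_deriv 0 eps (ef (\<lambda>x. 1 * u x + (-1) * v x) e) (\<lambda>t. 1 * g t + (-1) * h t)"
    unfolding ef_linear by (rule weak_deriv_linear[OF g h])
  from edge_dnorm2_eq[OF this] show ?thesis by simp
qed

lemma ed_scale:
  assumes "edge_H1 u"
  shows "ed (\<lambda>x. c * u x) e = c\<^sup>2 * ed u e"
proof -
  obtain g where g: "weak_deriv 0 eps (ef u e) g" using assms unfolding edge_H1_def by blast
  have "weak_deriv 0 eps (ef (\<lambda>x. c * u x + 0 * u x) e) (\<lambda>t. c * g t + 0 * g t)"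
    unfolding ef_linear by (rule weak_deriv_linear[OF g g])
  from edge_dnorm2_eq[OF this] edge_dnorm2_eq[OF g] show ?thesis by (simp add: power_mult_distrib)
qed

lemma edge_Lr_scale: "edge_Lr eps (\<lambda>x. c * u x) r e = \<bar>c\<bar> powr r * edge_Lr eps u r e"
  unfolding edge_Lr_def edge_fun_def by (simp add: abs_mult powr_mult)

lemma em_parallelogram:
  assumes "edge_H1 u" "edge_H1 v"
  shows "em (\<lambda>x. u x + v x) e + em (\<lambda>x. u x - v x) e = 2 * em u e + 2 * em v e"
proof -
  note c = edge_H1_continuous[OF assms(1), of e] edge_H1_continuous[OF assms(2), of e]
  have i: "set_integrable lborel {0..eps} (\<lambda>t. (ef u e t)\<^sup>2)" "set_integrable lborel {0..eps} (\<lambda>t. (ef v e t)\<^sup>2)"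
     "set_integrable lborel {0..eps} (\<lambda>t. (ef u e t + ef v e t)\<^sup>2)" "set_integrable lborel {0..eps} (\<lambda>t. (ef u e t - ef v e t)\<^sup>2)"
    by (intro set_integrable_Icc_continuous continuous_intros c)+
  have "em (\<lambda>x. u x + v x) e + em (\<lambda>x. u x - v x) e = (LBINT t:{0..eps}. (ef u e t + ef v e t)\<^sup>2 + (ef u e t - ef v e t)\<^sup>2)"
    using i by (simp add: edge_mass_eq edge_fun_def set_integral_add)
  also have "\<dots> = (LBINT t:{0..eps}. 2 * (ef u e t)\<^sup>2 + 2 * (ef v e t)\<^sup>2)"
    by (rule set_lebesgue_integral_cong) (auto simp: power2_eq_square algebra_simps)
  also have "\<dots> = 2 * em u e + 2 * em v e"
    using i by (simp add: edge_mass_eq set_integral_add)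
  finally show ?thesis .
qed

lemma ed_parallelogram:
  assumes "edge_H1 u" "edge_H1 v"
  shows "ed (\<lambda>x. u x + v x) e + ed (\<lambda>x. u x - v x) e = 2 * ed u e + 2 * ed v e"
proof -
  obtain g h where g: "weak_deriv 0 eps (ef u e) g" and h: "weak_deriv 0 eps (ef v e) h"
    using assms unfolding edge_H1_def by blast 
  have p: "weak_deriv 0 eps (ef (\<lambda>x. 1 * u x + 1 * v x) e) (\<lambda>t. 1 * g t + 1 * h t)"
    unfolding ef_linear by (rule weak_deriv_linear[OF g h])
  have m: "weak_deriv 0 eps (ef (\<lambda>x. 1 * u x + (-1) * v x) e) (\<lambda>t. 1 * g t + (-1) * h t)"
    unfolding ef_linear by (rule weak_deriv_linear[OF g h])
  have i: "set_integrable lborel {0..eps} (\<lambda>t. (g t + h t)\<^sup>2)" "set_integrable lborel {0..eps} (\<lambda>t. (g t - h t)\<^sup>2)"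
    using weak_derivD(2)[OF p] weak_derivD(2)[OF m] by simp_all
  have "ed (\<lambda>x. u x + v x) e + ed (\<lambda>x. u x - v x) e = (LBINT t:{0..eps}. (g t + h t)\<^sup>2 + (g t - h t)\<^sup>2)"
    using edge_dnorm2_eq[OF p] edge_dnorm2_eq[OF m] i by (simp add: set_integral_add)
  also have "\<dots> = (LBINT t:{0..eps}. 2 * (g t)\<^sup>2 + 2 * (h t)\<^sup>2)"
    by (rule set_lebesgue_integral_cong) (auto simp: power2_eq_square algebra_simps)
  also have "\<dots> = 2 * ed u e + 2 * ed v e"
    using weak_derivD(2)[OF g] weak_derivD(2)[OF h] by (simp add: edge_dnorm2_eq[OF g] edge_dnorm2_eq[OF h] set_integral_add)
  finally show ?thesis .
qed

lemma em_diff_le: "edge_H1 u \<Longrightarrow> edge_H1 v \<Longrightarrow> em (\<lambda>x. u x - v x) e \<le> 2 * em u e + 2 * em v e"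
  and em_add_le: "edge_H1 u \<Longrightarrow> edge_H1 v \<Longrightarrow> em (\<lambda>x. u x + v x) e \<le> 2 * em u e + 2 * em v e"
  using em_parallelogram[of u v e] edge_Lr_nonneg[of "\<lambda>x. u x + v x" 2 e] edge_Lr_nonneg[of "\<lambda>x. u x - v x" 2 e] by simp_all

lemma ed_diff_le: "edge_H1 u \<Longrightarrow> edge_H1 v \<Longrightarrow> ed (\<lambda>x. u x - v x) e \<le> 2 * ed u e + 2 * ed v e"
  and ed_add_le: "edge_H1 u \<Longrightarrow> edge_H1 v \<Longrightarrow> ed (\<lambda>x. u x + v x) e \<le> 2 * ed u e + 2 * ed v e"
  using ed_parallelogram[of u v e] edge_dnorm2_nonneg[of "\<lambda>x. u x + v x" e] edge_dnorm2_nonneg[of "\<lambda>x. u x - v x" e] by simp_all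

text \<open>Factor g^2 - h^2 = (g + h) * (g - h) and apply Young's inequality. The derivative norm
  is thus continuous along sequences that converge in it.\<close>

lemma ed_perturb:
  assumes "edge_H1 u" "edge_H1 v" "\<kappa> > 0"
  shows "\<bar>ed u e - ed v e\<bar> \<le> \<kappa> * (ed u e + ed v e) + ed (\<lambda>x. u x - v x) e / \<kappa>"
proof -
  obtain g h where g: "weak_deriv 0 eps (ef u e) g" and h: "weak_deriv 0 eps (ef v e) h"
    using assms unfolding edge_H1_def by blast 
  have i: "set_integrable lborel {0..eps} (\<lambda>t. (g t)\<^sup>2)" "set_integrable lborel {0..eps} (\<lambda>t. (h t)\<^sup>2)"
    using weak_derivD(2)[OF g] weak_derivD(2)[OF h] .
  have i2: "set_integrable lborel {0..eps} (\<lambda>t. (g t - h t)\<^sup>2)"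
    using weak_derivD(2)[OF weak_deriv_linear[OF g h, of 1 "-1"]] by simp
  have le: "g\<^sup>2 - h\<^sup>2 \<le> \<kappa> * (g\<^sup>2 + h\<^sup>2) + (g - h)\<^sup>2 / \<kappa>" for g h :: real
  proof -
    have "0 \<le> (\<kappa> * (g + h) - (g - h))\<^sup>2" by simp
    then have "2 * \<kappa> * (g\<^sup>2 - h\<^sup>2) \<le> \<kappa>\<^sup>2 * (g + h)\<^sup>2 + (g - h)\<^sup>2" by (simp add: power2_eq_square algebra_simps)
    also have "\<dots> \<le> \<kappa>\<^sup>2 * (2 * (g\<^sup>2 + h\<^sup>2)) + 2 * (g - h)\<^sup>2"
    proof (intro add_mono mult_left_mono)
      show "(g + h)\<^sup>2 \<le> 2 * (g\<^sup>2 + h\<^sup>2)" using zero_le_power2[of "g - h"] by (simp add: power2_eq_square algebra_simps)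
    qed auto
    also have "\<dots> = 2 * \<kappa> * (\<kappa> * (g\<^sup>2 + h\<^sup>2) + (g - h)\<^sup>2 / \<kappa>)" using \<open>\<kappa> > 0\<close> by (simp add: power2_eq_square field_simps)
    finally show ?thesis using \<open>\<kappa> > 0\<close> by simp
  qed
  have R: "\<kappa> * (ed u e + ed v e) + ed (\<lambda>x. u x - v x) e / \<kappa> = (LBINT t:{0..eps}. \<kappa> * ((g t)\<^sup>2 + (h t)\<^sup>2) + (g t - h t)\<^sup>2 / \<kappa>)"
    using i i2 by (simp add: edge_dnorm2_eq[OF g] edge_dnorm2_eq[OF h] ed_diff_eq[OF g h] set_integral_add)
  have Ri: "set_integrable lborel {0..eps} (\<lambda>t. \<kappa> * ((g t)\<^sup>2 + (h t)\<^sup>2) + (g t - h t)\<^sup>2 / \<kappa>)"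
    using i i2 by (intro set_integral_add) auto
  have "ed u e - ed v e = (LBINT t:{0..eps}. (g t)\<^sup>2 - (h t)\<^sup>2)"
    using i by (simp add: edge_dnorm2_eq[OF g] edge_dnorm2_eq[OF h] set_integral_diff)
  also have "\<dots> \<le> (LBINT t:{0..eps}. \<kappa> * ((g t)\<^sup>2 + (h t)\<^sup>2) + (g t - h t)\<^sup>2 / \<kappa>)"
    by (intro set_integral_mono set_integral_diff(1) i Ri le)
  finally have "ed u e - ed v e \<le> \<kappa> * (ed u e + ed v e) + ed (\<lambda>x. u x - v x) e / \<kappa>" unfolding R .
  moreover
  have "ed v e - ed u e = (LBINT t:{0..eps}. (h t)\<^sup>2 - (g t)\<^sup>2)"
    using i by (simp add: edge_dnorm2_eq[OF g] edge_dnorm2_eq[OF h] set_integral_diff)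
  then have "ed v e - ed u e \<le> \<kappa> * (ed u e + ed v e) + ed (\<lambda>x. u x - v x) e / \<kappa>" unfolding R
    using set_integral_mono[OF set_integral_diff(1)[OF i(2,1)] Ri] le[of "h _" "g _"]
    by (simp add: add.commute power2_commute)
  ultimately show ?thesis by linarith
qed

lemma edge_sup_bound:
  assumes "edge_H1 u" "t \<in> {0..eps}" "0 < l" "l \<le> eps"
  shows "(ef u e t)\<^sup>2 \<le> 2 * em u e / l + 2 * l * ed u e"
proof -
  obtain g where g: "weak_deriv 0 eps (ef u e) g" using assms unfolding edge_H1_def by blast
  from weak_deriv_sup_bound[OF g assms(2,3)] assms(4) show ?thesis
    by (simp add: edge_dnorm2_eq[OF g] edge_mass_eq)
qed

lemma edge_holder:
  assumes "edge_H1 u" "s \<in> {0..eps}" "t \<in> {0..eps}"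
  shows "(ef u e t - ef u e s)\<^sup>2 \<le> \<bar>t - s\<bar> * ed u e"
proof -
  obtain g where g: "weak_deriv 0 eps (ef u e) g" using assms unfolding edge_H1_def by blast
  from weak_deriv_holder[OF g assms(2,3)] show ?thesis
    by (simp add: edge_dnorm2_eq[OF g])
qed

lemma edge_Lr_perturb:
  assumes "edge_H1 u" "edge_H1 v" "\<kappa> > 0" "2 \<le> r" 
    and S: "\<And>t. t \<in> {0..eps} \<Longrightarrow> \<bar>ef u e t\<bar> \<le> S" "\<And>t. t \<in> {0..eps} \<Longrightarrow> \<bar>ef v e t\<bar> \<le> S"
  shows "\<bar>edge_Lr eps u r e - edge_Lr eps v r e\<bar> \<le> r * S powr (r - 2) * (\<kappa> * (em u e + em v e) + em (\<lambda>x. u x - v x) e / \<kappa>)"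
proof -
  note c = edge_H1_continuous[OF assms(1), of e] edge_H1_continuous[OF assms(2), of e]
  have i: "set_integrable lborel {0..eps} (\<lambda>t. (ef u e t)\<^sup>2)" "set_integrable lborel {0..eps} (\<lambda>t. (ef v e t)\<^sup>2)"
     "set_integrable lborel {0..eps} (\<lambda>t. (ef u e t - ef v e t)\<^sup>2)"
    by (intro set_integrable_Icc_continuous continuous_intros c)+
  have j: "set_integrable lborel {0..eps} (\<lambda>t. \<bar>ef u e t\<bar> powr r)" "set_integrable lborel {0..eps} (\<lambda>t. \<bar>ef v e t\<bar> powr r)"
    using \<open>2 \<le> r\<close> by (intro set_integrable_Icc_continuous continuous_on_powr' continuous_intros c; auto)+
  have R: "r * S powr (r - 2) * (\<kappa> * (em u e + em v e) + em (\<lambda>x. u x - v x) e / \<kappa>)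
     = (LBINT t:{0..eps}. r * S powr (r - 2) * (\<kappa> * ((ef u e t)\<^sup>2 + (ef v e t)\<^sup>2) + (ef u e t - ef v e t)\<^sup>2 / \<kappa>))"
    using i by (simp add: edge_mass_eq edge_fun_def set_integral_add)
  have Ri: "set_integrable lborel {0..eps} (\<lambda>t. r * S powr (r - 2) * (\<kappa> * ((ef u e t)\<^sup>2 + (ef v e t)\<^sup>2) + (ef u e t - ef v e t)\<^sup>2 / \<kappa>))"
    using i by (intro set_integrable_mult_right set_integral_add) auto
  have le: "\<bar>\<bar>ef u e t\<bar> powr r - \<bar>ef v e t\<bar> powr r\<bar> \<le> r * S powr (r - 2) * (\<kappa> * ((ef u e t)\<^sup>2 + (ef v e t)\<^sup>2) + (ef u e t - ef v e t)\<^sup>2 / \<kappa>)"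
    if "t \<in> {0..eps}" for t
    by (rule abs_powr_diff_le) (use assms that in auto)
  have "edge_Lr eps u r e - edge_Lr eps v r e = (LBINT t:{0..eps}. \<bar>ef u e t\<bar> powr r - \<bar>ef v e t\<bar> powr r)"
    unfolding edge_Lr_def using j by (simp add: set_integral_diff)
  also have "\<dots> \<le> (LBINT t:{0..eps}. r * S powr (r - 2) * (\<kappa> * ((ef u e t)\<^sup>2 + (ef v e t)\<^sup>2) + (ef u e t - ef v e t)\<^sup>2 / \<kappa>))"
    by (rule set_integral_mono[OF set_integral_diff(1)[OF j] Ri]) (use le in fastforce)
  finally have "edge_Lr eps u r e - edge_Lr eps v r e \<le> r * S powr (r - 2) * (\<kappa> * (em u e + em v e) + em (\<lambda>x. u x - v x) e / \<kappa>)"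
    unfolding R .
  moreover have "edge_Lr eps v r e - edge_Lr eps u r e = (LBINT t:{0..eps}. \<bar>ef v e t\<bar> powr r - \<bar>ef u e t\<bar> powr r)"
    unfolding edge_Lr_def using j by (simp add: set_integral_diff)
  moreover have "\<dots> \<le> (LBINT t:{0..eps}. r * S powr (r - 2) * (\<kappa> * ((ef u e t)\<^sup>2 + (ef v e t)\<^sup>2) + (ef u e t - ef v e t)\<^sup>2 / \<kappa>))"
    by (rule set_integral_mono[OF set_integral_diff(1)[OF j(2,1)] Ri]) (use le in fastforce)
  ultimately show ?thesis unfolding R by linarith
qed

lemma edge_Lr_le_mass:
  assumes "edge_H1 u" "2 \<le> r" and S: "\<And>t. t \<in> {0..eps} \<Longrightarrow> \<bar>ef u e t\<bar> \<le> S"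
  shows "edge_Lr eps u r e \<le> S powr (r - 2) * em u e"
proof -
  note c = edge_H1_continuous[OF assms(1), of e]
  have "edge_Lr eps u r e \<le> (LBINT t:{0..eps}. S powr (r - 2) * (ef u e t)\<^sup>2)"
    unfolding edge_Lr_def
    using \<open>2 \<le> r\<close> by (intro set_integral_mono set_integrable_Icc_continuous continuous_on_powr' continuous_intros c abs_powr_le_square S) auto
  then show ?thesis by (simp add: edge_mass_eq)
qed

lemma vertex_ef: "u (vtx eps k) = ef u (k, d) 0" "u (vtx eps (edge_end e)) = ef u e eps"
  by (auto simp: edge_fun_def edge_pt_def vtx_def edge_end_def algebra_simps)

end

section \<open>Sums over the grid\<close>

lemma infsum_abs_diff_le:
  fixes f g h :: "'a \<Rightarrow> real"
  assumes f: "f summable_on A" and g: "g summable_on A" and h: "h summable_on A"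
    and le: "\<And>x. x \<in> A \<Longrightarrow> \<bar>f x - g x\<bar> \<le> h x"
  shows "\<bar>infsum f A - infsum g A\<bar> \<le> infsum h A"
proof -
  have "infsum f A \<le> (\<Sum>\<^sub>\<infinity>x\<in>A. g x + h x)" "infsum g A \<le> (\<Sum>\<^sub>\<infinity>x\<in>A. f x + h x)"
    by (intro infsum_mono summable_on_add f g h; drule le; simp)+
  then show ?thesis by (simp add: infsum_add f g h)
qed

lemma infsum_add_cmult:
  fixes f g :: "'a \<Rightarrow> real"
  assumes "f summable_on A" "g summable_on A"
  shows "(\<lambda>x. c * f x + d * g x) summable_on A" 
    "(\<Sum>\<^sub>\<infinity>x\<in>A. c * f x + d * g x) = c * infsum f A + d * infsum g A"
  using assms by (auto simp: infsum_add summable_on_add summable_on_cmult_right infsum_cmult_right')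

lemma infsum_parallelogram:
  fixes a b f g :: "'a \<Rightarrow> real"
  assumes "a summable_on A" "b summable_on A" "f summable_on A" "g summable_on A"
    and "\<And>x. x \<in> A \<Longrightarrow> a x + b x = 2 * f x + 2 * g x"
  shows "infsum a A + infsum b A = 2 * infsum f A + 2 * infsum g A"
  using infsum_add[OF assms(1,2)] infsum_add_cmult(2)[OF assms(3,4), of 2 2] infsum_cong[of A, OF assms(5)] by simp

text \<open>The left side sums over \<open>A\<close> and the right side over everything, because the
  vertex term of the energy sees only V while its change is controlled by all vertices.\<close>

lemma infsum_perturb:
  fixes f g a b w :: "'a \<Rightarrow> real"
  assumes fg: "f summable_on A" "g summable_on A"
    and abw: "a summable_on UNIV" "b summable_on UNIV" "w summable_on UNIV" "\<And>x. 0 \<le> a x" "\<And>x. 0 \<le> b x" "\<And>x. 0 \<le> w x"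
    and c: "0 \<le> c" and \<kappa>: "0 < \<kappa>"
    and le: "\<And>x. x \<in> A \<Longrightarrow> \<bar>f x - g x\<bar> \<le> c * (\<kappa> * (a x + b x) + w x / \<kappa>)"
  shows "\<bar>infsum f A - infsum g A\<bar> \<le> c * (\<kappa> * (infsum a UNIV + infsum b UNIV) + infsum w UNIV / \<kappa>)"
proof -
  let ?h = "\<lambda>x. c * (\<kappa> * (a x + b x) + w x / \<kappa>)"
  note sm = infsum_add_cmult[OF summable_on_add[OF abw(1,2)] abw(3), of "c * \<kappa>" "c / \<kappa>"]
  have h: "?h = (\<lambda>x. (c * \<kappa>) * (a x + b x) + (c / \<kappa>) * w x)" by (simp add: algebra_simps)
  have hs: "?h summable_on UNIV" unfolding h by (rule sm(1))
  then have hA: "?h summable_on A" by (rule summable_on_subset) simp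
  have "\<bar>infsum f A - infsum g A\<bar> \<le> infsum ?h A" by (rule infsum_abs_diff_le[OF fg hA le])
  also have "\<dots> \<le> infsum ?h UNIV" using c \<kappa> abw(4-) by (intro infsum_mono2 hA hs) auto
  also have "\<dots> = c * (\<kappa> * (infsum a UNIV + infsum b UNIV) + infsum w UNIV / \<kappa>)"
    unfolding h sm(2) infsum_add[OF abw(1,2)] by (simp add: algebra_simps)
  finally show ?thesis .
qed

section \<open>Norms on the whole grid and their perturbation\<close>

context grid_graph
begin

definition vs :: "(real \<times> real \<Rightarrow> real) \<Rightarrow> real \<Rightarrow> (int \<times> int) set \<Rightarrow> real" where
  "vs u r A = (\<Sum>\<^sub>\<infinity>k\<in>A. \<bar>u (vtx eps k)\<bar> powr r)"

abbreviation "Y u \<equiv> vs u 2 UNIV"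

lemma H1D:
  assumes "u \<in> H1 eps"
  shows "edge_H1 u" "em u summable_on A" "ed u summable_on A"
  using assms summable_on_subset[of _ UNIV A] by (auto simp: H1_iff)

lemma H1I:
  assumes "edge_H1 u" "\<And>e. em u e \<le> f e" "\<And>e. ed u e \<le> g e" "f summable_on UNIV" "g summable_on UNIV"
  shows "u \<in> H1 eps"
  unfolding H1_iff using assms
  by (auto intro: summable_on_comparison_test[OF assms(4)] summable_on_comparison_test[OF assms(5)] edge_Lr_nonneg edge_dnorm2_nonneg)

lemma Lr_pow_nonneg: "0 \<le> Lr_pow eps u r"
  unfolding Lr_pow_def by (intro infsum_nonneg edge_Lr_nonneg)

lemma D_nonneg: "0 \<le> D u"
  unfolding dnorm2_def by (intro infsum_nonneg edge_dnorm2_nonneg)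

lemma vs_nonneg: "0 \<le> vs u r A"
  unfolding vs_def by (intro infsum_nonneg) auto

lemma em_sum_le_M: "u \<in> H1 eps \<Longrightarrow> finite F \<Longrightarrow> (\<Sum>e\<in>F. em u e) \<le> M u"
  unfolding Lr_pow_def by (intro finite_sum_le_infsum H1D) (auto simp: edge_Lr_nonneg)

lemma em_le_M: "u \<in> H1 eps \<Longrightarrow> em u e \<le> M u"
  using em_sum_le_M[of u "{e}"] by simp

lemma ed_le_D: "u \<in> H1 eps \<Longrightarrow> ed u e \<le> D u"
  unfolding dnorm2_def using finite_sum_le_infsum[OF H1D(3)[of u UNIV], of "{e}"] by (simp add: edge_dnorm2_nonneg)

lemma H1_scale: 
  assumes "u \<in> H1 eps" shows "(\<lambda>x. c * u x) \<in> H1 eps"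
proof (rule H1I)
  show "em (\<lambda>x. c * u x) e \<le> \<bar>c\<bar> powr 2 * em u e" for e by (simp only: edge_Lr_scale order_refl)
  show "ed (\<lambda>x. c * u x) e \<le> c\<^sup>2 * ed u e" for e by (simp only: ed_scale[OF H1D(1)[OF assms]] order_refl)
qed (intro edge_H1_scale H1D assms summable_on_cmult_right)+

lemma H1_add: 
  assumes "u \<in> H1 eps" "v \<in> H1 eps" shows "(\<lambda>x. u x + v x) \<in> H1 eps"
  by (rule H1I[where f = "\<lambda>e. 2 * em u e + 2 * em v e" and g = "\<lambda>e. 2 * ed u e + 2 * ed v e"])
   (intro edge_H1_add em_add_le ed_add_le infsum_add_cmult H1D assms)+

lemma H1_diff: 
  assumes "u \<in> H1 eps" "v \<in> H1 eps" shows "(\<lambda>x. u x - v x) \<in> H1 eps"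
  by (rule H1I[where f = "\<lambda>e. 2 * em u e + 2 * em v e" and g = "\<lambda>e. 2 * ed u e + 2 * ed v e"])
   (intro edge_H1_diff em_diff_le ed_diff_le infsum_add_cmult H1D assms)+

lemma Lr_pow_scale: "Lr_pow eps (\<lambda>x. c * u x) r = \<bar>c\<bar> powr r * Lr_pow eps u r"
  unfolding Lr_pow_def by (simp only: infsum_cmult_right'[symmetric] edge_Lr_scale[symmetric])

lemma M_scale: "M (\<lambda>x. c * u x) = c\<^sup>2 * M u"
  by (simp only: Lr_pow_scale abs_powr_2)

lemma D_scale: "u \<in> H1 eps \<Longrightarrow> D (\<lambda>x. c * u x) = c\<^sup>2 * D u"
  unfolding dnorm2_def by (simp only: infsum_cmult_right'[symmetric] ed_scale[OF H1D(1), symmetric])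

lemma vs_scale: "vs (\<lambda>x. c * u x) r A = \<bar>c\<bar> powr r * vs u r A"
  unfolding vs_def by (simp add: abs_mult powr_mult infsum_cmult_right')

lemma M_parallelogram:
  assumes "u \<in> H1 eps" "v \<in> H1 eps"
  shows "M (\<lambda>x. u x + v x) + M (\<lambda>x. u x - v x) = 2 * M u + 2 * M v"
  unfolding Lr_pow_def
  by (intro infsum_parallelogram H1D(2) H1_add H1_diff assms em_parallelogram H1D(1))

lemma D_parallelogram:
  assumes "u \<in> H1 eps" "v \<in> H1 eps"
  shows "D (\<lambda>x. u x + v x) + D (\<lambda>x. u x - v x) = 2 * D u + 2 * D v"
  unfolding dnorm2_def
  by (intro infsum_parallelogram H1D(3) H1_add H1_diff assms ed_parallelogram H1D(1))

lemma sup_bound: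
  assumes "u \<in> H1 eps" "t \<in> {0..eps}" "0 < l" "l \<le> eps"
  shows "(ef u e t)\<^sup>2 \<le> 2 * M u / l + 2 * l * D u"
proof -
  have "(ef u e t)\<^sup>2 \<le> 2 * em u e / l + 2 * l * ed u e" by (rule edge_sup_bound[OF H1D(1)[OF assms(1)] assms(2-)])
  also have "\<dots> \<le> 2 * M u / l + 2 * l * D u"
    using assms by (intro add_mono divide_right_mono mult_left_mono em_le_M ed_le_D) auto
  finally show ?thesis .
qed

lemma vertex_sup:
  assumes "\<And>e t. t \<in> {0..eps} \<Longrightarrow> \<bar>ef u e t\<bar> \<le> S"
  shows "\<bar>u (vtx eps k)\<bar> \<le> S"
  using assms[of 0 "(k,True)"] eps_pos by (simp add: vertex_ef(1)[of u k True])

text \<open>\<open>infsum\<close> is 0 for a family that is not summable, so this is what makes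
  \<open>Lr_pow\<close> a true norm power. A uniform bound on \<open>u\<close> reduces exponent
  \<open>r\<close> to exponent 2.\<close>

lemma Lr_summable:
  assumes u: "u \<in> H1 eps" and r: "2 \<le> r"
  shows "edge_Lr eps u r summable_on A"
proof (rule summable_on_comparison_test)
  define S where "S = sqrt (2 * M u / eps + 2 * eps * D u)"
  show "(\<lambda>e. S powr (r - 2) * em u e) summable_on A" by (intro summable_on_cmult_right H1D u)
  show "edge_Lr eps u r e \<le> S powr (r - 2) * em u e" for e
    using sup_bound[OF u _ eps_pos order_refl] unfolding S_def
    by (intro edge_Lr_le_mass H1D u r real_le_rsqrt) auto
qed (rule edge_Lr_nonneg)

lemma Lr_pow_le:
  assumes u: "u \<in> H1 eps" and r: "2 \<le> r" and S: "\<And>e t. t \<in> {0..eps} \<Longrightarrow> \<bar>ef u e t\<bar> \<le> S"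
  shows "Lr_pow eps u r \<le> S powr (r - 2) * M u"
  unfolding Lr_pow_def infsum_cmult_right'[symmetric]
  by (intro infsum_mono Lr_summable summable_on_cmult_right edge_Lr_le_mass H1D u r S)

lemma Lr_pow_perturb:
  assumes u: "u \<in> H1 eps" and v: "v \<in> H1 eps" and r: "2 \<le> r" and \<kappa>: "\<kappa> > 0"
    and S: "\<And>e t. t \<in> {0..eps} \<Longrightarrow> \<bar>ef u e t\<bar> \<le> S" "\<And>e t. t \<in> {0..eps} \<Longrightarrow> \<bar>ef v e t\<bar> \<le> S"
  shows "\<bar>Lr_pow eps u r - Lr_pow eps v r\<bar> \<le> r * S powr (r - 2) * (\<kappa> * (M u + M v) + M (\<lambda>x. u x - v x) / \<kappa>)"
  unfolding Lr_pow_def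
  by (rule infsum_perturb) (use r in \<open>auto intro!: Lr_summable H1D H1_diff u v \<kappa> edge_Lr_nonneg edge_Lr_perturb S\<close>)

lemma D_perturb:
  assumes u: "u \<in> H1 eps" and v: "v \<in> H1 eps" and \<kappa>: "\<kappa> > 0"
  shows "\<bar>D u - D v\<bar> \<le> \<kappa> * (D u + D v) + D (\<lambda>x. u x - v x) / \<kappa>"
proof -
  have "\<bar>ed u e - ed v e\<bar> \<le> 1 * (\<kappa> * (ed u e + ed v e) + ed (\<lambda>x. u x - v x) e / \<kappa>)" for e
    using ed_perturb[OF H1D(1)[OF u] H1D(1)[OF v] \<kappa>] by simp
  then show ?thesis unfolding dnorm2_def
    using infsum_perturb[OF H1D(3)[OF u] H1D(3)[OF v] H1D(3)[OF u] H1D(3)[OF v] H1D(3)[OF H1_diff[OF u v]], of 1 \<kappa>]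
    by (simp add: edge_dnorm2_nonneg \<kappa>)
qed

text \<open>Each vertex is charged to the horizontal edge that starts there. The charging is
  injective, so the one-edge bound sums up to the norms on the whole grid.\<close>

lemma vertex_square_summable:
  assumes u: "u \<in> H1 eps"
  shows "(\<lambda>k. (u (vtx eps k))\<^sup>2) summable_on A"
    and "0 < l \<Longrightarrow> l \<le> eps \<Longrightarrow> Y u \<le> 2 * M u / l + 2 * l * D u"
proof -
  have inj: "inj_on (\<lambda>k. (k, True)) (UNIV :: (int \<times> int) set)" by (auto simp: inj_on_def)
  have s: "(\<lambda>k. em u (k, True)) summable_on UNIV" "(\<lambda>k. ed u (k, True)) summable_on UNIV"
    using summable_on_reindex[OF inj, of "em u"] summable_on_reindex[OF inj, of "ed u"] H1D[OF u] by (auto simp: o_def)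
  have i: "(\<Sum>\<^sub>\<infinity>k. em u (k, True)) \<le> M u" "(\<Sum>\<^sub>\<infinity>k. ed u (k, True)) \<le> D u"
    using infsum_reindex[OF inj, of "em u"] infsum_reindex[OF inj, of "ed u"]
      infsum_mono2[of "em u" "range (\<lambda>k. (k, True))" UNIV] infsum_mono2[of "ed u" "range (\<lambda>k. (k, True))" UNIV] H1D[OF u]
    by (auto simp: o_def Lr_pow_def dnorm2_def edge_Lr_nonneg edge_dnorm2_nonneg)
  have le: "(u (vtx eps k))\<^sup>2 \<le> (2 / l) * em u (k, True) + (2 * l) * ed u (k, True)" if "0 < l" "l \<le> eps" for k l
    using edge_sup_bound[OF H1D(1)[OF u], of 0 l "(k,True)"] that eps_pos by (simp add: vertex_ef(1)[of u k True])
  have sum: "(\<lambda>k. (u (vtx eps k))\<^sup>2) summable_on UNIV"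
    by (rule summable_on_comparison_test[OF infsum_add_cmult(1)[OF s] le[OF eps_pos order_refl]]) auto
  then show "(\<lambda>k. (u (vtx eps k))\<^sup>2) summable_on A" by (rule summable_on_subset) auto
  assume l: "0 < l" "l \<le> eps"
  have "Y u = (\<Sum>\<^sub>\<infinity>k. (u (vtx eps k))\<^sup>2)" unfolding vs_def by (simp only: abs_powr_2)
  also have "\<dots> \<le> (\<Sum>\<^sub>\<infinity>k. (2 / l) * em u (k, True) + (2 * l) * ed u (k, True))"
    by (intro infsum_mono sum infsum_add_cmult s le l)
  also have "\<dots> \<le> (2 / l) * M u + (2 * l) * D u"
    unfolding infsum_add_cmult(2)[OF s] using l i by (intro add_mono mult_left_mono) auto
  finally show "Y u \<le> 2 * M u / l + 2 * l * D u" by simp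
qed

lemma vs_summable:
  assumes u: "u \<in> H1 eps" and r: "2 \<le> r"
  shows "(\<lambda>k. \<bar>u (vtx eps k)\<bar> powr r) summable_on A"
proof (rule summable_on_comparison_test)
  define S where "S = sqrt (2 * M u / eps + 2 * eps * D u)"
  show "(\<lambda>k. S powr (r - 2) * (u (vtx eps k))\<^sup>2) summable_on A"
    by (intro summable_on_cmult_right vertex_square_summable u)
  show "\<bar>u (vtx eps k)\<bar> powr r \<le> S powr (r - 2) * (u (vtx eps k))\<^sup>2" for k
    using sup_bound[OF u _ eps_pos order_refl] unfolding S_def
    by (intro abs_powr_le_square r vertex_sup[of u] real_le_rsqrt) auto
qed auto

lemma vs_le:
  assumes u: "u \<in> H1 eps" and r: "2 \<le> r" and S: "\<And>e t. t \<in> {0..eps} \<Longrightarrow> \<bar>ef u e t\<bar> \<le> S"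
  shows "vs u r A \<le> S powr (r - 2) * Y u"
proof -
  have "vs u r A \<le> (\<Sum>\<^sub>\<infinity>k\<in>UNIV. \<bar>u (vtx eps k)\<bar> powr r)"
    unfolding vs_def by (intro infsum_mono2 vs_summable u r) auto
  also have "\<dots> \<le> (\<Sum>\<^sub>\<infinity>k\<in>UNIV. S powr (r - 2) * (\<bar>u (vtx eps k)\<bar> powr 2))"
    unfolding abs_powr_2
    by (intro infsum_mono vs_summable u r summable_on_cmult_right vertex_square_summable abs_powr_le_square vertex_sup[of u] S)
  finally show ?thesis by (simp add: vs_def infsum_cmult_right')
qed

lemma vs_perturb:
  assumes u: "u \<in> H1 eps" and v: "v \<in> H1 eps" and r: "2 \<le> r" and \<kappa>: "\<kappa> > 0"
    and S: "\<And>e t. t \<in> {0..eps} \<Longrightarrow> \<bar>ef u e t\<bar> \<le> S" "\<And>e t. t \<in> {0..eps} \<Longrightarrow> \<bar>ef v e t\<bar> \<le> S"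
  shows "\<bar>vs u r A - vs v r A\<bar> \<le> r * S powr (r - 2) * (\<kappa> * (Y u + Y v) + Y (\<lambda>x. u x - v x) / \<kappa>)"
  unfolding vs_def
proof (rule infsum_perturb)
  fix k
  show "\<bar>\<bar>u (vtx eps k)\<bar> powr r - \<bar>v (vtx eps k)\<bar> powr r\<bar> \<le> r * S powr (r - 2) *
      (\<kappa> * (\<bar>u (vtx eps k)\<bar> powr 2 + \<bar>v (vtx eps k)\<bar> powr 2) + \<bar>u (vtx eps k) - v (vtx eps k)\<bar> powr 2 / \<kappa>)"
    unfolding abs_powr_2 by (intro abs_powr_diff_le vertex_sup[of u] vertex_sup[of v] r \<kappa> S)
qed (use r \<kappa> in \<open>auto intro!: vs_summable vertex_square_summable vertex_square_summable[OF H1_diff[OF u v]] u v\<close>)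

section \<open>Cutting along a set of vertices\<close>

lemma affine_edge:
  assumes f: "\<And>t. t \<in> {0..eps} \<Longrightarrow> ef w e t = x + (y - x) / eps * t"
  shows "weak_deriv 0 eps (ef w e) (\<lambda>_. (y - x) / eps)"
    and "ed w e = (y - x)\<^sup>2 / eps" and "em w e \<le> eps * (x\<^sup>2 + y\<^sup>2)"
proof -
  show w: "weak_deriv 0 eps (ef w e) (\<lambda>_. (y - x) / eps)"
    using weak_deriv_affine[of 0 eps x "(y - x) / eps"] 
      weak_deriv_cong[of 0 eps "ef w e" "\<lambda>t. x + (y - x) / eps * (t - 0)"] f by simp
  have "ed w e = eps * ((y - x) / eps)\<^sup>2"
    unfolding edge_dnorm2_eq[OF w] using eps_pos by (simp add: set_integral_Icc_const)
  then show "ed w e = (y - x)\<^sup>2 / eps" using eps_pos by (simp add: power2_eq_square)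
  have "em w e \<le> (LBINT t:{0..eps}. x\<^sup>2 + y\<^sup>2)"
    unfolding edge_mass_eq
  proof (rule set_integral_mono)
    show "set_integrable lborel {0..eps} (\<lambda>t. (ef w e t)\<^sup>2)"
      by (intro set_integrable_Icc_continuous continuous_intros weak_deriv_continuous_on[OF w])
    show "set_integrable lborel {0..eps} (\<lambda>t. x\<^sup>2 + y\<^sup>2)"
      by (intro set_integrable_Icc_continuous continuous_intros)
    fix t assume t: "t \<in> {0..eps}"
    define s where "s = t / eps"
    have s: "0 \<le> s" "s \<le> 1" using t eps_pos by (auto simp: s_def)
    have "ef w e t = (1 - s) * x + s * y"
      unfolding f[OF t] s_def using eps_pos by (simp add: field_simps)
    then have "\<bar>ef w e t\<bar> \<le> max \<bar>x\<bar> \<bar>y\<bar>"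
    proof -
      have "\<bar>(1 - s) * x + s * y\<bar> \<le> (1 - s) * \<bar>x\<bar> + s * \<bar>y\<bar>"
        using s abs_triangle_ineq[of "(1 - s) * x" "s * y"] by (simp add: abs_mult)
      also have "\<dots> \<le> (1 - s) * max \<bar>x\<bar> \<bar>y\<bar> + s * max \<bar>x\<bar> \<bar>y\<bar>"
        using s by (intro add_mono mult_left_mono) auto
      finally show ?thesis using \<open>ef w e t = _\<close> by (simp add: algebra_simps)
    qed
    then have "(ef w e t)\<^sup>2 \<le> (max \<bar>x\<bar> \<bar>y\<bar>)\<^sup>2" by (metis abs_ge_zero power2_abs power_mono)
    also have "\<dots> \<le> x\<^sup>2 + y\<^sup>2" by (auto simp: max_def)
    finally show "(ef w e t)\<^sup>2 \<le> x\<^sup>2 + y\<^sup>2" .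
  qed
  also have "\<dots> = eps * (x\<^sup>2 + y\<^sup>2)" using set_integral_Icc_const(2)[of 0 eps] eps_pos by simp
  finally show "em w e \<le> eps * (x\<^sup>2 + y\<^sup>2)" .
qed

text \<open>One construction serves two purposes: with \<open>I\<close> the inner edges of a set it
  cuts \<open>u\<close> off, and with \<open>I\<close> empty it builds a piecewise affine function
  from vertex values alone.\<close>

lemma patch:
  fixes \<phi> :: "int \<times> int \<Rightarrow> real"
  assumes u: "edge_H1 u" and I: "\<And>e. e \<in> I \<Longrightarrow> u (vtx eps (fst e)) = \<phi> (fst e) \<and> u (vtx eps (edge_end e)) = \<phi> (edge_end e)"
  obtains w where "edge_H1 w" "\<And>k. w (vtx eps k) = \<phi> k"
    "\<And>e t. e \<in> I \<Longrightarrow> t \<in> {0..eps} \<Longrightarrow> ef w e t = ef u e t"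
    "\<And>e. e \<notin> I \<Longrightarrow> ed w e = (\<phi> (edge_end e) - \<phi> (fst e))\<^sup>2 / eps"
    "\<And>e. e \<notin> I \<Longrightarrow> em w e \<le> eps * ((\<phi> (fst e))\<^sup>2 + (\<phi> (edge_end e))\<^sup>2)"
proof -
  define F where "F e t = (if e \<in> I then ef u e t else \<phi> (fst e) + (\<phi> (edge_end e) - \<phi> (fst e)) / eps * t)" for e t
  have "F e 0 = \<phi> (fst e)" for e
    using I[of e] vertex_ef(1)[of u "fst e" "snd e"] by (auto simp: F_def)
  moreover have "F e eps = \<phi> (edge_end e)" for e
    using I[of e] vertex_ef(2)[of u e] eps_pos by (auto simp: F_def)
  ultimately obtain w where w: "\<And>e t. t \<in> {0..eps} \<Longrightarrow> ef w e t = F e t" "\<And>k. w (vtx eps k) = \<phi> k"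
    using grid_gluing[of eps F \<phi>] eps_pos by blast
  have aff: "ef w e t = \<phi> (fst e) + (\<phi> (edge_end e) - \<phi> (fst e)) / eps * t" if "e \<notin> I" "t \<in> {0..eps}" for e t
    using w(1)[OF that(2)] that(1) by (simp add: F_def)
  have kp: "ef w e t = ef u e t" if "e \<in> I" "t \<in> {0..eps}" for e t
    using w(1)[OF that(2)] that(1) by (simp add: F_def)
  have "edge_H1 w" unfolding edge_H1_def
  proof
    fix e
    show "\<exists>g. weak_deriv 0 eps (ef w e) g"
    proof (cases "e \<in> I")
      case True
      then show ?thesis using u weak_deriv_cong[of 0 eps "ef w e" "ef u e"] kp unfolding edge_H1_def by blast
    next
      case False
      then show ?thesis using affine_edge(1)[OF aff] by blast
    qed
  qed
  then show ?thesis using that[of w] w(2) kp affine_edge(2,3)[OF aff] by blast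
qed

section \<open>Edges inside, outside and across a set of vertices\<close>

definition inner :: "(int \<times> int) set \<Rightarrow> grid_edge set" where
  "inner S = {e. fst e \<in> S \<and> edge_end e \<in> S}"

definition bdry :: "(int \<times> int) set \<Rightarrow> grid_edge set" where
  "bdry S = {e. (fst e \<in> S) \<noteq> (edge_end e \<in> S)}"

text \<open>The squared H^1 norm on the crossing edges, which is the price of a cut.\<close>

definition hB :: "(real \<times> real \<Rightarrow> real) \<Rightarrow> (int \<times> int) set \<Rightarrow> real" where
  "hB u S = (\<Sum>\<^sub>\<infinity>e\<in>bdry S. em u e + ed u e)"

text \<open>The two coefficients of \<open>edge_sup_bound\<close> at \<open>l = eps\<close>, added
  so that one constant serves mass and derivative alike.\<close>

definition "C0 = 2 / eps + 2 * eps"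

lemma C0_pos: "0 < C0" unfolding C0_def using eps_pos by (simp add: add_pos_pos)

lemma edge_sup_bound':
  assumes "edge_H1 u" "t \<in> {0..eps}"
  shows "(ef u e t)\<^sup>2 \<le> C0 * (em u e + ed u e)"
proof -
  have "(ef u e t)\<^sup>2 \<le> 2 * em u e / eps + 2 * eps * ed u e"
    by (rule edge_sup_bound[OF assms eps_pos order_refl])
  also have "\<dots> \<le> C0 * (em u e + ed u e)"
    using eps_pos edge_Lr_nonneg[of u 2 e] edge_dnorm2_nonneg[of u e]
    by (simp add: C0_def algebra_simps)
  finally show ?thesis .
qed

lemma infsum_split_cut:
  fixes f :: "grid_edge \<Rightarrow> real"
  assumes f: "f summable_on UNIV"
  shows "infsum f UNIV = infsum f (inner S) + infsum f (inner (- S)) + infsum f (bdry S)"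
proof -
  have s: "f summable_on A" for A using summable_on_subset[OF f] by auto
  have "UNIV = (inner S \<union> inner (- S)) \<union> bdry S" by (auto simp: inner_def bdry_def)
  then have "infsum f UNIV = infsum f ((inner S \<union> inner (- S)) \<union> bdry S)" by simp
  also have "\<dots> = infsum f (inner S \<union> inner (- S)) + infsum f (bdry S)"
    by (rule infsum_Un_disjoint[OF s s]) (auto simp: inner_def bdry_def)
  also have "infsum f (inner S \<union> inner (- S)) = infsum f (inner S) + infsum f (inner (- S))"
    by (rule infsum_Un_disjoint[OF s s]) (auto simp: inner_def bdry_def)
  finally show ?thesis .
qed

lemma h_summable: "u \<in> H1 eps \<Longrightarrow> (\<lambda>e. em u e + ed u e) summable_on A"
  by (intro summable_on_add H1D)

text \<open>Affine interpolation on the cut edges, instead of a cutoff factor, avoids a product rule for weak derivatives.\<close>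

lemma cut:
  assumes u: "u \<in> H1 eps"
  obtains w where "w \<in> H1 eps"
    "\<And>k. w (vtx eps k) = (if k \<in> S then u (vtx eps k) else 0)"
    "\<And>e r. e \<in> inner S \<Longrightarrow> edge_Lr eps w r e = edge_Lr eps u r e"
    "M w \<le> infsum (em u) (inner S) + eps * C0 * hB u S"
    "infsum (em u) (inner S) \<le> M w"
    "D w \<le> infsum (ed u) (inner S) + C0 / eps * hB u S"
proof -
  define \<phi> where "\<phi> k = (if k \<in> S then u (vtx eps k) else 0)" for k
  have uH: "edge_H1 u" by (rule H1D[OF u])
  obtain w where w: "edge_H1 w" "\<And>k. w (vtx eps k) = \<phi> k"
    "\<And>e t. e \<in> inner S \<Longrightarrow> t \<in> {0..eps} \<Longrightarrow> ef w e t = ef u e t"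
    "\<And>e. e \<notin> inner S \<Longrightarrow> ed w e = (\<phi> (edge_end e) - \<phi> (fst e))\<^sup>2 / eps"
    "\<And>e. e \<notin> inner S \<Longrightarrow> em w e \<le> eps * ((\<phi> (fst e))\<^sup>2 + (\<phi> (edge_end e))\<^sup>2)"
    by (rule patch[OF uH, of "inner S" \<phi>]) (auto simp: inner_def \<phi>_def)
  have keep: "edge_Lr eps w r e = edge_Lr eps u r e" "ed w e = ed u e" if "e \<in> inner S" for e r
    using edge_Lr_cong[OF w(3)[OF that]] edge_dnorm2_cong[OF w(3)[OF that]] by auto
  have out: "em w e = 0" "ed w e = 0" if "e \<in> inner (- S)" for e
  proof -
    have "\<phi> (fst e) = 0" "\<phi> (edge_end e) = 0" "e \<notin> inner S" using that by (auto simp: inner_def \<phi>_def)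
    then show "em w e = 0" "ed w e = 0" using w(4,5)[of e] edge_Lr_nonneg[of w 2 e] by auto
  qed
  \<comment> \<open>Exactly one end of a crossing edge keeps its value, and that value is controlled
    by the H^1 norm of \<open>u\<close> on this very edge. The cut therefore costs only what
    \<open>u\<close> carries across it.\<close>
  have bd: "em w e \<le> eps * C0 * (em u e + ed u e)" "ed w e \<le> C0 / eps * (em u e + ed u e)" if "e \<in> bdry S" for e
  proof -
    have "(u (vtx eps (fst e)))\<^sup>2 \<le> C0 * (em u e + ed u e)"
      unfolding vertex_ef(1)[of u "fst e" "snd e"] using edge_sup_bound'[OF uH, of 0 e] eps_pos by simp
    moreover have "(u (vtx eps (edge_end e)))\<^sup>2 \<le> C0 * (em u e + ed u e)"
      unfolding vertex_ef(2) using edge_sup_bound'[OF uH, of eps e] eps_pos by simp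
    moreover have "e \<notin> inner S" using that by (auto simp: inner_def bdry_def)
    moreover have "\<phi> (fst e) = 0 \<and> \<phi> (edge_end e) = u (vtx eps (edge_end e)) \<or> \<phi> (edge_end e) = 0 \<and> \<phi> (fst e) = u (vtx eps (fst e))"
      using that by (auto simp: bdry_def \<phi>_def)
    ultimately have *: "(\<phi> (edge_end e) - \<phi> (fst e))\<^sup>2 \<le> C0 * (em u e + ed u e)" 
      "(\<phi> (fst e))\<^sup>2 + (\<phi> (edge_end e))\<^sup>2 \<le> C0 * (em u e + ed u e)" "e \<notin> inner S" by auto
    have "eps * ((\<phi> (fst e))\<^sup>2 + (\<phi> (edge_end e))\<^sup>2) \<le> eps * (C0 * (em u e + ed u e))"
      by (rule mult_left_mono[OF *(2)]) (use eps_pos in simp)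
    then show "em w e \<le> eps * C0 * (em u e + ed u e)" using w(5)[OF *(3)] by (simp add: mult.assoc)
    show "ed w e \<le> C0 / eps * (em u e + ed u e)" using divide_right_mono[OF *(1), of eps] eps_pos w(4)[OF *(3)] by simp
  qed
  have H: "w \<in> H1 eps"
  proof (rule H1I[OF w(1)])
    show "em w e \<le> em u e + eps * C0 * (em u e + ed u e)" for e
    proof -
      have "0 \<le> em u e" "0 \<le> eps * C0 * (em u e + ed u e)"
        using eps_pos C0_pos by (auto simp: edge_Lr_nonneg edge_dnorm2_nonneg)
      moreover have "e \<in> inner S \<or> e \<in> inner (-S) \<or> e \<in> bdry S" by (auto simp: inner_def bdry_def)
      ultimately show ?thesis using keep(1)[of e 2] out(1)[of e] bd(1)[of e] by auto
    qed
    show "ed w e \<le> ed u e + C0 / eps * (em u e + ed u e)" for e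
    proof -
      have "0 \<le> ed u e" "0 \<le> C0 / eps * (em u e + ed u e)"
        using eps_pos C0_pos by (auto simp: edge_Lr_nonneg edge_dnorm2_nonneg)
      moreover have "e \<in> inner S \<or> e \<in> inner (-S) \<or> e \<in> bdry S" by (auto simp: inner_def bdry_def)
      ultimately show ?thesis using keep(2)[of e] out(2)[of e] bd(2)[of e] by auto
    qed
  qed (intro summable_on_add summable_on_cmult_right H1D u)+
  have Meq: "M w = infsum (em u) (inner S) + infsum (em w) (bdry S)"
    unfolding Lr_pow_def infsum_split_cut[OF H1D(2)[OF H], of S]
    using infsum_cong[of "inner S" "em w" "em u"] infsum_cong[of "inner (-S)" "em w" "\<lambda>_. 0"] keep out by simp
  have Deq: "D w = infsum (ed u) (inner S) + infsum (ed w) (bdry S)"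
    unfolding dnorm2_def infsum_split_cut[OF H1D(3)[OF H], of S]
    using infsum_cong[of "inner S" "ed w" "ed u"] infsum_cong[of "inner (-S)" "ed w" "\<lambda>_. 0"] keep out by simp
  show thesis
  proof (rule that[OF H])
    show "w (vtx eps k) = (if k \<in> S then u (vtx eps k) else 0)" for k using w(2) \<phi>_def by simp
    show "edge_Lr eps w r e = edge_Lr eps u r e" if "e \<in> inner S" for e r using keep(1)[OF that] .
    have "infsum (em w) (bdry S) \<le> eps * C0 * hB u S"
      unfolding hB_def infsum_cmult_right'[symmetric]
      by (intro infsum_mono H1D H summable_on_cmult_right h_summable u bd)
    then show "M w \<le> infsum (em u) (inner S) + eps * C0 * hB u S" unfolding Meq by simp
    show "infsum (em u) (inner S) \<le> M w" unfolding Meq by (simp add: infsum_nonneg edge_Lr_nonneg)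
    have "infsum (ed w) (bdry S) \<le> C0 / eps * hB u S"
      unfolding hB_def infsum_cmult_right'[symmetric]
      by (intro infsum_mono H1D H summable_on_cmult_right h_summable u bd)
    then show "D w \<le> infsum (ed u) (inner S) + C0 / eps * hB u S" unfolding Deq by simp
  qed
qed

end

section \<open>Coercivity, scaling and nonvanishing\<close>

text \<open>Beyond \<open>X\<close> the linear term dominates the sublinear power; up to
  \<open>X\<close> the constant \<open>C * X\<close> does.\<close>

lemma powr_absorb:
  fixes \<theta> C c :: real
  assumes \<theta>: "\<theta> < 1" and C: "0 \<le> C" and c: "0 < c"
  obtains B where "0 \<le> B" "\<And>x. 1 \<le> x \<Longrightarrow> C * x powr \<theta> \<le> c * x + B"
proof -
  define X where "X = max 1 ((C / c) powr (1 / (1 - \<theta>)))"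
  have "C * x powr \<theta> \<le> c * x + C * X" if x: "1 \<le> x" for x
  proof (cases "x \<le> X")
    case True
    have "x powr \<theta> \<le> x powr 1" using x \<theta> by (intro powr_mono) auto
    then have "x powr \<theta> \<le> X" using True x by simp
    then have "C * x powr \<theta> \<le> C * X" using C by (intro mult_left_mono)
    then show ?thesis using c x by (smt (verit) mult_nonneg_nonneg)
  next
    case False
    have "C / c = ((C / c) powr (1 / (1 - \<theta>))) powr (1 - \<theta>)"
      using \<theta> C c by (simp add: powr_powr)
    also have "\<dots> \<le> x powr (1 - \<theta>)"
      using False \<theta> by (intro powr_mono2) (auto simp: X_def)
    finally have "C \<le> c * x powr (1 - \<theta>)" using c by (simp add: field_simps)
    then have "C * x powr \<theta> \<le> c * x powr (1 - \<theta>) * x powr \<theta>"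
      by (rule mult_right_mono) auto
    also have "\<dots> = c * x" using x by (simp add: mult.assoc powr_add[symmetric])
    finally show ?thesis using C by (simp add: X_def add_increasing2)
  qed
  moreover have "0 \<le> C * X" using C by (auto simp: X_def)
  ultimately show ?thesis using that by blast
qed

section \<open>The energy functional at fixed mass\<close>

locale nls_grid = grid_graph eps for eps :: real +
  fixes p q \<alpha> \<beta> \<mu> :: real and V :: "(int \<times> int) set"
  assumes p: "2 < p" "p < 6" and q: "2 < q" "q < 4" and \<alpha>: "0 < \<alpha>" and \<beta>: "0 < \<beta>" and \<mu>: "0 < \<mu>"
begin

abbreviation "P u \<equiv> Lr_pow eps u p"
abbreviation "Q u \<equiv> vs u q V"

definition "E u = D u / 2 - \<alpha> / p * P u - \<beta> / q * Q u"

lemma energy_eq: "energy eps p q \<alpha> \<beta> (vtx eps ` V) u = E u"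
proof -
  have "inj (vtx eps)" using eps_pos by (auto simp: inj_on_def vtx_def prod_eq_iff)
  then have "inj_on (vtx eps) V" using inj_on_subset by blast
  then show ?thesis by (simp add: energy_def E_def vs_def infsum_reindex o_def)
qed

lemma pq_ge: "2 \<le> p" "2 \<le> q" using p q by auto

lemma coef_pos: "0 < \<alpha> / p" "0 < \<beta> / q" using p q \<alpha> \<beta> by auto

lemma E_scale:
  assumes "u \<in> H1 eps"
  shows "E (\<lambda>x. c * u x) = c\<^sup>2 * D u / 2 - \<alpha> / p * (\<bar>c\<bar> powr p * P u) - \<beta> / q * (\<bar>c\<bar> powr q * Q u)"
  unfolding E_def by (simp only: D_scale[OF assms] Lr_pow_scale vs_scale)

text \<open>The term with \<open>P u\<close> is what makes the energy level strictly subadditive.\<close>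

lemma E_lower_by_scaling:
  assumes I: "\<And>w. w \<in> H1 eps \<Longrightarrow> M w = \<mu> \<Longrightarrow> I \<le> E w"
    and u: "u \<in> H1 eps" "0 < M u" "M u \<le> \<mu>"
  shows "(M u / \<mu>) * I + ((\<mu> / M u) powr ((p - 2) / 2) - 1) * (\<alpha> / p * P u) \<le> E u"
proof -
  \<comment> \<open>Multiplying by \<open>sqrt k\<close> lifts the mass to \<mu>. \<open>D\<close>
    grows by \<open>k\<close>, while \<open>P\<close> and \<open>Q\<close> gain a further power of
    \<open>k \<ge> 1\<close>. The gain of \<open>P\<close> is kept and that of \<open>Q\<close> is
    given away.\<close>
  define k where "k = \<mu> / M u"
  have k: "1 \<le> k" "M u / \<mu> = 1 / k" "M u * k = \<mu>" using u \<mu> by (auto simp: k_def)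
  have sk: "sqrt k powr r = k * k powr ((r - 2) / 2)" for r
  proof -
    have "sqrt k powr r = k powr (r / 2)" using k by (simp add: powr_half_sqrt[symmetric] powr_powr)
    also have "\<dots> = k powr (1 + (r - 2) / 2)" by (simp add: field_simps)
    finally show ?thesis using k by (simp add: powr_add)
  qed
  have "I \<le> E (\<lambda>x. sqrt k * u x)"
    using k u by (intro I H1_scale) (auto simp: M_scale mult.commute)
  also have "\<dots> = k * D u / 2 - \<alpha> / p * (k * k powr ((p - 2) / 2) * P u) - \<beta> / q * (k * k powr ((q - 2) / 2) * Q u)"
    using k by (simp add: E_scale[OF u(1)] sk)
  also have "\<dots> \<le> k * D u / 2 - \<alpha> / p * (k * k powr ((p - 2) / 2) * P u) - \<beta> / q * (k * 1 * Q u)"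
    using k q coef_pos by (intro diff_left_mono mult_left_mono mult_right_mono ge_one_powr_ge_zero vs_nonneg) auto
  also have "\<dots> = k * (E u - (k powr ((p - 2) / 2) - 1) * (\<alpha> / p * P u))"
    by (simp add: E_def algebra_simps)
  finally have "I \<le> k * (E u - (k powr ((p - 2) / 2) - 1) * (\<alpha> / p * P u))" .
  then have "I / k \<le> E u - (k powr ((p - 2) / 2) - 1) * (\<alpha> / p * P u)"
    using k by (subst pos_divide_le_eq) (auto simp: mult.commute)
  then show ?thesis unfolding k(2) k_def[symmetric] by simp
qed

lemma E_lower_by_scaling':
  assumes I: "\<And>w. w \<in> H1 eps \<Longrightarrow> M w = \<mu> \<Longrightarrow> I \<le> E w"
    and u: "u \<in> H1 eps" "0 < M u" "M u \<le> \<mu>"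
  shows "(M u / \<mu>) * I \<le> E u"
proof -
  have "1 \<le> (\<mu> / M u) powr ((p - 2) / 2)" using u p by (intro ge_one_powr_ge_zero) auto
  then have "0 \<le> ((\<mu> / M u) powr ((p - 2) / 2) - 1) * (\<alpha> / p * P u)"
    by (intro mult_nonneg_nonneg Lr_pow_nonneg less_imp_le[OF coef_pos(1)]) simp
  then show ?thesis using E_lower_by_scaling[OF assms] by linarith
qed

text \<open>A Gagliardo-Nirenberg bound: at fixed mass the squared maximum and the vertex sum grow
  only like the square root of \<open>D\<close>.\<close>

lemma sup_coercive:
  assumes u: "u \<in> H1 eps" "M u = \<mu>"
  defines "K \<equiv> 2 * \<mu> / eps + 2 * eps"
  shows "t \<in> {0..eps} \<Longrightarrow> \<bar>ef u e t\<bar> \<le> sqrt (K * sqrt (1 + D u))" and "Y u \<le> K * sqrt (1 + D u)"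
proof -
  define x where "x = 1 + D u"
  have x: "1 \<le> x" "D u \<le> sqrt x * sqrt x" "1 \<le> sqrt x" using D_nonneg[of u] by (auto simp: x_def)
  \<comment> \<open>This length balances the two terms of the sup bound. The 1 added to
    \<open>D u\<close> keeps it below \<open>eps\<close>.\<close>
  define l where "l = eps / sqrt x"
  have l: "0 < l" "l \<le> eps" using eps_pos x by (auto simp: l_def field_simps)
  have "2 * M u / l + 2 * l * D u \<le> K * sqrt x"
  proof -
    have "D u / sqrt x \<le> sqrt x" using x by (simp add: divide_le_eq)
    then have "2 * eps * (D u / sqrt x) \<le> 2 * eps * sqrt x" using eps_pos by (intro mult_left_mono) auto
    then show ?thesis by (simp add: l_def K_def u(2) algebra_simps)
  qed
  then show "\<bar>ef u e t\<bar> \<le> sqrt (K * sqrt (1 + D u))" if "t \<in> {0..eps}"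
    using sup_bound[OF u(1) that l, of e] unfolding x_def[symmetric] by (intro real_le_rsqrt) simp
  show "Y u \<le> K * sqrt (1 + D u)"
    using vertex_square_summable(2)[OF u(1) l] \<open>_ \<le> K * sqrt x\<close> unfolding x_def by simp
qed

text \<open>This is where the upper bounds on the exponents enter. With x = 1 + \<open>D u\<close>,
  \<open>P\<close> is of order x^((p-2)/4) and \<open>Q\<close> of order x^((q-2)/4 + 1/2) =
  x^(q/4); both are sublinear exactly for p < 6 and q < 4.\<close>

lemma coercive:
  obtains B where "0 \<le> B" "\<And>u. u \<in> H1 eps \<Longrightarrow> M u = \<mu> \<Longrightarrow> D u \<le> 4 * E u + B"
proof -
  define K where "K = 2 * \<mu> / eps + 2 * eps"
  have K: "0 < K" using eps_pos \<mu> by (simp add: K_def add_pos_pos)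
  have e: "(p - 2) / 4 < 1" "q / 4 < 1" using p q by auto
  \<comment> \<open>Two terms of at most x/8 leave D/4 out of the D/2 in the energy, hence the
    factor 4 in the result.\<close>
  obtain B1 where B1: "0 \<le> B1" "\<And>x. 1 \<le> x \<Longrightarrow> \<alpha> / p * (K powr ((p - 2) / 2) * \<mu>) * x powr ((p - 2) / 4) \<le> 1/8 * x + B1"
  proof (rule powr_absorb[OF e(1), of "\<alpha> / p * (K powr ((p - 2) / 2) * \<mu>)" "1/8"])
    show "0 \<le> \<alpha> / p * (K powr ((p - 2) / 2) * \<mu>)" using \<mu> by (intro mult_nonneg_nonneg less_imp_le[OF coef_pos(1)]) auto
  qed auto
  obtain B2 where B2: "0 \<le> B2" "\<And>x. 1 \<le> x \<Longrightarrow> \<beta> / q * (K powr (q / 2)) * x powr (q / 4) \<le> 1/8 * x + B2"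
  proof (rule powr_absorb[OF e(2), of "\<beta> / q * (K powr (q / 2))" "1/8"])
    show "0 \<le> \<beta> / q * (K powr (q / 2))" by (intro mult_nonneg_nonneg less_imp_le[OF coef_pos(2)]) auto
  qed auto
  have "D u \<le> 4 * E u + (4 * B1 + 4 * B2 + 1)" if u: "u \<in> H1 eps" "M u = \<mu>" for u
  proof -
    define x where "x = 1 + D u"
    have x: "1 \<le> x" using D_nonneg[of u] by (auto simp: x_def)
    define S where "S = sqrt (K * sqrt x)"
    have S: "\<bar>ef u e t\<bar> \<le> S" if "t \<in> {0..eps}" for e t
      using sup_coercive(1)[OF u that] unfolding S_def x_def K_def .
    have Sp: "S powr r = K powr (r / 2) * x powr (r / 4)" for r
      unfolding S_def using K x by (simp add: powr_half_sqrt[symmetric] powr_mult powr_powr)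
    have Y: "Y u \<le> K * x powr (1/2)"
      using sup_coercive(2)[OF u] x unfolding x_def K_def by (simp add: powr_half_sqrt)
    have "\<alpha> / p * P u \<le> \<alpha> / p * (S powr (p - 2) * \<mu>)"
      using Lr_pow_le[OF u(1) pq_ge(1) S] coef_pos u(2) by (intro mult_left_mono) auto
    also have "\<dots> = \<alpha> / p * (K powr ((p - 2) / 2) * \<mu>) * x powr ((p - 2) / 4)" by (simp add: Sp)
    also have "\<dots> \<le> 1/8 * x + B1" by (rule B1(2)[OF x])
    finally have 1: "\<alpha> / p * P u \<le> 1/8 * x + B1" .
    have "Q u \<le> S powr (q - 2) * Y u" by (rule vs_le[OF u(1) pq_ge(2) S])
    also have "\<dots> \<le> S powr (q - 2) * (K * x powr (1/2))" by (rule mult_left_mono[OF Y]) simp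
    also have "\<dots> = (K powr ((q - 2)/2) * K powr 1) * (x powr ((q - 2)/4) * x powr (1/2))" using K by (simp add: Sp)
    also have "\<dots> = K powr (q / 2) * x powr (q / 4)" unfolding powr_add[symmetric] by (simp add: field_simps)
    finally have "\<beta> / q * Q u \<le> \<beta> / q * (K powr (q / 2) * x powr (q / 4))" using coef_pos by (intro mult_left_mono) auto
    also have "\<dots> \<le> 1/8 * x + B2" using B2(2)[OF x] by (simp add: mult.assoc)
    finally have 2: "\<beta> / q * Q u \<le> 1/8 * x + B2" .
    have "E u = D u / 2 - \<alpha> / p * P u - \<beta> / q * Q u" by (rule E_def)
    moreover have "D u \<le> 4 * E u + (4 * B1 + 4 * B2 + 1)" if "E u = D u / 2 - a - b" "a \<le> 1/8 * x + B1" "b \<le> 1/8 * x + B2" for a b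
      using that unfolding x_def by argo
    ultimately show ?thesis using 1 2 by blast
  qed
  then show ?thesis using that[of "4 * B1 + 4 * B2 + 1"] B1 B2 by simp
qed

text \<open>Values below a level \<open>s\<close> are discarded through the pointwise inequality
  s^(p-2) * (y^2 - s^2) \<le> |y|^p. With \<open>eps * s\<^sup>2 = \<delta> / 2\<close> this loses
  at most half of the mass \<delta>.\<close>

lemma edge_Lr_lower:
  assumes u: "edge_H1 u" and d: "\<delta> \<le> em u e" "0 < \<delta>"
  shows "sqrt (\<delta> / (2 * eps)) powr (p - 2) * \<delta> / 2 \<le> edge_Lr eps u p e"
proof -
  define s where "s = sqrt (\<delta> / (2 * eps))"
  have s: "0 < s" "s\<^sup>2 = \<delta> / (2 * eps)" using d eps_pos by (auto simp: s_def)
  note c = edge_H1_continuous[OF u, of e]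
  have le: "s powr (p - 2) * (y\<^sup>2 - s\<^sup>2) \<le> \<bar>y\<bar> powr p" for y
  proof (cases "\<bar>y\<bar> \<le> s")
    case True
    then have "y\<^sup>2 \<le> s\<^sup>2" by (metis abs_ge_zero power2_abs power_mono)
    then have "s powr (p - 2) * (y\<^sup>2 - s\<^sup>2) \<le> 0" by (simp add: mult_nonneg_nonpos)
    then show ?thesis by (smt (verit) powr_ge_zero)
  next
    case False
    have "s powr (p - 2) * (y\<^sup>2 - s\<^sup>2) \<le> s powr (p - 2) * y\<^sup>2" by (intro mult_left_mono) auto
    also have "\<dots> \<le> \<bar>y\<bar> powr (p - 2) * y\<^sup>2" using False s p by (intro mult_right_mono powr_mono2) auto
    also have "\<dots> = \<bar>y\<bar> powr (p - 2) * \<bar>y\<bar> powr 2" by (simp only: abs_powr_2)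
    also have "\<dots> = \<bar>y\<bar> powr p" unfolding powr_add[symmetric] by simp
    finally show ?thesis .
  qed
  have i: "set_integrable lborel {0..eps} (\<lambda>t. (ef u e t)\<^sup>2)" "set_integrable lborel {0..eps} (\<lambda>t. s\<^sup>2)"
    by (intro set_integrable_Icc_continuous continuous_intros c)+
  have "s powr (p - 2) * \<delta> / 2 \<le> s powr (p - 2) * (em u e - eps * s\<^sup>2)"
  proof -
    have "s powr (p - 2) * (\<delta> / 2) \<le> s powr (p - 2) * (em u e - eps * s\<^sup>2)"
      using d eps_pos by (intro mult_left_mono) (auto simp: s)
    then show ?thesis by simp
  qed
  also have "\<dots> = (LBINT t:{0..eps}. s powr (p - 2) * ((ef u e t)\<^sup>2 - s\<^sup>2))"
    using set_integral_Icc_const(2)[of 0 eps "s\<^sup>2"] eps_pos by (simp add: set_integral_diff[OF i] edge_mass_eq)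
  also have "\<dots> \<le> edge_Lr eps u p e"
    unfolding edge_Lr_def using p 
    by (intro set_integral_mono set_integrable_mult_right set_integral_diff i le set_integrable_Icc_continuous continuous_on_powr' continuous_intros c) auto
  finally show ?thesis unfolding s_def .
qed

text \<open>If all edges carry little mass, then \<open>u\<close> is uniformly small because its
  derivative is bounded. \<open>P\<close> and \<open>Q\<close> are then too small to bring the
  energy down to \<open>I\<close>.\<close>

lemma nonvanishing:
  assumes I: "I < 0"
  obtains \<delta> where "0 < \<delta>" "\<And>u. u \<in> H1 eps \<Longrightarrow> M u = \<mu> \<Longrightarrow> E u \<le> I \<Longrightarrow> \<exists>e. \<delta> \<le> em u e"
proof -
  obtain B where B: "0 \<le> B" "\<And>u. u \<in> H1 eps \<Longrightarrow> M u = \<mu> \<Longrightarrow> D u \<le> 4 * E u + B"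
    by (rule coercive) blast
  define Ym where "Ym = 2 * \<mu> / eps + 2 * eps * B"
  have Ym: "0 < Ym" using eps_pos \<mu> B by (auto simp: Ym_def intro!: add_pos_nonneg)
  \<comment> \<open>Chosen so that each nonlinear term is at most \<open>- I / 4\<close>; together
    they leave an energy of at least \<open>I / 2\<close>, which exceeds \<open>I\<close>.\<close>
  define c1 where "c1 = - I / (4 * (\<alpha> / p * \<mu>))"
  define c2 where "c2 = - I / (4 * (\<beta> / q * Ym))"
  have c: "0 < c1" "0 < c2" "\<alpha> / p * \<mu> * c1 = - I / 4" "\<beta> / q * Ym * c2 = - I / 4"
  proof -
    show "0 < c1" "0 < c2" unfolding c1_def c2_def minus_divide_left
      using I \<mu> Ym p q \<alpha> \<beta> by (auto intro!: divide_neg_pos mult_neg_pos mult_pos_pos)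
    show "\<alpha> / p * \<mu> * c1 = - I / 4" "\<beta> / q * Ym * c2 = - I / 4" unfolding c1_def c2_def
      using \<mu> Ym p q \<alpha> \<beta> by simp_all
  qed
  define S where "S = min (c1 powr (1 / (p - 2))) (c2 powr (1 / (q - 2)))"
  have S: "0 < S" using c by (auto simp: S_def)
  have S1: "S powr (p - 2) \<le> c1"
  proof -
    have "S powr (p - 2) \<le> (c1 powr (1 / (p - 2))) powr (p - 2)" using S p by (intro powr_mono2) (auto simp: S_def)
    then show ?thesis using c p by (simp add: powr_powr)
  qed
  have S2: "S powr (q - 2) \<le> c2"
  proof -
    have "S powr (q - 2) \<le> (c2 powr (1 / (q - 2))) powr (q - 2)" using S q by (intro powr_mono2) (auto simp: S_def)
    then show ?thesis using c q by (simp add: powr_powr)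
  qed
  \<comment> \<open>The same \<open>l\<close> is the window length and, squared, the mass threshold:
    the sup bound becomes 2 * l^2 / l + 2 * l * B = l * (2 + 2 * B).\<close>
  define l where "l = min eps (S\<^sup>2 / (2 + 2 * B))"
  have l: "0 < l" "l \<le> eps" "l * (2 + 2 * B) \<le> S\<^sup>2"
  proof -
    have b: "0 < 2 + 2 * B" using B(1) by simp
    show "0 < l" "l \<le> eps" using eps_pos S b by (auto simp: l_def)
    show "l * (2 + 2 * B) \<le> S\<^sup>2" unfolding pos_le_divide_eq[OF b, symmetric] l_def by simp
  qed
  have "\<exists>e. l\<^sup>2 \<le> em u e" if u: "u \<in> H1 eps" "M u = \<mu>" "E u \<le> I" for u
  proof (rule ccontr)
    assume "\<not> ?thesis"
    then have small: "em u e \<le> l\<^sup>2" for e by (meson less_eq_real_def not_le)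
    have DB: "D u \<le> B" using B(2)[OF u(1,2)] u(3) I by simp
    have sup: "\<bar>ef u e t\<bar> \<le> S" if "t \<in> {0..eps}" for e t
    proof -
      have "(ef u e t)\<^sup>2 \<le> 2 * em u e / l + 2 * l * ed u e"
        by (rule edge_sup_bound[OF H1D(1)[OF u(1)] that l(1,2)])
      also have "\<dots> \<le> 2 * l\<^sup>2 / l + 2 * l * B"
        using small[of e] l ed_le_D[OF u(1), of e] DB by (intro add_mono mult_left_mono divide_right_mono) auto
      also have "\<dots> = l * (2 + 2 * B)" using l by (simp add: power2_eq_square algebra_simps)
      also have "\<dots> \<le> S\<^sup>2" by (rule l(3))
      finally show ?thesis using S abs_le_square_iff[of "ef u e t" S] by simp
    qed
    have "P u \<le> c1 * \<mu>"
      using order_trans[OF Lr_pow_le[OF u(1) pq_ge(1) sup] mult_right_mono[OF S1, of "M u"]] u(2) \<mu> by simp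
    from mult_left_mono[OF this less_imp_le[OF coef_pos(1)]]
    have 1: "\<alpha> / p * P u \<le> - I / 4" unfolding c(3)[symmetric] by (simp only: mult_ac)
    have Y: "Y u \<le> Ym"
    proof -
      have "Y u \<le> 2 * M u / eps + 2 * eps * D u" by (rule vertex_square_summable(2)[OF u(1) eps_pos order_refl])
      also have "\<dots> \<le> Ym" unfolding Ym_def u(2) using DB eps_pos by simp
      finally show ?thesis .
    qed
    have "Q u \<le> S powr (q - 2) * Y u" by (rule vs_le[OF u(1) pq_ge(2) sup])
    also have "\<dots> \<le> c2 * Ym" using S2 Y c by (intro mult_mono vs_nonneg) auto
    finally have "Q u \<le> c2 * Ym" .
    from mult_left_mono[OF this less_imp_le[OF coef_pos(2)]]
    have 2: "\<beta> / q * Q u \<le> - I / 4" unfolding c(4)[symmetric] by (simp only: mult_ac)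
    have False if "E u = D u / 2 - a - b" "a \<le> - I / 4" "b \<le> - I / 4" for a b
      using that u(3) D_nonneg[of u] I by linarith
    with 1 2 E_def show False by blast
  qed
  then show ?thesis using that[of "l\<^sup>2"] l by simp
qed

end

section \<open>Negative energy\<close>

lemma infsum_le_card:
  fixes f :: "'a \<Rightarrow> real" and c :: real
  assumes F: "finite F" and le: "\<And>e. e \<in> F \<Longrightarrow> f e \<le> c" and z: "\<And>e. e \<notin> F \<Longrightarrow> f e = 0"
  shows "f summable_on UNIV" "infsum f UNIV \<le> card F * c"
proof -
  have "f summable_on F" using F by simp
  then show "f summable_on UNIV" using summable_on_cong_neutral[of UNIV F f f] z by auto
  have "infsum f UNIV = infsum f F" by (rule infsum_cong_neutral) (auto simp: z)
  also have "\<dots> \<le> card F * c" using F sum_bounded_above[of F f c] le by simp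
  finally show "infsum f UNIV \<le> card F * c" .
qed

section \<open>Tents as test functions\<close>

context grid_graph
begin

text \<open>Let the window length in the sup bound tend to 0. It serves to show that a tent has
  positive mass and can be normalised.\<close>

lemma vertex_zero_if_massless:
  assumes u: "u \<in> H1 eps" and "M u = 0"
  shows "u (vtx eps k) = 0"
proof (rule ccontr)
  assume "u (vtx eps k) \<noteq> 0"
  define y where "y = (u (vtx eps k))\<^sup>2"
  have y: "0 < y" using \<open>u (vtx eps k) \<noteq> 0\<close> by (simp add: y_def)
  define l where "l = min eps (y / (4 * (D u + 1)))"
  have D: "0 \<le> D u" by (rule D_nonneg)
  have l: "0 < l" "l \<le> eps" using eps_pos y D by (auto simp: l_def)
  have "y \<le> 2 * M u / l + 2 * l * D u"
    unfolding y_def vertex_ef(1)[of u k True] using eps_pos by (intro sup_bound u l) auto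
  also have "\<dots> \<le> 2 * (y / (4 * (D u + 1))) * D u"
  proof -
    have "l \<le> y / (4 * (D u + 1))" by (simp add: l_def)
    then have "2 * l * D u \<le> 2 * (y / (4 * (D u + 1))) * D u" using D by (intro mult_right_mono mult_left_mono) auto
    then show ?thesis unfolding assms(2) by simp
  qed
  also have "\<dots> \<le> y / 2" using y D by (simp add: field_simps)
  finally show False using y by simp
qed

lemma edge_pt_translate: "edge_pt eps (k, b) t + vtx eps c = edge_pt eps (k + c, b) t"
  by (auto simp: edge_pt_def vtx_def plus_prod_def algebra_simps)

lemma tent_bound: "\<bar>max 0 (real N - real_of_int x) - max 0 (real N - real_of_int y)\<bar> \<le> 1" if "\<bar>x - y\<bar> \<le> 1"
  using that by linarith

lemma max_abs_step: "\<bar>max \<bar>x + 1 - a\<bar> c - max \<bar>x - a\<bar> c\<bar> \<le> (1 :: int)"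
  by linarith

text \<open>The max-norm distance changes by at most 1 along an edge, so the increments are at most
  1/N, on at most 18 N^2 edges. Each contributes at most 1 / (N^2 eps) to \<open>D\<close> and 2 eps
  to \<open>M\<close>; hence \<open>D\<close> stays bounded as the tent spreads.\<close>

lemma tent:
  fixes a :: "int \<times> int" and N :: nat
  assumes N: "1 \<le> N"
  obtains w where "w \<in> H1 eps" 
    "\<And>k. w (vtx eps k) = max 0 (1 - of_int (max \<bar>fst k - fst a\<bar> \<bar>snd k - snd a\<bar>) / N)"
    "D w \<le> 18 / eps" "M w \<le> 36 * eps * (real N)\<^sup>2"
proof -
  define \<rho> where "\<rho> k = max \<bar>fst k - fst a\<bar> \<bar>snd k - snd a\<bar>" for k :: "int \<times> int"
  define \<phi> where "\<phi> k = max 0 (1 - \<rho> k / N)" for k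
  have zH: "edge_H1 (\<lambda>x. 0)"
    unfolding edge_H1_def
  proof
    fix e
    have "ef (\<lambda>x. 0) e = (\<lambda>t. 0 + 0 * (t - 0))" by (simp add: edge_fun_def fun_eq_iff)
    then show "\<exists>g. weak_deriv 0 eps (ef (\<lambda>x. 0) e) g" using weak_deriv_affine[of 0 eps 0 0] by metis
  qed
  obtain w where w: "edge_H1 w" "\<And>k. w (vtx eps k) = \<phi> k"
    "\<And>e. ed w e = (\<phi> (edge_end e) - \<phi> (fst e))\<^sup>2 / eps"
    "\<And>e. em w e \<le> eps * ((\<phi> (fst e))\<^sup>2 + (\<phi> (edge_end e))\<^sup>2)"
    by (rule patch[OF zH, of "{}" \<phi>]) auto
  have \<phi>01: "0 \<le> \<phi> k" "\<phi> k \<le> 1" for k using N by (auto simp: \<phi>_def \<rho>_def)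
  have \<phi>N: "\<phi> k = max 0 (real N - \<rho> k) / N" for k
    using N by (auto simp: \<phi>_def max_def field_simps)
  have \<rho>1: "\<bar>\<rho> (edge_end e) - \<rho> (fst e)\<bar> \<le> 1" for e
  proof (cases "snd e")
    case True
    then have e: "edge_end e = (fst (fst e) + 1, snd (fst e))" by (simp add: edge_end_def)
    show ?thesis unfolding \<rho>_def e fst_conv snd_conv by (rule max_abs_step)
  next
    case False
    then have e: "edge_end e = (fst (fst e), snd (fst e) + 1)" by (simp add: edge_end_def)
    show ?thesis unfolding \<rho>_def e fst_conv snd_conv max.commute[of "\<bar>fst (fst e) - fst a\<bar>"] by (rule max_abs_step)
  qed
  have step: "(\<phi> (edge_end e) - \<phi> (fst e))\<^sup>2 \<le> 1 / (real N)\<^sup>2" for e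
  proof -
    have "\<bar>\<phi> (edge_end e) - \<phi> (fst e)\<bar> = \<bar>max 0 (real N - \<rho> (edge_end e)) - max 0 (real N - \<rho> (fst e))\<bar> / N"
      by (simp only: \<phi>N diff_divide_distrib[symmetric] abs_divide abs_of_nat)
    also have "\<dots> \<le> 1 / N" using tent_bound[OF \<rho>1, of N e] by (intro divide_right_mono) auto
    finally have "\<bar>\<phi> (edge_end e) - \<phi> (fst e)\<bar> \<le> \<bar>1 / real N\<bar>" by simp
    then show ?thesis unfolding abs_le_square_iff by (simp add: power_divide)
  qed
  \<comment> \<open>For a base vertex outside this box the distance exceeds \<open>N\<close>, so it
    is still at least \<open>N\<close> at the other end, and the tent vanishes at both.\<close>
  define F :: "grid_edge set" where "F = ({fst a - int N..fst a + int N} \<times> {snd a - int N..snd a + int N}) \<times> UNIV"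
  have F: "finite F" by (simp add: F_def)
  have cF: "card F = 2 * (2 * N + 1)\<^sup>2"
  proof -
    have "card {z - int N..z + int N} = 2 * N + 1" for z by simp
    then show ?thesis by (simp only: F_def card_cartesian_product card_UNIV_bool power2_eq_square mult_ac)
  qed
  have "2 * N + 1 \<le> 3 * N" using N by simp
  then have "(2 * N + 1)\<^sup>2 \<le> (3 * N)\<^sup>2" by (rule power_mono) simp
  then have "card F \<le> 18 * N\<^sup>2" unfolding cF by (simp add: power_mult_distrib)
  then have cF: "real (card F) \<le> 18 * (real N)\<^sup>2" by (metis of_nat_le_iff of_nat_mult of_nat_numeral of_nat_power)
  have out: "\<phi> (fst e) = 0 \<and> \<phi> (edge_end e) = 0" if "e \<notin> F" for e
  proof -
    have "\<rho> (fst e) > int N" using that unfolding F_def \<rho>_def by (cases e; cases "fst e") auto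
    then have "\<rho> (fst e) \<ge> int N" "\<rho> (edge_end e) \<ge> int N" using \<rho>1[of e] by linarith+
    then show ?thesis unfolding \<phi>N by auto
  qed
  have m: "em w summable_on UNIV" "infsum (em w) UNIV \<le> card F * (2 * eps)"
  proof -
    have "em w e \<le> 2 * eps" for e
    proof -
      have "(\<phi> (fst e))\<^sup>2 + (\<phi> (edge_end e))\<^sup>2 \<le> 1 + 1" using \<phi>01 by (intro add_mono power_le_one) auto
      then have "eps * ((\<phi> (fst e))\<^sup>2 + (\<phi> (edge_end e))\<^sup>2) \<le> eps * 2" using eps_pos by (intro mult_left_mono) auto
      then show ?thesis using w(4)[of e] by simp
    qed
    moreover have "em w e = 0" if "e \<notin> F" for e using w(4)[of e] out[OF that] edge_Lr_nonneg[of w 2 e] by simp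
    ultimately show "em w summable_on UNIV" "infsum (em w) UNIV \<le> card F * (2 * eps)"
      using infsum_le_card[OF F, of "em w" "2 * eps"] by auto
  qed
  have d: "ed w summable_on UNIV" "infsum (ed w) UNIV \<le> card F * (1 / (real N)\<^sup>2 / eps)"
  proof -
    have "ed w e \<le> 1 / (real N)\<^sup>2 / eps" for e
      unfolding w(3) using eps_pos by (intro divide_right_mono step) auto
    moreover have "ed w e = 0" if "e \<notin> F" for e using w(3)[of e] out[OF that] by simp
    ultimately show "ed w summable_on UNIV" "infsum (ed w) UNIV \<le> card F * (1 / (real N)\<^sup>2 / eps)"
      using infsum_le_card[OF F, of "ed w" "1 / (real N)\<^sup>2 / eps"] by auto
  qed
  show thesis
  proof (rule that)
    show "w \<in> H1 eps" using w(1) m(1) d(1) by (simp add: H1_iff)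
    show "w (vtx eps k) = max 0 (1 - of_int (max \<bar>fst k - fst a\<bar> \<bar>snd k - snd a\<bar>) / N)" for k
      unfolding w(2) \<phi>_def \<rho>_def ..
    have "card F * (1 / (real N)\<^sup>2 / eps) \<le> (18 * (real N)\<^sup>2) * (1 / (real N)\<^sup>2 / eps)"
      using eps_pos by (intro mult_right_mono cF) auto
    then show "D w \<le> 18 / eps" using d(2) N by (simp add: dnorm2_def)
    have "card F * (2 * eps) \<le> (18 * (real N)\<^sup>2) * (2 * eps)"
      using eps_pos by (intro mult_right_mono cF) auto
    then have "infsum (em w) UNIV \<le> (18 * (real N)\<^sup>2) * (2 * eps)" using m(2) by (rule order_trans[rotated])
    then show "M w \<le> 36 * eps * (real N)\<^sup>2" by (simp add: Lr_pow_def mult_ac)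
  qed
qed

end

text \<open>Periods along the axes with a common length \<open>d\<close> make the cell a square, so
  that recentring is division with remainder in each coordinate.\<close>

locale nls_periodic = nls_grid eps p q \<alpha> \<beta> \<mu> V for eps p q \<alpha> \<beta> \<mu> and V :: "(int \<times> int) set" +
  fixes d :: int
  assumes d: "0 < d" and V_ne: "V \<noteq> {}" and V_per: "\<And>k i j. k \<in> V \<Longrightarrow> k + (d * i, d * j) \<in> V"
begin

lemma translate:
  assumes u: "u \<in> H1 eps"
  obtains w where "w \<in> H1 eps" "M w = M u" "E w = E u"
    "\<And>k b. em w (k, b) = em u (k + (d * i, d * j), b)"
proof -
  define c where "c = (d * i, d * j)"
  define w where "w x = u (x + vtx eps c)" for x
  define \<sigma> where "\<sigma> e = (fst e + c, snd e)" for e :: grid_edge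
  have efw: "ef w e t = ef u (\<sigma> e) t" for e t
    by (cases e) (simp add: edge_fun_def w_def \<sigma>_def edge_pt_translate)
  have bij: "bij_betw \<sigma> UNIV UNIV"
    by (rule bij_betw_byWitness[where f' = "\<lambda>e. (fst e - c, snd e)"]) (auto simp: \<sigma>_def)
  have Lr: "edge_Lr eps w r e = edge_Lr eps u r (\<sigma> e)" for r e
    by (rule edge_Lr_cong) (rule efw)
  have ed: "ed w e = ed u (\<sigma> e)" for e
    by (rule edge_dnorm2_cong) (rule efw)
  have "ef w e = ef u (\<sigma> e)" for e by (rule ext) (rule efw)
  then have "edge_H1 w" using H1D(1)[OF u] unfolding edge_H1_def by metis
  moreover have "em w summable_on UNIV" "ed w summable_on UNIV"
    using H1D(2,3)[OF u, of UNIV] summable_on_reindex_bij_betw[OF bij, of "em u"] summable_on_reindex_bij_betw[OF bij, of "ed u"]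
    by (simp_all add: Lr[symmetric] ed[symmetric])
  ultimately have H: "w \<in> H1 eps" by (simp add: H1_iff)
  have Lp: "Lr_pow eps w r = Lr_pow eps u r" for r
    unfolding Lr_pow_def using infsum_reindex_bij_betw[OF bij, of "edge_Lr eps u r"] by (simp add: Lr[symmetric])
  have Dw: "D w = D u"
    unfolding dnorm2_def using infsum_reindex_bij_betw[OF bij, of "ed u"] by (simp add: ed[symmetric])
  have bV: "bij_betw (\<lambda>k. k + c) V V"
  proof (rule bij_betw_byWitness[where f' = "\<lambda>k. k - c"])
    show "(\<lambda>k. k + c) ` V \<subseteq> V" using V_per[of _ i j] by (auto simp: c_def)
    show "(\<lambda>k. k - c) ` V \<subseteq> V" using V_per[of _ "-i" "-j"] by (auto simp: c_def minus_prod_def plus_prod_def)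
  qed auto
  have vtxc: "vtx eps k + vtx eps c = vtx eps (k + c)" for k by (simp add: vtx_def plus_prod_def algebra_simps)
  have "Q w = Q u"
    unfolding vs_def w_def vtxc using infsum_reindex_bij_betw[OF bV, of "\<lambda>k. \<bar>u (vtx eps k)\<bar> powr q"] by simp
  then have "E w = E u" by (simp add: E_def Lp Dw)
  moreover have "em w (k, b) = em u (k + (d * i, d * j), b)" for k b by (simp add: Lr \<sigma>_def c_def)
  ultimately show ?thesis using that H Lp by blast
qed

lemma recenter:
  assumes u: "u \<in> H1 eps" and e: "\<delta> \<le> em u e"
  obtains w k b where "w \<in> H1 eps" "M w = M u" "E w = E u" "k \<in> {0..<d} \<times> {0..<d}" "\<delta> \<le> em w (k, b)"
proof -
  obtain k1 k2 b where eb: "e = ((k1, k2), b)" by (metis surj_pair)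
  obtain w where w: "w \<in> H1 eps" "M w = M u" "E w = E u"
    "\<And>k b. em w (k, b) = em u (k + (d * (k1 div d), d * (k2 div d)), b)"
    by (rule translate[OF u]) blast
  have "em w ((k1 mod d, k2 mod d), b) = em u e"
    unfolding w(4) eb by (simp add: plus_prod_def)
  then show ?thesis using that[of w "(k1 mod d, k2 mod d)" b] w(1-3) e d by simp
qed

text \<open>Of the vertices of V, the n^2 translates of \<open>k0\<close> by fewer than
  \<open>n\<close> periods in each direction lie within half the radius of the tent, where its value
  is at least 1/2.\<close>

lemma Q_tent_lower:
  assumes n: "1 \<le> n" and k0: "k0 \<in> V" and w: "w \<in> H1 eps"
    and wv: "\<And>k. w (vtx eps k) = max 0 (1 - of_int (max \<bar>fst k - fst k0\<bar> \<bar>snd k - snd k0\<bar>) / real (2 * nat d * n))"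
  shows "(1/2) powr q * (real n)\<^sup>2 \<le> Q w"
proof -
  define X where "X = (\<lambda>(i, j). k0 + (d * int i, d * int j)) ` ({..<n} \<times> {..<n})"
  have X: "finite X" "X \<subseteq> V" using V_per[OF k0] by (auto simp: X_def)
  have cX: "card X = n * n"
    unfolding X_def using d by (subst card_image) (auto simp: inj_on_def card_cartesian_product)
  have "1/2 \<le> w (vtx eps k)" if "k \<in> X" for k
  proof -
    obtain i j where k: "k = k0 + (d * int i, d * int j)" "i < n" "j < n" using \<open>k \<in> X\<close> by (auto simp: X_def)
    have b: "\<bar>d * int m\<bar> \<le> d * int n" if "m < n" for m using that d by (simp add: abs_mult)
    have "max \<bar>fst k - fst k0\<bar> \<bar>snd k - snd k0\<bar> \<le> d * int n" using b[OF k(2)] b[OF k(3)] by (simp add: k(1))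
    then have "real_of_int (max \<bar>fst k - fst k0\<bar> \<bar>snd k - snd k0\<bar>) \<le> real_of_int (d * int n)" by linarith
    then have "real_of_int (max \<bar>fst k - fst k0\<bar> \<bar>snd k - snd k0\<bar>) / real (2 * nat d * n) \<le> real_of_int (d * int n) / real (2 * nat d * n)"
      by (rule divide_right_mono) simp
    also have "\<dots> = 1/2" using n d by simp
    finally show ?thesis unfolding wv using diff_left_mono[of _ "1/2" 1] by (intro max.coboundedI2) fastforce
  qed
  then have "(1/2) powr q \<le> \<bar>w (vtx eps k)\<bar> powr q" if "k \<in> X" for k
    using that[THEN \<open>\<And>k. k \<in> X \<Longrightarrow> 1/2 \<le> w (vtx eps k)\<close>] q by (intro powr_mono2) auto
  then have "real (card X) * (1/2) powr q \<le> (\<Sum>k\<in>X. \<bar>w (vtx eps k)\<bar> powr q)"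
    by (rule sum_bounded_below)
  also have "\<dots> \<le> Q w" unfolding vs_def by (intro finite_sum_le_infsum vs_summable w pq_ge X) auto
  finally show ?thesis by (simp add: cX power2_eq_square mult.commute)
qed

text \<open>Spreading a tent over \<open>n\<^sup>2\<close> periods, \<open>D\<close> decays like \<open>n\<^sup>-\<^sup>2\<close> but the vertex term only like \<open>n\<^sup>2\<^sup>-\<^sup>q\<close>.\<close>

lemma negative_energy:
  obtains u where "u \<in> H1 eps" "M u = \<mu>" "E u < 0"
proof -
  obtain k0 where k0: "k0 \<in> V" using V_ne by blast
  \<comment> \<open>The tent has mass at most 36 eps N^2 = 144 eps d^2 n^2. Normalisation thus
    multiplies it by at least the square root of \<mu> / (144 eps d^2 n^2), whose power
    \<open>q - 2\<close> without \<open>n\<close> is \<open>A\<close>.\<close>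
  define A where "A = (\<mu> / (144 * eps * (real_of_int d)\<^sup>2)) powr ((q - 2) / 2)"
  have A: "0 < A" unfolding A_def using \<mu> eps_pos d by simp
  define C where "C = \<beta> / q * (A * (1/2) powr q)"
  have C: "0 < C" unfolding C_def using A by (intro mult_pos_pos coef_pos) auto
  \<comment> \<open>\<open>9 / eps\<close> bounds half of \<open>D\<close> for the tent;
    \<open>n\<close> is taken so large that \<open>C * real n powr (4 - q)\<close> exceeds
    it.\<close>
  define c where "c = 9 / eps / C"
  have c: "0 < c" using C eps_pos by (simp add: c_def)
  obtain n where n': "max 1 (c powr (1 / (4 - q))) < real n" using reals_Archimedean2 by blast
  have "c = (c powr (1 / (4 - q))) powr (4 - q)" using c q by (simp add: powr_powr)
  also have "\<dots> < real n powr (4 - q)" using n' q by (intro powr_less_mono2) auto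
  finally have n: "9 / eps / C < real n powr (4 - q)" "1 \<le> n" using n' by (auto simp: c_def)
  define N where "N = 2 * nat d * n"
  have N: "1 \<le> N" "real N = 2 * real_of_int d * real n" using d n by (auto simp: N_def)
  obtain w where w: "w \<in> H1 eps" 
    "\<And>k. w (vtx eps k) = max 0 (1 - of_int (max \<bar>fst k - fst k0\<bar> \<bar>snd k - snd k0\<bar>) / N)"
    "D w \<le> 18 / eps" "M w \<le> 36 * eps * (real N)\<^sup>2"
    by (rule tent[OF N(1), of k0]) blast
  have Q: "(1/2) powr q * (real n)\<^sup>2 \<le> Q w"
    by (rule Q_tent_lower[OF n(2) k0 w(1)]) (use w(2) N_def in simp)
  have "w (vtx eps k0) = 1" using w(2)[of k0] by simp
  then have M0: "0 < M w" using vertex_zero_if_massless[OF w(1), of k0] Lr_pow_nonneg[of w 2] by fastforce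
  define \<nu> where "\<nu> = sqrt (\<mu> / M w)"
  have l: "0 < \<nu>" "\<nu>\<^sup>2 = \<mu> / M w" using \<mu> M0 by (auto simp: \<nu>_def)
  have lq: "\<nu> powr (q - 2) \<ge> A * real n powr (2 - q)"
  proof -
    have "A * real n powr (2 - q) = (\<mu> / (144 * eps * (real_of_int d)\<^sup>2)) powr ((q - 2) / 2) * ((1 / (real n)\<^sup>2)) powr ((q - 2) / 2)"
    proof -
      have "1 / (real n)\<^sup>2 = real n powr (-2)" using n by (simp add: powr_minus divide_inverse)
      moreover have "- 2 * ((q - 2) / 2) = 2 - q" by simp
      ultimately have "(1 / (real n)\<^sup>2) powr ((q - 2) / 2) = real n powr (2 - q)" by (simp only: powr_powr)
      then show ?thesis by (simp add: A_def)
    qed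
    also have "\<dots> = (\<mu> / (36 * eps * (real N)\<^sup>2)) powr ((q - 2) / 2)"
      using \<mu> eps_pos by (subst powr_mult[symmetric]) (auto simp: N(2) power_mult_distrib mult_ac)
    also have "\<dots> \<le> (\<mu> / M w) powr ((q - 2) / 2)"
      using w(4) M0 \<mu> q eps_pos N(1) by (intro powr_mono2 divide_left_mono) auto
    also have "\<dots> = \<nu> powr (q - 2)"
      unfolding \<nu>_def using \<mu> M0 by (simp add: powr_half_sqrt[symmetric] powr_powr)
    finally show ?thesis .
  qed
  have "C * real n powr (4 - q) = \<beta> / q * ((A * real n powr (2 - q)) * ((1/2) powr q * (real n)\<^sup>2))"
  proof -
    have "real n powr (4 - q) = real n powr (2 - q) * real n powr 2" unfolding powr_add[symmetric] by simp
    then show ?thesis using n by (simp add: C_def)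
  qed
  also have "\<dots> \<le> \<beta> / q * (\<nu> powr (q - 2) * Q w)"
    using coef_pos A by (intro mult_left_mono mult_mono lq Q) auto
  finally have "C * real n powr (4 - q) \<le> \<beta> / q * (\<nu> powr (q - 2) * Q w)" .
  moreover have "9 / eps < C * real n powr (4 - q)"
    using n(1) unfolding pos_divide_less_eq[OF C] by (simp only: mult.commute)
  ultimately have "9 / eps < \<beta> / q * (\<nu> powr (q - 2) * Q w)" by (rule less_le_trans[rotated])
  note big = this
  have "\<nu>\<^sup>2 * (D w / 2) < \<nu>\<^sup>2 * (\<beta> / q * (\<nu> powr (q - 2) * Q w))"
  proof (rule mult_strict_left_mono)
    have "D w / 2 \<le> 9 / eps" using w(3) by simp
    then show "D w / 2 < \<beta> / q * (\<nu> powr (q - 2) * Q w)"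
      using big by (rule le_less_trans)
  qed (use l(1) in simp)
  moreover have "\<nu>\<^sup>2 * (\<beta> / q * (\<nu> powr (q - 2) * Q w)) = \<beta> / q * (\<nu> powr q * Q w)"
  proof -
    have "\<nu> powr q = \<nu> powr 2 * \<nu> powr (q - 2)" unfolding powr_add[symmetric] by simp
    then show ?thesis using l(1) by simp
  qed
  moreover have "0 \<le> \<alpha> / p * (\<nu> powr p * P w)" using coef_pos by (intro mult_nonneg_nonneg Lr_pow_nonneg) auto
  ultimately have "E (\<lambda>x. \<nu> * w x) < 0"
  proof -
    have "c * x / 2 - y - z < 0" if "c * (x / 2) < t" "t = z" "0 \<le> y" for c x y z t :: real using that by simp
    from this[OF \<open>\<nu>\<^sup>2 * (D w / 2) < _\<close> \<open>_ = \<beta> / q * (\<nu> powr q * Q w)\<close> \<open>0 \<le> \<alpha> / p * _\<close>]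
    show ?thesis unfolding E_scale[OF w(1)] using l(1) by (simp only: abs_of_pos)
  qed
  moreover have "M (\<lambda>x. \<nu> * w x) = \<mu>" using M0 by (simp add: M_scale l(2))
  ultimately show ?thesis using that H1_scale[OF w(1)] by blast
qed

end

section \<open>Tightness\<close>

context grid_graph
begin

definition square :: "nat \<Rightarrow> (int \<times> int) set" where
  "square R = {- int R..int R} \<times> {- int R..int R}"

lemma edge_end_cases: "edge_end e = (fst (fst e) + 1, snd (fst e)) \<or> edge_end e = (fst (fst e), snd (fst e) + 1)"
  by (simp add: edge_end_def)

lemma square_step:
  assumes "R < R'" 
  shows "fst e \<in> square R \<Longrightarrow> edge_end e \<in> square R'" "edge_end e \<in> square R \<Longrightarrow> fst e \<in> square R'" "k \<in> square R \<Longrightarrow> k \<in> square R'"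
  using assms edge_end_cases[of e] by (cases "fst e"; auto simp: square_def)+

text \<open>An edge changes the max norm by at most 1, so it can leave only one of the
  squares.\<close>

lemma bdry_square_disjoint:
  assumes "R \<noteq> R'"
  shows "bdry (square R) \<inter> bdry (square R') = {}"
proof -
  have "e \<notin> bdry (square R')" if "R < R'" "e \<in> bdry (square R)" for R R' e
    using square_step(1,2)[OF that(1), of e] that(2) square_step(3)[OF that(1)] unfolding bdry_def mem_Collect_eq by blast
  then show ?thesis using assms by (metis disjoint_iff linorder_neqE_nat)
qed

lemma finite_inner_square: "finite (inner (square R))"
proof -
  have "inner (square R) \<subseteq> square R \<times> UNIV" by (auto simp: inner_def)
  then show ?thesis by (rule finite_subset) (simp add: square_def)
qed

lemma inner_square_mono: "R < R' \<Longrightarrow> inner (square R) \<subseteq> inner (square R')"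
  unfolding inner_def using square_step(3) by blast

text \<open>Pigeonhole: \<open>n\<close> disjoint boundaries share at most \<open>M u + D u\<close>.
  The lower bound \<open>a\<close> lets the square be chosen large enough to contain a given
  cell.\<close>

lemma small_boundary:
  assumes u: "u \<in> H1 eps" and n: "1 \<le> n"
  obtains R where "a \<le> R" "R < a + n" "hB u (square R) \<le> (M u + D u) / n"
proof -
  have "\<exists>R\<in>{a..<a+n}. hB u (square R) \<le> (M u + D u) / n"
  proof (rule ccontr)
    assume "\<not> ?thesis"
    then have "(M u + D u) / n \<le> hB u (square R)" "(M u + D u) / n < hB u (square R)" if "R \<in> {a..<a+n}" for R
      using that by force+
    then have "(\<Sum>R\<in>{a..<a+n}. (M u + D u) / n) < (\<Sum>R\<in>{a..<a+n}. hB u (square R))"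
      using n by (intro sum_strict_mono) auto
    also have "\<dots> = (\<Sum>\<^sub>\<infinity>e\<in>(\<Union>R\<in>{a..<a+n}. bdry (square R)). em u e + ed u e)"
      unfolding hB_def by (rule sum_infsum) (auto intro: h_summable[OF u] simp: bdry_square_disjoint)
    also have "\<dots> \<le> (\<Sum>\<^sub>\<infinity>e. em u e + ed u e)"
      by (intro infsum_mono2 h_summable u) (auto simp: edge_Lr_nonneg edge_dnorm2_nonneg)
    also have "\<dots> = M u + D u"
      unfolding Lr_pow_def dnorm2_def by (intro infsum_add H1D u)
    finally show False using n by simp
  qed
  then show ?thesis using that by auto
qed

lemma bdry_Compl: "bdry (- S) = bdry S"
  by (auto simp: bdry_def)

end

section \<open>Almost additivity of the energy under a cut\<close>

context nls_grid
begin

text \<open>Cutting along vertices gives every vertex to exactly one piece, so \<open>Q\<close> is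
  exactly additive. \<open>D\<close> and \<open>P\<close> change only on crossing edges. Both pieces
  pay for the affine slopes, and the 1/2 in front of \<open>D\<close> reduces this to a single
  \<open>C0 / eps\<close>.\<close>

lemma energy_cut:
  assumes u: "u \<in> H1 eps" and sup: "\<And>e t. t \<in> {0..eps} \<Longrightarrow> \<bar>ef u e t\<bar> \<le> S"
  obtains v w where "v \<in> H1 eps" "w \<in> H1 eps"
    "\<And>e r. e \<in> inner K \<Longrightarrow> edge_Lr eps v r e = edge_Lr eps u r e"
    "infsum (em u) (inner K) \<le> M v" "M v \<le> infsum (em u) (inner K) + eps * C0 * hB u K"
    "infsum (em u) (inner (- K)) \<le> M w" "M w \<le> infsum (em u) (inner (- K)) + eps * C0 * hB u K"
    "E v + E w \<le> E u + (C0 / eps + \<alpha> / p * S powr (p - 2)) * hB u K"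
proof -
  obtain v where v: "v \<in> H1 eps" "\<And>k. v (vtx eps k) = (if k \<in> K then u (vtx eps k) else 0)"
    "\<And>e r. e \<in> inner K \<Longrightarrow> edge_Lr eps v r e = edge_Lr eps u r e"
    "M v \<le> infsum (em u) (inner K) + eps * C0 * hB u K"
    "infsum (em u) (inner K) \<le> M v"
    "D v \<le> infsum (ed u) (inner K) + C0 / eps * hB u K"
    by (rule cut[OF u]) blast
  obtain w where w: "w \<in> H1 eps" "\<And>k. w (vtx eps k) = (if k \<in> - K then u (vtx eps k) else 0)"
    "\<And>e r. e \<in> inner (- K) \<Longrightarrow> edge_Lr eps w r e = edge_Lr eps u r e"
    "M w \<le> infsum (em u) (inner (- K)) + eps * C0 * hB u (- K)"
    "infsum (em u) (inner (- K)) \<le> M w"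
    "D w \<le> infsum (ed u) (inner (- K)) + C0 / eps * hB u (- K)"
    by (rule cut[OF u, of "- K"]) blast
  have hBC: "hB u (- K) = hB u K" by (simp add: hB_def bdry_Compl)
  have "D v + D w \<le> D u + 2 * (C0 / eps * hB u K)"
  proof -
    have "0 \<le> infsum (ed u) (bdry K)" by (intro infsum_nonneg edge_dnorm2_nonneg)
    then have "infsum (ed u) (inner K) + infsum (ed u) (inner (- K)) \<le> D u"
      unfolding dnorm2_def infsum_split_cut[OF H1D(3)[OF u], of K] by simp
    then show ?thesis using v(6) w(6) unfolding hBC by linarith
  qed
  moreover have "P u \<le> P v + P w + S powr (p - 2) * hB u K"
  proof -
    note sm = Lr_summable[OF _ pq_ge(1)]
    have "infsum (edge_Lr eps u p) (inner K) = infsum (edge_Lr eps v p) (inner K)" 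
      by (intro infsum_cong) (simp add: v(3))
    also have "\<dots> \<le> P v" unfolding Lr_pow_def
      by (intro infsum_mono2 sm v) (auto simp: edge_Lr_nonneg)
    finally have 1: "infsum (edge_Lr eps u p) (inner K) \<le> P v" .
    have "infsum (edge_Lr eps u p) (inner (- K)) = infsum (edge_Lr eps w p) (inner (- K))" 
      by (intro infsum_cong) (simp add: w(3))
    also have "\<dots> \<le> P w" unfolding Lr_pow_def
      by (intro infsum_mono2 sm w) (auto simp: edge_Lr_nonneg)
    finally have 2: "infsum (edge_Lr eps u p) (inner (- K)) \<le> P w" .
    have "infsum (edge_Lr eps u p) (bdry K) \<le> S powr (p - 2) * hB u K"
      unfolding hB_def infsum_cmult_right'[symmetric]
    proof (intro infsum_mono sm u summable_on_cmult_right h_summable)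
      fix e
      have "edge_Lr eps u p e \<le> S powr (p - 2) * em u e"
        by (intro edge_Lr_le_mass H1D u pq_ge sup)
      also have "\<dots> \<le> S powr (p - 2) * (em u e + ed u e)"
        by (intro mult_left_mono) (auto simp: edge_dnorm2_nonneg)
      finally show "edge_Lr eps u p e \<le> S powr (p - 2) * (em u e + ed u e)" .
    qed
    with 1 2 show ?thesis
      unfolding Lr_pow_def[of _ u] infsum_split_cut[OF sm[OF u], of K] by linarith
  qed
  moreover have "Q u = Q v + Q w"
  proof -
    have "Q u = (\<Sum>\<^sub>\<infinity>k\<in>V. \<bar>v (vtx eps k)\<bar> powr q + \<bar>w (vtx eps k)\<bar> powr q)"
      unfolding vs_def by (intro infsum_cong) (auto simp: v(2) w(2))
    also have "\<dots> = Q v + Q w" unfolding vs_def by (intro infsum_add vs_summable v w pq_ge)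
    finally show ?thesis .
  qed
  ultimately have "E v + E w \<le> E u + (C0 / eps + \<alpha> / p * S powr (p - 2)) * hB u K"
  proof -
    have "\<alpha> / p * P u \<le> \<alpha> / p * (P v + P w + S powr (p - 2) * hB u K)"
      using \<open>P u \<le> _\<close> coef_pos by (intro mult_left_mono) auto
    moreover have "Dv / 2 - a * Pv - b * Qv + (Dw / 2 - a * Pw - b * Qw) \<le> Du / 2 - a * Pu - b * (Qv + Qw) + (c + a * S') * h"
      if "a * Pu \<le> a * (Pv + Pw + S' * h)" "Dv + Dw \<le> Du + 2 * (c * h)" for Dv Dw Du Pv Pw Pu Qv Qw a b c h S' :: real
      using that by (simp add: algebra_simps)
    ultimately show ?thesis using \<open>D v + D w \<le> _\<close> unfolding E_def \<open>Q u = _\<close> by blast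
  qed
  then show ?thesis using that[of v w] v w unfolding hBC by blast
qed

end

context nls_periodic
begin

text \<open>Strict subadditivity in quantitative form. If mass \<omega> lies outside, the cut leaves
  an inner piece that holds the edge of mass \<delta> and yet has mass well below \<mu>, so
  rescaling it gains \<gamma>. The outer piece has at least its proportional share of
  \<open>I\<close>. Since the cut costs at most half of \<gamma>, the energy is too far above
  \<open>I\<close>.\<close>

lemma tightness:
  assumes I: "I < 0" "\<And>w. w \<in> H1 eps \<Longrightarrow> M w = \<mu> \<Longrightarrow> I \<le> E w"
    and \<delta>: "0 < \<delta>" and \<omega>: "0 < \<omega>"
  obtains F \<eta> where "finite F" "0 < \<eta>"
    "\<And>u k b. u \<in> H1 eps \<Longrightarrow> M u = \<mu> \<Longrightarrow> E u \<le> I + \<eta> \<Longrightarrow> k \<in> {0..<d} \<times> {0..<d} \<Longrightarrow> \<delta> \<le> em u (k, b) 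
        \<Longrightarrow> infsum (em u) (- F) \<le> \<omega>"
proof (cases "\<omega> < \<mu>")
  \<comment> \<open>The total mass is at most \<omega>, so the empty set will do.\<close>
  case False
  have "infsum (em u) (- {}) \<le> \<omega>" if "M u = \<mu>" for u
    using that False by (simp add: Lr_pow_def)
  then show ?thesis using that[of "{}" 1] by auto
next
  case True
  obtain B where B: "0 \<le> B" "\<And>u. u \<in> H1 eps \<Longrightarrow> M u = \<mu> \<Longrightarrow> D u \<le> 4 * E u + B"
    by (rule coercive) blast
  define H where "H = \<mu> + (4 + B)"
  have H: "0 < H" using \<mu> B by (simp add: H_def)
  define S where "S = sqrt (C0 * H)"
  define c1 where "c1 = sqrt (\<delta> / (2 * eps)) powr (p - 2) * \<delta> / 2"
  have c1: "0 < c1" using \<delta> eps_pos by (simp add: c1_def)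
  define g where "g = (\<mu> / (\<mu> - \<omega> / 2)) powr ((p - 2) / 2) - 1"
  have "1 powr ((p - 2) / 2) < (\<mu> / (\<mu> - \<omega> / 2)) powr ((p - 2) / 2)"
    using \<omega> True p by (intro powr_less_mono2) auto
  then have g: "0 < g" by (simp add: g_def)
  \<comment> \<open>The gain for the inner piece: \<open>g\<close> is the excess factor at the
    largest mass it can have, \<open>\<mu> - \<omega> / 2\<close>, and \<open>c1\<close> is the
    bound on \<open>P\<close> from the edge of mass \<delta>.\<close>
  define \<gamma> where "\<gamma> = g * (\<alpha> / p * c1)"
  have \<gamma>: "0 < \<gamma>" unfolding \<gamma>_def by (intro mult_pos_pos g coef_pos c1)
  \<comment> \<open>Besides the cost of the cut, the two pieces may together exceed mass \<mu> by
    \<open>2 * (eps * C0)\<close> times the boundary norm. As \<open>I\<close> is negative, this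
    surplus lowers the bound and gives the last summand.\<close>
  define C where "C = C0 / eps + \<alpha> / p * S powr (p - 2) + 2 * (eps * C0) * (- I) / \<mu>"
  have "0 < C0 / eps" using C0_pos eps_pos by simp
  moreover have "0 \<le> \<alpha> / p * S powr (p - 2)" by (intro mult_nonneg_nonneg less_imp_le[OF coef_pos(1)]) simp
  moreover have "0 \<le> 2 * (eps * C0) * (- I) / \<mu>" using C0_pos eps_pos I(1) \<mu> by (intro divide_nonneg_pos mult_nonneg_nonneg) auto
  ultimately have C: "0 < C" unfolding C_def by linarith
  define c where "c = eps * C0"
  have c: "0 < c" using C0_pos eps_pos by (simp add: c_def)
  \<comment> \<open>In this order the four bounds keep the cost below \<gamma>/2, the inner mass
    below \<open>\<mu> - \<omega> / 2\<close>, the outer mass below \<mu> and, by limiting what sits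
    on crossing edges, the outer mass positive.\<close>
  define T where "T = Min {\<gamma> / (2 * C), \<omega> / (2 * c), \<delta> / c, \<omega> / 2}"
  have T: "0 < T" unfolding T_def using \<gamma> C \<omega> c \<delta> by simp
  have "T \<le> \<gamma> / (2 * C)" "T \<le> \<omega> / (2 * c)" "T \<le> \<delta> / c" "T \<le> \<omega> / 2" unfolding T_def by (rule Min_le; simp)+
  then have T': "C * T \<le> \<gamma> / 2" "c * T \<le> \<omega> / 2" "c * T \<le> \<delta>" "T \<le> \<omega> / 2" using C c by (auto simp: field_simps)
  obtain n where n0: "max 1 (H / T) < real n" using reals_Archimedean2 by blast
  then have "H / T \<le> real n" by simp
  then have n: "1 \<le> n" "H / n \<le> T" using n0 T by (auto simp: field_simps)
  \<comment> \<open>The 1 yields the bound \<open>4 + B\<close> on \<open>D\<close>, and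
    \<open>\<gamma> / 3\<close> stays strictly below the remaining gain
    \<open>\<gamma> / 2\<close>.\<close>
  define \<eta> where "\<eta> = min 1 (\<gamma> / 3)"
  have \<eta>: "0 < \<eta>" using \<gamma> by (simp add: \<eta>_def)
  \<comment> \<open>The radius of the cut depends on \<open>u\<close> but stays below
    \<open>nat d + n\<close>, so this finite set covers all cases.\<close>
  define F where "F = inner (square (nat d + n))"
  have main: "infsum (em u) (- F) \<le> \<omega>"
    if u: "u \<in> H1 eps" "M u = \<mu>" "E u \<le> I + \<eta>" and k: "k \<in> {0..<d} \<times> {0..<d}" "\<delta> \<le> em u (k, b)" for u k b
  proof (rule ccontr)
    assume neg: "\<not> ?thesis"
    have "D u \<le> 4 + B" using B(2)[OF u(1,2)] u(3) I(1) by (simp add: \<eta>_def)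
    then have MD: "M u + D u \<le> H" unfolding H_def using u(2) by simp
    have sup: "\<bar>ef u e t\<bar> \<le> S" if t: "t \<in> {0..eps}" for e t
    proof -
      have "(ef u e t)\<^sup>2 \<le> C0 * (em u e + ed u e)" by (rule edge_sup_bound'[OF H1D(1)[OF u(1)] t])
      also have "\<dots> \<le> C0 * H" using em_le_M[OF u(1), of e] ed_le_D[OF u(1), of e] MD C0_pos by (intro mult_left_mono) auto
      finally show ?thesis unfolding S_def by (intro real_le_rsqrt) simp
    qed
    obtain R where R: "nat d \<le> R" "R < nat d + n" "hB u (square R) \<le> (M u + D u) / n"
      by (rule small_boundary[OF u(1) n(1)]) blast
    define t where "t = hB u (square R)"
    have t: "0 \<le> t" "t \<le> T"
    proof -
      show "0 \<le> t" unfolding t_def hB_def by (intro infsum_nonneg add_nonneg_nonneg edge_Lr_nonneg edge_dnorm2_nonneg)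
      have "t \<le> H / n" using R(3) MD divide_right_mono[OF MD, of "real n"] unfolding t_def by simp
      then show "t \<le> T" using n(2) by simp
    qed
    have ct: "c * t \<le> \<omega> / 2" "c * t \<le> \<delta>" "t \<le> \<omega> / 2" "C * t \<le> \<gamma> / 2" "0 \<le> c * t"
    proof -
      have "c * t \<le> c * T" "C * t \<le> C * T" using t c C by (auto intro: mult_left_mono)
      then show "c * t \<le> \<omega> / 2" "c * t \<le> \<delta>" "t \<le> \<omega> / 2" "C * t \<le> \<gamma> / 2" using T' t by linarith+
      show "0 \<le> c * t" using t c by simp
    qed
    obtain v w where vw: "v \<in> H1 eps" "w \<in> H1 eps"
      "\<And>e r. e \<in> inner (square R) \<Longrightarrow> edge_Lr eps v r e = edge_Lr eps u r e"
      "infsum (em u) (inner (square R)) \<le> M v" "M v \<le> infsum (em u) (inner (square R)) + c * t"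
      "infsum (em u) (inner (- square R)) \<le> M w" "M w \<le> infsum (em u) (inner (- square R)) + c * t"
      "E v + E w \<le> E u + (C0 / eps + \<alpha> / p * S powr (p - 2)) * t"
      unfolding c_def t_def by (rule energy_cut[OF u(1) sup, where K = "square R"]) blast+
    define min where "min = infsum (em u) (inner (square R))"
    define mout where "mout = infsum (em u) (inner (- square R))"
    define mb where "mb = infsum (em u) (bdry (square R))"
    have split: "\<mu> = min + mout + mb" 
      using infsum_split_cut[OF H1D(2)[OF u(1)], of "square R"] u(2) by (simp add: min_def mout_def mb_def Lr_pow_def)
    have mb: "0 \<le> mb" "mb \<le> t"
    proof -
      show "0 \<le> mb" unfolding mb_def by (intro infsum_nonneg edge_Lr_nonneg)
      show "mb \<le> t" unfolding mb_def t_def hB_def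
        by (intro infsum_mono H1D h_summable u) (simp add: edge_dnorm2_nonneg)
    qed
    \<comment> \<open>An edge based in the cell may end at coordinate \<open>d\<close> itself; this
      is why the radius starts at \<open>nat d\<close>.\<close>
    have kin: "(k, b) \<in> inner (square R)"
      using k(1) R(1) edge_end_cases[of "(k,b)"] d by (cases k) (auto simp: inner_def square_def)
    have minl: "\<delta> \<le> min"
      unfolding min_def using finite_sum_le_infsum[OF H1D(2)[OF u(1), of "inner (square R)"], of "{(k,b)}"] kin k(2)
      by (auto simp: edge_Lr_nonneg)
    have minu: "min < \<mu> - \<omega>"
    proof -
      have "min \<le> infsum (em u) F"
        unfolding min_def F_def by (intro infsum_mono2 H1D u inner_square_mono R) (auto simp: edge_Lr_nonneg)
      moreover have "infsum (em u) F + infsum (em u) (- F) = \<mu>"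
        using infsum_Un_disjoint[OF H1D(2)[OF u(1), of F] H1D(2)[OF u(1), of "- F"]] u(2) by (simp add: Lr_pow_def)
      ultimately show ?thesis using neg by simp
    qed
    have Mv: "0 < M v" "M v \<le> \<mu> - \<omega> / 2" using vw(4,5) minl minu \<delta> ct unfolding min_def[symmetric] by linarith+
    have Mw: "0 < M w" "M w \<le> \<mu>" using vw(6,7) minl minu split mb ct \<omega> unfolding mout_def[symmetric] by linarith+
    have sumM: "M v + M w \<le> \<mu> + 2 * (c * t)" using vw(5,7) split mb unfolding min_def[symmetric] mout_def[symmetric] by linarith
    have Ew: "(M w / \<mu>) * I \<le> E w" by (rule E_lower_by_scaling'[OF I(2) vw(2) Mw])
    have Ev: "(M v / \<mu>) * I + \<gamma> \<le> E v"
    proof -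
      have "(M v / \<mu>) * I + ((\<mu> / M v) powr ((p - 2) / 2) - 1) * (\<alpha> / p * P v) \<le> E v"
        using E_lower_by_scaling[OF I(2) vw(1) Mv(1)] Mv(2) \<omega> by simp
      moreover have "\<gamma> \<le> ((\<mu> / M v) powr ((p - 2) / 2) - 1) * (\<alpha> / p * P v)"
        unfolding \<gamma>_def
      proof (rule mult_mono)
        have "\<mu> / (\<mu> - \<omega> / 2) \<le> \<mu> / M v" using Mv \<mu> by (intro divide_left_mono) auto
        then show "g \<le> (\<mu> / M v) powr ((p - 2) / 2) - 1"
          unfolding g_def using p True \<omega> \<mu> by (intro diff_right_mono powr_mono2) auto
        then show "0 \<le> (\<mu> / M v) powr ((p - 2) / 2) - 1" using g by linarith
        have "c1 \<le> edge_Lr eps u p (k, b)" unfolding c1_def by (rule edge_Lr_lower[OF H1D(1)[OF u(1)] k(2) \<delta>])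
        also have "\<dots> = edge_Lr eps v p (k, b)" by (rule vw(3)[OF kin, symmetric])
        also have "\<dots> \<le> P v" unfolding Lr_pow_def
          using finite_sum_le_infsum[OF Lr_summable[OF vw(1) pq_ge(1), of UNIV], of "{(k,b)}"] by (auto simp: edge_Lr_nonneg)
        finally show "\<alpha> / p * c1 \<le> \<alpha> / p * P v" using coef_pos by (intro mult_left_mono) auto
        show "0 \<le> \<alpha> / p * c1" using coef_pos c1 by (intro mult_nonneg_nonneg) auto
      qed
      ultimately show ?thesis by linarith
    qed
    have "I + (2 * (eps * C0) * I / \<mu>) * t \<le> (M v / \<mu>) * I + (M w / \<mu>) * I"
    proof -
      have "(\<mu> + 2 * (c * t)) * I \<le> (M v + M w) * I" using sumM I(1) by (intro mult_right_mono_neg) auto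
      then have "(\<mu> + 2 * (c * t)) * I / \<mu> \<le> (M v + M w) * I / \<mu>" using \<mu> by (intro divide_right_mono) auto
      then show ?thesis using \<mu> by (simp add: c_def field_simps)
    qed
    then have "I + (2 * (eps * C0) * I / \<mu>) * t + \<gamma> \<le> E u + (C0 / eps + \<alpha> / p * S powr (p - 2)) * t"
      using Ev Ew vw(8) by linarith
    then have "I + \<gamma> \<le> E u + C * t" by (simp add: C_def algebra_simps)
    then have "I + \<gamma> / 2 \<le> E u" using ct(4) by linarith
    moreover have "\<eta> < \<gamma> / 2" using \<gamma> by (simp add: \<eta>_def)
    ultimately show False using u(3) by linarith
  qed
  show ?thesis by (rule that[OF _ \<eta> main]) (simp add: F_def finite_inner_square)
qed

end

section \<open>Convergence of minimising sequences\<close>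

text \<open>Fix \<kappa> first, to make the bounded part small, and then let \<open>n\<close> grow.
  No rate of convergence of \<open>w\<close> is required.\<close>

lemma tendsto_if_le_young:
  fixes X :: "nat \<Rightarrow> real"
  assumes le: "\<And>n \<kappa>. 0 < \<kappa> \<Longrightarrow> \<bar>X n - x\<bar> \<le> A * (\<kappa> * B + w n / \<kappa>)" and w: "w \<longlonglongrightarrow> 0" and A: "0 \<le> A" and B: "0 \<le> B"
  shows "X \<longlonglongrightarrow> x"
proof (rule tendstoI)
  fix e :: real assume e: "0 < e"
  define \<kappa> where "\<kappa> = e / (2 * (A * B + 1))"
  have AB: "0 < A * B + 1" using A B by (simp add: add_nonneg_pos)
  have \<kappa>: "0 < \<kappa>" using e AB by (simp add: \<kappa>_def)
  have "\<kappa> * (A * B) < \<kappa> * (A * B + 1)" using \<kappa> by simp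
  also have "\<dots> = e / 2"
  proof -
    have "e / (2 * x) * x = e / 2" if "0 < x" for x :: real using that by simp
    from this[OF AB] show ?thesis unfolding \<kappa>_def .
  qed
  finally have 1: "A * (\<kappa> * B) < e / 2" by (simp add: mult_ac)
  have "(\<lambda>n. A * (w n / \<kappa>)) \<longlonglongrightarrow> A * (0 / \<kappa>)" using \<kappa> by (intro tendsto_intros w) auto
  then have "eventually (\<lambda>n. A * (w n / \<kappa>) < e / 2) sequentially"
    using e by (intro order_tendstoD(2)) auto
  then show "eventually (\<lambda>n. dist (X n) x < e) sequentially"
  proof eventually_elim
    case (elim n)
    have "\<bar>X n - x\<bar> \<le> A * (\<kappa> * B) + A * (w n / \<kappa>)" using le[OF \<kappa>, of n] by (simp add: distrib_left)
    then show ?case using 1 elim unfolding dist_real_def by linarith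
  qed
qed

context grid_graph
begin

text \<open>Every point of the edge is within \<open>eps / k\<close> of a sample point, and Hoelder
  continuity controls the error. Pointwise convergence at countably many points thereby yields L^2
  convergence on the edge.\<close>

lemma edge_mass_sample:
  assumes w: "edge_H1 w" and k: "1 \<le> k"
  shows "em w e \<le> eps * (2 * (\<Sum>i\<le>k. (ef w e (eps * (real i / real k)))\<^sup>2) + 2 * (eps / k) * ed w e)"
proof -
  let ?t = "\<lambda>i. eps * (real i / real k)"
  define R where "R = 2 * (\<Sum>i\<le>k. (ef w e (?t i))\<^sup>2) + 2 * (eps / k) * ed w e"
  have le: "(ef w e t)\<^sup>2 \<le> R" if t: "t \<in> {0..eps}" for t
  proof -
    define i where "i = nat \<lfloor>t * k / eps\<rfloor>"
    have tk: "0 \<le> t * k / eps" "t * k / eps \<le> k" using t eps_pos k by (auto simp: field_simps)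
    then have i: "i \<le> k" "real i \<le> t * k / eps" "t * k / eps \<le> real i + 1"
      unfolding i_def by linarith+
    have d: "\<bar>t - ?t i\<bar> \<le> eps / k"
    proof -
      have "t - ?t i = (eps / k) * (t * k / eps - i)" using eps_pos k by (simp add: field_simps)
      also have "\<bar>\<dots>\<bar> \<le> (eps / k) * 1" using eps_pos i unfolding abs_mult by (intro mult_mono) auto
      finally show ?thesis by simp
    qed
    have ti: "?t i \<in> {0..eps}" using i(1) eps_pos k by (auto simp: field_simps)
    have "(ef w e t - ef w e (?t i))\<^sup>2 \<le> \<bar>t - ?t i\<bar> * ed w e" by (rule edge_holder[OF w ti t])
    also have "\<dots> \<le> (eps / k) * ed w e" using d by (intro mult_right_mono edge_dnorm2_nonneg)
    finally have "(ef w e t - ef w e (?t i))\<^sup>2 \<le> (eps / k) * ed w e" .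
    moreover have "(ef w e (?t i))\<^sup>2 \<le> (\<Sum>i\<le>k. (ef w e (?t i))\<^sup>2)"
      using i(1) by (intro member_le_sum) auto
    moreover have "(ef w e t)\<^sup>2 \<le> 2 * (ef w e (?t i))\<^sup>2 + 2 * (ef w e t - ef w e (?t i))\<^sup>2"
      using zero_le_power2[of "ef w e t - 2 * ef w e (?t i)"] by (simp add: power2_eq_square algebra_simps)
    ultimately show ?thesis unfolding R_def by linarith
  qed
  have "em w e \<le> (LBINT t:{0..eps}. R)"
    unfolding edge_mass_eq
    by (intro set_integral_mono set_integrable_Icc_continuous continuous_intros edge_H1_continuous w le)
  also have "\<dots> = eps * R" using set_integral_Icc_const(2)[of 0 eps R] eps_pos by simp
  finally show ?thesis unfolding R_def .
qed

lemma M_le_split: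
  assumes u: "u \<in> H1 eps" and v: "v \<in> H1 eps" and F: "finite F"
  shows "M (\<lambda>x. u x - v x) \<le> (\<Sum>e\<in>F. em (\<lambda>x. u x - v x) e) + 2 * infsum (em u) (- F) + 2 * infsum (em v) (- F)"
proof -
  note w = H1_diff[OF u v]
  have "M (\<lambda>x. u x - v x) = infsum (em (\<lambda>x. u x - v x)) F + infsum (em (\<lambda>x. u x - v x)) (- F)"
    using infsum_Un_disjoint[OF H1D(2)[OF w, of F] H1D(2)[OF w, of "- F"]] by (simp add: Lr_pow_def)
  also have "infsum (em (\<lambda>x. u x - v x)) (- F) \<le> (\<Sum>\<^sub>\<infinity>e\<in>- F. 2 * em u e + 2 * em v e)"
    by (intro infsum_mono H1D w infsum_add_cmult u v em_diff_le)
  also have "\<dots> = 2 * infsum (em u) (- F) + 2 * infsum (em v) (- F)"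
    by (intro infsum_add_cmult H1D u v)
  finally show ?thesis using F by simp
qed

end

section \<open>Derivatives of nearly minimising functions\<close>

context nls_grid
begin

text \<open>Parallelogram law for the midpoint, whose mass is at most \<open>\<mu>\<close> and whose energy is therefore at least \<open>I\<close>.
  The free parameter \<open>y\<close> is the constant in Young's inequality, and \<open>y\<^sup>2\<close> the length in the vertex bound.\<close>

lemma midpoint_estimate:
  assumes I: "I < 0" "\<And>w. w \<in> H1 eps \<Longrightarrow> M w = \<mu> \<Longrightarrow> I \<le> E w"
  obtains A where "0 \<le> A"
    "\<And>u v y. u \<in> H1 eps \<Longrightarrow> M u = \<mu> \<Longrightarrow> v \<in> H1 eps \<Longrightarrow> M v = \<mu> \<Longrightarrow> D u \<le> Dm \<Longrightarrow> D v \<le> Dm \<Longrightarrow>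
       0 < y \<Longrightarrow> y \<le> 1 \<Longrightarrow> y\<^sup>2 \<le> eps \<Longrightarrow> y ^ 4 < 4 * \<mu> \<Longrightarrow> M (\<lambda>x. u x - v x) \<le> y ^ 4 \<Longrightarrow>
       D (\<lambda>x. u x - v x) \<le> 4 * (E u + E v - 2 * I) + A * y"
proof -
  define S where "S = sqrt (C0 * (\<mu> + Dm))"
  define Ym where "Ym = 2 * \<mu> / eps + 2 * eps * Dm"
  \<comment> \<open>The absolute values keep the constant nonnegative before any function with
    \<open>D u \<le> Dm\<close> is at hand.\<close>
  define A where "A = 8 * (\<alpha> / p * (p * S powr (p - 2) * (2 * \<mu> + 1)) + \<beta> / q * (q * S powr (q - 2) * (2 * \<bar>Ym\<bar> + (2 + 8 * \<bar>Dm\<bar>))))"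
  have A: "0 \<le> A" unfolding A_def using p q \<mu> \<alpha> \<beta> by simp
  have "D (\<lambda>x. u x - v x) \<le> 4 * (E u + E v - 2 * I) + A * y"
    if u: "u \<in> H1 eps" "M u = \<mu>" "D u \<le> Dm" and v: "v \<in> H1 eps" "M v = \<mu>" "D v \<le> Dm"
      and y: "0 < y" "y \<le> 1" "y\<^sup>2 \<le> eps" "y ^ 4 < 4 * \<mu>" and w: "M (\<lambda>x. u x - v x) \<le> y ^ 4" for u v y
  proof -
    define W where "W = (\<lambda>x. u x - v x)"
    define a where "a = (\<lambda>x. 1/2 * (u x + v x))"
    have W: "W \<in> H1 eps" unfolding W_def by (rule H1_diff[OF u(1) v(1)])
    have a: "a \<in> H1 eps" unfolding a_def by (intro H1_scale H1_add u v)
    have Ma: "M a = \<mu> - M W / 4"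
    proof -
      have "M a = 1/4 * M (\<lambda>x. u x + v x)" unfolding a_def M_scale by (simp add: power2_eq_square)
      then show ?thesis using M_parallelogram[OF u(1) v(1)] u(2) v(2) by (simp add: W_def)
    qed
    have Da: "D a = (2 * D u + 2 * D v - D W) / 4"
    proof -
      have "D a = 1/4 * D (\<lambda>x. u x + v x)" unfolding a_def D_scale[OF H1_add[OF u(1) v(1)]] by (simp add: power2_eq_square)
      then show ?thesis using D_parallelogram[OF u(1) v(1)] by (simp add: W_def)
    qed
    have W4: "M W \<le> y ^ 4" using w by (simp add: W_def)
    have Ma2: "0 < M a" "M a \<le> \<mu>" using Ma W4 y Lr_pow_nonneg[of W 2] by linarith+
    have Da2: "D a \<le> Dm" using Da u(3) v(3) D_nonneg[of W] by simp
    have Dm: "0 \<le> Dm" using D_nonneg[of u] u(3) by simp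
    have DW: "D W \<le> 4 * Dm" using D_parallelogram[OF u(1) v(1)] D_nonneg[of "\<lambda>x. u x + v x"] u(3) v(3) by (simp add: W_def)
    \<comment> \<open>\<open>I\<close> is negative and the midpoint has at most mass \<mu>, so a
      share of \<open>I\<close> is no less than \<open>I\<close>. The bound
      \<open>y ^ 4 < 4 * \<mu>\<close> guarantees that the midpoint has positive mass.\<close>
    have "I \<le> (M a / \<mu>) * I"
      using Ma2 I(1) \<mu> mult_right_mono_neg[of "M a / \<mu>" 1 I] by simp
    also have "\<dots> \<le> E a" by (rule E_lower_by_scaling'[OF I(2) a Ma2])
    finally have Ea: "I \<le> E a" .
    have sup: "\<bar>ef f e t\<bar> \<le> S" if f: "f \<in> H1 eps" "M f \<le> \<mu>" "D f \<le> Dm" and t: "t \<in> {0..eps}" for f e t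
    proof -
      have "(ef f e t)\<^sup>2 \<le> C0 * (em f e + ed f e)" by (rule edge_sup_bound'[OF H1D(1)[OF f(1)] t])
      also have "\<dots> \<le> C0 * (\<mu> + Dm)" using em_le_M[OF f(1), of e] ed_le_D[OF f(1), of e] f(2,3) C0_pos by (intro mult_left_mono) auto
      finally show ?thesis unfolding S_def by (intro real_le_rsqrt) simp
    qed
    have Yb: "Y f \<le> \<bar>Ym\<bar>" if f: "f \<in> H1 eps" "M f \<le> \<mu>" "D f \<le> Dm" for f
    proof -
      have "Y f \<le> 2 * M f / eps + 2 * eps * D f" by (rule vertex_square_summable(2)[OF f(1) eps_pos order_refl])
      also have "\<dots> \<le> Ym" unfolding Ym_def using f eps_pos by (intro add_mono divide_right_mono mult_left_mono) auto
      finally show ?thesis by simp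
    qed
    \<comment> \<open>Why the mass is compared with \<open>y ^ 4\<close>: a window of length y^2
      makes both terms of order y^2, and the division by y in Young's inequality still leaves order
      y.\<close>
    have YW: "Y W \<le> (2 + 8 * Dm) * y\<^sup>2"
    proof -
      have "Y W \<le> 2 * M W / y\<^sup>2 + 2 * y\<^sup>2 * D W" using y by (intro vertex_square_summable(2)[OF W]) auto
      also have "\<dots> \<le> 2 * y ^ 4 / y\<^sup>2 + 2 * y\<^sup>2 * (4 * Dm)" using W4 DW by (intro add_mono divide_right_mono mult_left_mono) auto
      also have "\<dots> = (2 + 8 * Dm) * y\<^sup>2" using y by (simp add: power2_eq_square power4_eq_xxxx algebra_simps)
      finally show ?thesis .
    qed
    \<comment> \<open>Stated for \<open>f\<close> with a factor \<open>c\<close> so as to cover both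
      ends: u - a = W/2 and v - a = -W/2.\<close>
    have diff: "P f - P a \<le> p * S powr (p - 2) * (2 * \<mu> + 1) * y \<and> Q f - Q a \<le> q * S powr (q - 2) * (2 * \<bar>Ym\<bar> + (2 + 8 * \<bar>Dm\<bar>)) * y"
      if f: "f \<in> H1 eps" "M f = \<mu>" "D f \<le> Dm" and c: "(\<lambda>x. f x - a x) = (\<lambda>x. c * W x)" "c\<^sup>2 = 1/4" for f c
    proof
      have M4: "M (\<lambda>x. f x - a x) = M W / 4" "Y (\<lambda>x. f x - a x) = Y W / 4"
        unfolding c(1) M_scale vs_scale abs_powr_2 c(2) by simp_all
      have S: "\<bar>ef f e t\<bar> \<le> S" "\<bar>ef a e t\<bar> \<le> S" if "t \<in> {0..eps}" for e t
        using sup[of f] sup[of a] f a Ma2 Da2 that by auto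
      have "P f - P a \<le> p * S powr (p - 2) * (y * (M f + M a) + M (\<lambda>x. f x - a x) / y)"
        using Lr_pow_perturb[OF f(1) a pq_ge(1) y(1) S] by simp
      also have "\<dots> \<le> p * S powr (p - 2) * ((2 * \<mu> + 1) * y)"
      proof (rule mult_left_mono)
        have 1: "y * (M f + M a) \<le> (2 * \<mu>) * y" using f(2) Ma2 y by (subst mult.commute, intro mult_right_mono) auto
        have "M (\<lambda>x. f x - a x) / y \<le> y ^ 4 / y" unfolding M4 using W4 y Lr_pow_nonneg[of W 2] by (intro divide_right_mono) auto
        also have "y ^ 4 / y = y * y ^ 2" using y by (simp add: power2_eq_square power4_eq_xxxx)
        also have "y * y ^ 2 \<le> y * 1" using y by (intro mult_left_mono power_le_one) auto
        finally have 2: "M (\<lambda>x. f x - a x) / y \<le> 1 * y" by simp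
        from 1 2 show "y * (M f + M a) + M (\<lambda>x. f x - a x) / y \<le> (2 * \<mu> + 1) * y"
          unfolding distrib_right[of "2 * \<mu>"] by (rule add_mono)
      qed (use p in simp)
      finally show "P f - P a \<le> p * S powr (p - 2) * (2 * \<mu> + 1) * y" by (simp only: mult.assoc)
      have "Q f - Q a \<le> q * S powr (q - 2) * (y * (Y f + Y a) + Y (\<lambda>x. f x - a x) / y)"
        using vs_perturb[OF f(1) a pq_ge(2) y(1) S, of V] by simp
      also have "\<dots> \<le> q * S powr (q - 2) * ((2 * \<bar>Ym\<bar> + (2 + 8 * \<bar>Dm\<bar>)) * y)"
      proof (rule mult_left_mono)
        have 1: "y * (Y f + Y a) \<le> (2 * \<bar>Ym\<bar>) * y"
          using Yb[of f] Yb[of a] f a Ma2 Da2 y by (subst mult.commute, intro mult_right_mono) auto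
        have "Y (\<lambda>x. f x - a x) / y \<le> ((2 + 8 * Dm) * y\<^sup>2) / y" unfolding M4
          using YW vs_nonneg[of W 2 UNIV] y by (intro divide_right_mono) auto
        also have "((2 + 8 * Dm) * y\<^sup>2) / y = (2 + 8 * \<bar>Dm\<bar>) * y" using y Dm by (simp add: power2_eq_square)
        finally have 2: "Y (\<lambda>x. f x - a x) / y \<le> (2 + 8 * \<bar>Dm\<bar>) * y" .
        from 1 2 show "y * (Y f + Y a) + Y (\<lambda>x. f x - a x) / y \<le> (2 * \<bar>Ym\<bar> + (2 + 8 * \<bar>Dm\<bar>)) * y"
          unfolding distrib_right[of "2 * \<bar>Ym\<bar>"] by (rule add_mono)
      qed (use q in simp)
      finally show "Q f - Q a \<le> q * S powr (q - 2) * (2 * \<bar>Ym\<bar> + (2 + 8 * \<bar>Dm\<bar>)) * y" by (simp only: mult.assoc)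
    qed
    define p' where "p' = p * S powr (p - 2) * (2 * \<mu> + 1) * y"
    define q' where "q' = q * S powr (q - 2) * (2 * \<bar>Ym\<bar> + (2 + 8 * \<bar>Dm\<bar>)) * y"
    have du: "P u - P a \<le> p'" "Q u - Q a \<le> q'"
      using diff[OF u, of "1/2"] by (auto simp: a_def W_def fun_eq_iff field_simps power2_eq_square p'_def q'_def)
    have dv: "P v - P a \<le> p'" "Q v - Q a \<le> q'"
      using diff[OF v, of "-1/2"] by (auto simp: a_def W_def fun_eq_iff field_simps power2_eq_square p'_def q'_def)
    have "\<alpha> / p * ((P u + P v) / 2 - P a) \<le> \<alpha> / p * p'" "\<beta> / q * ((Q u + Q v) / 2 - Q a) \<le> \<beta> / q * q'"
    proof -
      have avg: "(x + y) / 2 - z \<le> c" if "x - z \<le> c" "y - z \<le> c" for x y z c :: real using that by argo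
      show "\<alpha> / p * ((P u + P v) / 2 - P a) \<le> \<alpha> / p * p'"
        by (rule mult_left_mono[OF avg[OF du(1) dv(1)] less_imp_le[OF coef_pos(1)]])
      show "\<beta> / q * ((Q u + Q v) / 2 - Q a) \<le> \<beta> / q * q'"
        by (rule mult_left_mono[OF avg[OF du(2) dv(2)] less_imp_le[OF coef_pos(2)]])
    qed
    then have "D W \<le> 4 * (E u + E v - 2 * I) + 8 * (\<alpha> / p * p' + \<beta> / q * q')"
    proof -
      have "Dw \<le> 4 * ((Du / 2 - s * Pu - t * Qu) + (Dv / 2 - s * Pv - t * Qv) - 2 * I) + 8 * (x + z)"
        if "s * ((Pu + Pv) / 2 - Pa) \<le> x" "t * ((Qu + Qv) / 2 - Qa) \<le> z" "I \<le> (2 * Du + 2 * Dv - Dw) / 4 / 2 - s * Pa - t * Qa"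
        for Dw Du Dv Pu Pv Pa Qu Qv Qa s t x z :: real
        using that by (simp add: algebra_simps)
      from this[OF \<open>\<alpha> / p * ((P u + P v) / 2 - P a) \<le> \<alpha> / p * p'\<close> \<open>\<beta> / q * ((Q u + Q v) / 2 - Q a) \<le> \<beta> / q * q'\<close> Ea[unfolded E_def Da]]
      show ?thesis unfolding E_def .
    qed
    also have "8 * (\<alpha> / p * p' + \<beta> / q * q') = A * y"
      unfolding A_def p'_def q'_def by (simp only: distrib_right mult.assoc)
    finally show ?thesis unfolding W_def .
  qed
  then show ?thesis using that A by blast
qed

end

section \<open>Completeness of the energy space\<close>

context grid_graph
begin

text \<open>The sup bound gives a pointwise limit and the edgewise theorem its derivative. The
  distance to the limit is then estimated on finite sets of edges, uniformly in the set, which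
  yields both summability and convergence of the infinite sums.\<close>

lemma H1_complete:
  assumes v: "\<And>n. v n \<in> H1 eps"
    and cauchy: "\<And>\<kappa>. 0 < \<kappa> \<Longrightarrow> \<exists>N. \<forall>m\<ge>N. \<forall>n\<ge>N. M (\<lambda>x. v m x - v n x) \<le> \<kappa> \<and> D (\<lambda>x. v m x - v n x) \<le> \<kappa>"
  obtains u where "u \<in> H1 eps" "\<And>e t. t \<in> {0..eps} \<Longrightarrow> (\<lambda>n. ef (v n) e t) \<longlonglongrightarrow> ef u e t"
    "(\<lambda>n. M (\<lambda>x. v n x - u x)) \<longlonglongrightarrow> 0" "(\<lambda>n. D (\<lambda>x. v n x - u x)) \<longlonglongrightarrow> 0"
proof -
  define u where "u x = lim (\<lambda>n. v n x)" for x
  have ef_diff: "ef (\<lambda>x. f x - g x) e t = ef f e t - ef g e t" for f g e t by (simp add: edge_fun_def)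
  have lim: "(\<lambda>n. ef (v n) e t) \<longlonglongrightarrow> ef u e t" if t: "t \<in> {0..eps}" for e t
  proof -
    have "Cauchy (\<lambda>n. ef (v n) e t)"
    proof (rule metric_CauchyI)
      fix \<epsilon> :: real assume \<epsilon>: "0 < \<epsilon>"
      define \<kappa> where "\<kappa> = \<epsilon>\<^sup>2 / (4 * C0)"
      have \<kappa>: "0 < \<kappa>" using \<epsilon> C0_pos by (simp add: \<kappa>_def)
      obtain N where N: "\<And>m n. m \<ge> N \<Longrightarrow> n \<ge> N \<Longrightarrow> M (\<lambda>x. v m x - v n x) \<le> \<kappa> \<and> D (\<lambda>x. v m x - v n x) \<le> \<kappa>"
        using cauchy[OF \<kappa>] by blast
      have "dist (ef (v m) e t) (ef (v n) e t) < \<epsilon>" if "m \<ge> N" "n \<ge> N" for m n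
      proof -
        note H = H1_diff[OF v[of m] v[of n]]
        have "(ef (v m) e t - ef (v n) e t)\<^sup>2 \<le> C0 * (em (\<lambda>x. v m x - v n x) e + ed (\<lambda>x. v m x - v n x) e)"
          using edge_sup_bound'[OF H1D(1)[OF H] t, of e] by (simp add: ef_diff)
        also have "\<dots> \<le> C0 * (\<kappa> + \<kappa>)"
          using em_le_M[OF H, of e] ed_le_D[OF H, of e] N[OF that] C0_pos by (intro mult_left_mono) auto
        also have "\<dots> < \<epsilon>\<^sup>2" using \<epsilon> C0_pos by (simp add: \<kappa>_def)
        finally have "\<bar>ef (v m) e t - ef (v n) e t\<bar>\<^sup>2 < \<epsilon>\<^sup>2" by (simp only: power2_abs)
        then show ?thesis unfolding dist_real_def by (rule power2_less_imp_less) (use \<epsilon> in simp)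
      qed
      then show "\<exists>N. \<forall>m\<ge>N. \<forall>n\<ge>N. dist (ef (v m) e t) (ef (v n) e t) < \<epsilon>" by blast
    qed
    then show ?thesis unfolding u_def edge_fun_def by (simp add: Cauchy_convergent_iff convergent_LIMSEQ_iff)
  qed
  have "\<exists>g. weak_deriv 0 eps (ef (v n) e) g" for n e using H1D(1)[OF v] unfolding edge_H1_def by blast
  then obtain G where G: "weak_deriv 0 eps (ef (v n) e) (G n e)" for n e by metis
  have "\<exists>g. weak_deriv 0 eps (ef u e) g \<and> (\<lambda>n. LBINT x:{0..eps}. (G n e x - g x)\<^sup>2) \<longlonglongrightarrow> 0" for e
  proof (rule weak_deriv_L2_limit[OF less_imp_le[OF eps_pos] G _ lim])
    fix \<kappa> :: real assume "0 < \<kappa>"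
    then obtain N where N: "\<And>m n. m \<ge> N \<Longrightarrow> n \<ge> N \<Longrightarrow> D (\<lambda>x. v m x - v n x) \<le> \<kappa>" using cauchy by blast
    have "(LBINT x:{0..eps}. (G m e x - G n e x)\<^sup>2) \<le> \<kappa>" if "m \<ge> N" "n \<ge> N" for m n
      using ed_diff_eq[OF G[of m e] G[of n e]] ed_le_D[OF H1_diff[OF v[of m] v[of n]], of e] N[OF that] by simp
    then show "\<exists>N. \<forall>m\<ge>N. \<forall>n\<ge>N. (LBINT x:{0..eps}. (G m e x - G n e x)\<^sup>2) \<le> \<kappa>" by blast
  qed
  then have "\<forall>e. \<exists>g. weak_deriv 0 eps (ef u e) g \<and> (\<lambda>n. LBINT x:{0..eps}. (G n e x - g x)\<^sup>2) \<longlonglongrightarrow> 0" ..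
  from choice[OF this] obtain g where "\<forall>e. weak_deriv 0 eps (ef u e) (g e) \<and> (\<lambda>n. LBINT x:{0..eps}. (G n e x - g e x)\<^sup>2) \<longlonglongrightarrow> 0" ..
  then have g: "weak_deriv 0 eps (ef u e) (g e)" "(\<lambda>n. LBINT x:{0..eps}. (G n e x - g e x)\<^sup>2) \<longlonglongrightarrow> 0" for e by blast+
  have uH: "edge_H1 u" unfolding edge_H1_def by (intro allI exI) (rule g(1))
  note wH = edge_H1_diff[OF H1D(1)[OF v] uH]
  have ed0: "(\<lambda>n. ed (\<lambda>x. v n x - u x) e) \<longlonglongrightarrow> 0" for e
    using g(2)[of e] by (simp add: ed_diff_eq[OF G g(1)])
  have em0: "(\<lambda>n. em (\<lambda>x. v n x - u x) e) \<longlonglongrightarrow> 0" for e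
  proof (rule tendsto_sandwich[OF _ _ tendsto_const])
    \<comment> \<open>Sampling at the two ends is enough here, because the derivatives also
      converge.\<close>
    let ?b = "\<lambda>n. eps * (2 * (\<Sum>i\<le>1. (ef (v n) e (eps * (real i / real 1)) - ef u e (eps * (real i / real 1)))\<^sup>2) + 2 * (eps / real 1) * ed (\<lambda>x. v n x - u x) e)"
    show "\<forall>\<^sub>F n in sequentially. 0 \<le> em (\<lambda>x. v n x - u x) e" by (simp add: edge_Lr_nonneg)
    show "\<forall>\<^sub>F n in sequentially. em (\<lambda>x. v n x - u x) e \<le> ?b n"
      unfolding ef_diff[symmetric] by (intro always_eventually allI edge_mass_sample wH order_refl)
    have "?b \<longlonglongrightarrow> eps * (2 * (\<Sum>i\<le>1. (ef u e (eps * (real i / real 1)) - ef u e (eps * (real i / real 1)))\<^sup>2) + 2 * (eps / real 1) * 0)"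
      using eps_pos by (intro tendsto_intros lim ed0) auto
    then show "?b \<longlonglongrightarrow> 0" by simp
  qed
  \<comment> \<open>The 3 is 2 * 1 + 2 * (1/2): the triangle inequality for squares costs a factor
    2, and \<open>m\<close> is taken so late that the second part is below \<kappa>/2 on the finite
    set.\<close>
  have key: "(\<lambda>x. v n x - u x) \<in> H1 eps \<and> M (\<lambda>x. v n x - u x) \<le> 3 * \<kappa> \<and> D (\<lambda>x. v n x - u x) \<le> 3 * \<kappa>"
    if N: "\<And>m n. m \<ge> N \<Longrightarrow> n \<ge> N \<Longrightarrow> M (\<lambda>x. v m x - v n x) \<le> \<kappa> \<and> D (\<lambda>x. v m x - v n x) \<le> \<kappa>"
      and n: "n \<ge> N" and \<kappa>: "0 < \<kappa>" for n N \<kappa>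
  proof -
    have eq: "(\<lambda>x. v n x - u x) = (\<lambda>x. (v n x - v m x) + (v m x - u x))" for m by auto
    have fin: "(\<Sum>e\<in>F. f (\<lambda>x. v n x - u x) e) \<le> 3 * \<kappa>"
      if F: "finite F" and f0: "\<And>e. (\<lambda>m. f (\<lambda>x. v m x - u x) e) \<longlonglongrightarrow> 0"
        and add: "\<And>a b e. edge_H1 a \<Longrightarrow> edge_H1 b \<Longrightarrow> f (\<lambda>x. a x + b x) e \<le> 2 * f a e + 2 * f b e"
        and fin: "\<And>m. m \<ge> N \<Longrightarrow> (\<Sum>e\<in>F. f (\<lambda>x. v n x - v m x) e) \<le> \<kappa>"
      for f :: "(real \<times> real \<Rightarrow> real) \<Rightarrow> grid_edge \<Rightarrow> real" and F
    proof -
      have "(\<lambda>m. \<Sum>e\<in>F. f (\<lambda>x. v m x - u x) e) \<longlonglongrightarrow> (\<Sum>e\<in>F. 0)" by (intro tendsto_sum f0)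
      then have "\<forall>\<^sub>F m in sequentially. (\<Sum>e\<in>F. f (\<lambda>x. v m x - u x) e) < \<kappa> / 2"
        using \<kappa> by (intro order_tendstoD(2)) auto
      then have "\<forall>\<^sub>F m in sequentially. (\<Sum>e\<in>F. f (\<lambda>x. v m x - u x) e) < \<kappa> / 2 \<and> m \<ge> N"
        using eventually_ge_at_top[of N] by eventually_elim simp
      then obtain m where m: "(\<Sum>e\<in>F. f (\<lambda>x. v m x - u x) e) < \<kappa> / 2" "m \<ge> N"
        unfolding eventually_sequentially by blast
      have "(\<Sum>e\<in>F. f (\<lambda>x. v n x - u x) e) \<le> (\<Sum>e\<in>F. 2 * f (\<lambda>x. v n x - v m x) e + 2 * f (\<lambda>x. v m x - u x) e)"
        unfolding eq[of m] by (intro sum_mono add edge_H1_diff H1D(1) v uH)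
      also have "\<dots> = 2 * (\<Sum>e\<in>F. f (\<lambda>x. v n x - v m x) e) + 2 * (\<Sum>e\<in>F. f (\<lambda>x. v m x - u x) e)"
        by (simp add: sum.distrib sum_distrib_left)
      finally show ?thesis using m(1) fin[OF m(2)] by linarith
    qed
    have mF: "(\<Sum>e\<in>F. em (\<lambda>x. v n x - u x) e) \<le> 3 * \<kappa>" if F: "finite F" for F
    proof (rule fin[OF F em0 em_add_le])
      fix m assume "m \<ge> N"
      then show "(\<Sum>e\<in>F. em (\<lambda>x. v n x - v m x) e) \<le> \<kappa>"
        using em_sum_le_M[OF H1_diff[OF v[of n] v[of m]] F] N[OF n] by (meson order_trans)
    qed
    have dF: "(\<Sum>e\<in>F. ed (\<lambda>x. v n x - u x) e) \<le> 3 * \<kappa>" if F: "finite F" for F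
    proof (rule fin[OF F ed0 ed_add_le])
      fix m assume m: "m \<ge> N"
      have "(\<Sum>e\<in>F. ed (\<lambda>x. v n x - v m x) e) \<le> D (\<lambda>x. v n x - v m x)"
        unfolding dnorm2_def by (intro finite_sum_le_infsum H1D H1_diff v F) (auto simp: edge_dnorm2_nonneg)
      then show "(\<Sum>e\<in>F. ed (\<lambda>x. v n x - v m x) e) \<le> \<kappa>" using N[OF n m] by simp
    qed
    have sm: "em (\<lambda>x. v n x - u x) summable_on UNIV" "ed (\<lambda>x. v n x - u x) summable_on UNIV"
      using mF dF by (intro nonneg_bdd_above_summable_on edge_Lr_nonneg edge_dnorm2_nonneg; auto simp: bdd_above_def)+
    have "M (\<lambda>x. v n x - u x) \<le> 3 * \<kappa>" unfolding Lr_pow_def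
      by (rule infsum_le_finite_sums[OF sm(1)]) (rule mF)
    moreover have "D (\<lambda>x. v n x - u x) \<le> 3 * \<kappa>" unfolding dnorm2_def
      by (rule infsum_le_finite_sums[OF sm(2)]) (rule dF)
    ultimately show ?thesis using sm wH by (simp add: H1_iff)
  qed
  obtain N1 where N1: "\<And>m n. m \<ge> N1 \<Longrightarrow> n \<ge> N1 \<Longrightarrow> M (\<lambda>x. v m x - v n x) \<le> 1 \<and> D (\<lambda>x. v m x - v n x) \<le> 1"
    using cauchy[of 1] by auto
  have "(\<lambda>x. v N1 x - u x) \<in> H1 eps" using key[OF N1, of N1] by simp
  from H1_diff[OF v[of N1] this] have u: "u \<in> H1 eps" by simp
  have to0: "X \<longlonglongrightarrow> 0" if X: "\<And>n. 0 \<le> X n" "\<And>\<kappa>. 0 < \<kappa> \<Longrightarrow> \<exists>N. \<forall>n\<ge>N. X n \<le> 3 * \<kappa>" for X :: "nat \<Rightarrow> real"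
  proof (rule LIMSEQ_I)
    fix e :: real assume e: "0 < e"
    then obtain N where N: "\<And>n. n \<ge> N \<Longrightarrow> X n \<le> 3 * (e / 4)" using X(2)[of "e / 4"] by auto
    have "norm (X n - 0) < e" if "n \<ge> N" for n using N[OF that] X(1)[of n] e by simp
    then show "\<exists>N. \<forall>n\<ge>N. norm (X n - 0) < e" by blast
  qed
  have small: "\<exists>N. \<forall>n\<ge>N. M (\<lambda>x. v n x - u x) \<le> 3 * \<kappa> \<and> D (\<lambda>x. v n x - u x) \<le> 3 * \<kappa>" if \<kappa>: "0 < \<kappa>" for \<kappa>
  proof -
    obtain N where N: "\<And>m n. m \<ge> N \<Longrightarrow> n \<ge> N \<Longrightarrow> M (\<lambda>x. v m x - v n x) \<le> \<kappa> \<and> D (\<lambda>x. v m x - v n x) \<le> \<kappa>"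
      using cauchy[OF \<kappa>] by blast
    have "M (\<lambda>x. v n x - u x) \<le> 3 * \<kappa> \<and> D (\<lambda>x. v n x - u x) \<le> 3 * \<kappa>" if "n \<ge> N" for n
      using key[OF N that \<kappa>] by simp
    then show ?thesis by blast
  qed
  show thesis
  proof (rule that[OF u lim])
    show "(\<lambda>n. M (\<lambda>x. v n x - u x)) \<longlonglongrightarrow> 0" by (rule to0[OF Lr_pow_nonneg]) (drule small, blast)
    show "(\<lambda>n. D (\<lambda>x. v n x - u x)) \<longlonglongrightarrow> 0" by (rule to0[OF D_nonneg]) (drule small, blast)
  qed
qed

end

context nls_grid
begin

text \<open>Pointwise convergence is assumed so that the limit inherits the uniform bound
  \<open>S\<close>, after which the perturbation estimates apply with one common constant.\<close>

lemma energy_continuous: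
  assumes v: "\<And>n. v n \<in> H1 eps" "\<And>n. M (v n) = \<mu>" "\<And>n. D (v n) \<le> B" and u: "u \<in> H1 eps"
    and pt: "\<And>e t. t \<in> {0..eps} \<Longrightarrow> (\<lambda>n. ef (v n) e t) \<longlonglongrightarrow> ef u e t"
    and M0: "(\<lambda>n. M (\<lambda>x. v n x - u x)) \<longlonglongrightarrow> 0" and D0: "(\<lambda>n. D (\<lambda>x. v n x - u x)) \<longlonglongrightarrow> 0"
  shows "M u = \<mu>" "(\<lambda>n. E (v n)) \<longlonglongrightarrow> E u"
proof -
  define S where "S = sqrt (C0 * (\<mu> + B))"
  have Sv: "\<bar>ef (v n) e t\<bar> \<le> S" if t: "t \<in> {0..eps}" for n e t
  proof -
    have "(ef (v n) e t)\<^sup>2 \<le> C0 * (em (v n) e + ed (v n) e)" by (rule edge_sup_bound'[OF H1D(1)[OF v(1)] t])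
    also have "\<dots> \<le> C0 * (\<mu> + B)"
      using em_le_M[OF v(1), of n e] ed_le_D[OF v(1), of n e] v(2,3)[of n] C0_pos by (intro mult_left_mono) auto
    finally show ?thesis unfolding S_def by (intro real_le_rsqrt) simp
  qed
  have Su: "\<bar>ef u e t\<bar> \<le> S" if t: "t \<in> {0..eps}" for e t
    by (rule LIMSEQ_le_const2[OF tendsto_rabs[OF pt[OF t]]]) (use Sv[OF t] in blast)
  define Yv where "Yv = 2 * \<mu> / eps + 2 * eps * B"
  have B0: "0 \<le> B" using D_nonneg[of "v 0"] v(3)[of 0] by simp
  have Yv: "Y (v n) \<le> Yv" for n
  proof -
    have "Y (v n) \<le> 2 * M (v n) / eps + 2 * eps * D (v n)" by (rule vertex_square_summable(2)[OF v(1) eps_pos order_refl])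
    also have "\<dots> \<le> Yv" unfolding Yv_def v(2) using v(3)[of n] eps_pos by simp
    finally show ?thesis .
  qed
  have Y0: "(\<lambda>n. Y (\<lambda>x. v n x - u x)) \<longlonglongrightarrow> 0"
  proof (rule tendsto_sandwich[OF _ _ tendsto_const])
    show "\<forall>\<^sub>F n in sequentially. 0 \<le> Y (\<lambda>x. v n x - u x)" by (simp add: vs_nonneg)
    show "\<forall>\<^sub>F n in sequentially. Y (\<lambda>x. v n x - u x) \<le> 2 * M (\<lambda>x. v n x - u x) / eps + 2 * eps * D (\<lambda>x. v n x - u x)"
      by (intro always_eventually allI vertex_square_summable(2) H1_diff v u eps_pos order_refl)
    have "(\<lambda>n. 2 * M (\<lambda>x. v n x - u x) / eps + 2 * eps * D (\<lambda>x. v n x - u x)) \<longlonglongrightarrow> 2 * 0 / eps + 2 * eps * 0"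
      using eps_pos by (intro tendsto_intros M0 D0) auto
    then show "(\<lambda>n. 2 * M (\<lambda>x. v n x - u x) / eps + 2 * eps * D (\<lambda>x. v n x - u x)) \<longlonglongrightarrow> 0" by simp
  qed
  have Lr: "(\<lambda>n. Lr_pow eps (v n) r) \<longlonglongrightarrow> Lr_pow eps u r" if r: "2 \<le> r" for r
  proof (rule tendsto_if_le_young[OF _ M0])
    show "\<bar>Lr_pow eps (v n) r - Lr_pow eps u r\<bar> \<le> r * S powr (r - 2) * (\<kappa> * (\<mu> + M u) + M (\<lambda>x. v n x - u x) / \<kappa>)" if "0 < \<kappa>" for n \<kappa>
      using Lr_pow_perturb[OF v(1) u r that Sv Su, of n] by (simp add: v(2))
    show "0 \<le> r * S powr (r - 2)" using r by simp
    show "0 \<le> \<mu> + M u" using \<mu> Lr_pow_nonneg[of u 2] by simp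
  qed
  have "(\<lambda>n. M (v n)) \<longlonglongrightarrow> M u" by (rule Lr) simp
  then show "M u = \<mu>" using LIMSEQ_unique[OF tendsto_const] v(2) by fastforce
  have Dl: "(\<lambda>n. D (v n)) \<longlonglongrightarrow> D u"
  proof (rule tendsto_if_le_young[OF _ D0])
    show "\<bar>D (v n) - D u\<bar> \<le> 1 * (\<kappa> * (B + D u) + D (\<lambda>x. v n x - u x) / \<kappa>)" if "0 < \<kappa>" for n \<kappa>
    proof -
      have "\<kappa> * (D (v n) + D u) \<le> \<kappa> * (B + D u)" using v(3)[of n] that by (intro mult_left_mono) auto
      then show ?thesis using D_perturb[OF v(1) u that, of n] by simp
    qed
    show "0 \<le> B + D u" using B0 D_nonneg[of u] by simp
  qed simp
  have Ql: "(\<lambda>n. Q (v n)) \<longlonglongrightarrow> Q u"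
  proof (rule tendsto_if_le_young[OF _ Y0])
    show "\<bar>Q (v n) - Q u\<bar> \<le> q * S powr (q - 2) * (\<kappa> * (Yv + Y u) + Y (\<lambda>x. v n x - u x) / \<kappa>)" if "0 < \<kappa>" for n \<kappa>
    proof -
      have "\<bar>Q (v n) - Q u\<bar> \<le> q * S powr (q - 2) * (\<kappa> * (Y (v n) + Y u) + Y (\<lambda>x. v n x - u x) / \<kappa>)"
        by (rule vs_perturb[OF v(1) u pq_ge(2) that Sv Su])
      also have "\<dots> \<le> q * S powr (q - 2) * (\<kappa> * (Yv + Y u) + Y (\<lambda>x. v n x - u x) / \<kappa>)"
        using q that Yv[of n] by (intro mult_left_mono add_right_mono) auto
      finally show ?thesis .
    qed
    show "0 \<le> q * S powr (q - 2)" using q by simp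
    have "0 \<le> Yv" using \<mu> eps_pos B0 by (simp add: Yv_def)
    then show "0 \<le> Yv + Y u" using vs_nonneg[of u 2 UNIV] by simp
  qed
  show "(\<lambda>n. E (v n)) \<longlonglongrightarrow> E u"
    unfolding E_def by (intro tendsto_intros Dl Ql Lr pq_ge) auto
qed

end

section \<open>Existence of ground states\<close>

context nls_periodic
begin

text \<open>The excess over \<open>I\<close> never exceeds \<open>- I / 2\<close>, so all members
  have energy at most \<open>I / 2\<close>, and a single \<delta> from \<open>nonvanishing\<close>
  fits the whole sequence.\<close>

lemma centred_minimizing_sequence:
  assumes I: "I < 0" and approx: "\<And>\<eta>. 0 < \<eta> \<Longrightarrow> \<exists>w\<in>H1 eps. M w = \<mu> \<and> E w < I + \<eta>"
  obtains \<delta> v where "0 < \<delta>" "\<And>n. v n \<in> H1 eps" "\<And>n. M (v n) = \<mu>" "\<And>n. E (v n) \<le> I + (- I / 2) / (real n + 1)"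
    "\<And>n. \<exists>k\<in>{0..<d} \<times> {0..<d}. \<exists>b. \<delta> \<le> em (v n) (k, b)"
proof -
  obtain \<delta> where \<delta>: "0 < \<delta>" "\<And>u. u \<in> H1 eps \<Longrightarrow> M u = \<mu> \<Longrightarrow> E u \<le> I / 2 \<Longrightarrow> \<exists>e. \<delta> \<le> em u e"
    using nonvanishing[of "I / 2"] I by auto
  have "\<exists>w. w \<in> H1 eps \<and> M w = \<mu> \<and> E w \<le> I + (- I / 2) / (real n + 1) \<and> (\<exists>k\<in>{0..<d} \<times> {0..<d}. \<exists>b. \<delta> \<le> em w (k, b))" for n
  proof -
    have "0 < (- I / 2) / (real n + 1)" using I by (intro divide_pos_pos) auto
    from approx[OF this] obtain u where u: "u \<in> H1 eps" "M u = \<mu>" "E u < I + (- I / 2) / (real n + 1)" by blast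
    have "(- I / 2) / (real n + 1) \<le> (- I / 2) / 1" using I by (intro divide_left_mono) auto
    then have "E u \<le> I / 2" using u(3) by simp
    then obtain e where "\<delta> \<le> em u e" using \<delta>(2)[OF u(1,2)] by blast
    from recenter[OF u(1) this] obtain w k b where "w \<in> H1 eps" "M w = M u" "E w = E u" "k \<in> {0..<d} \<times> {0..<d}" "\<delta> \<le> em w (k, b)"
      by metis
    then show ?thesis using u(2,3) by (intro exI[of _ w]) auto
  qed
  then have "\<forall>n. \<exists>w. w \<in> H1 eps \<and> M w = \<mu> \<and> E w \<le> I + (- I / 2) / (real n + 1) \<and> (\<exists>k\<in>{0..<d} \<times> {0..<d}. \<exists>b. \<delta> \<le> em w (k, b))" ..
  from choice[OF this] show ?thesis using that \<delta>(1) by blast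
qed

lemma minimizer_exists:
  assumes I: "I < 0" "\<And>w. w \<in> H1 eps \<Longrightarrow> M w = \<mu> \<Longrightarrow> I \<le> E w"
    and approx: "\<And>\<eta>. 0 < \<eta> \<Longrightarrow> \<exists>w\<in>H1 eps. M w = \<mu> \<and> E w < I + \<eta>"
  obtains u where "u \<in> H1 eps" "M u = \<mu>" "E u = I"
proof -
  obtain \<delta> U where \<delta>: "0 < \<delta>" and U: "\<And>n. U n \<in> H1 eps" "\<And>n. M (U n) = \<mu>" "\<And>n. E (U n) \<le> I + (- I / 2) / (real n + 1)"
    and Uc: "\<And>n. \<exists>k\<in>{0..<d} \<times> {0..<d}. \<exists>b. \<delta> \<le> em (U n) (k, b)"
    by (rule centred_minimizing_sequence[OF I(1) approx]) blast+
  obtain B where B: "0 \<le> B" "\<And>u. u \<in> H1 eps \<Longrightarrow> M u = \<mu> \<Longrightarrow> D u \<le> 4 * E u + B"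
    by (rule coercive) blast
  have UD: "D (U n) \<le> B" for n
  proof -
    have "(- I / 2) / (real n + 1) \<le> (- I / 2) / 1" using I(1) by (intro divide_left_mono) auto
    then have "E (U n) \<le> 0" using U(3)[of n] I(1) by simp
    then show ?thesis using B(2)[OF U(1,2), of n] by simp
  qed
  have bound: "norm (ef (U n) (fst x) (eps * of_rat (snd x))) \<le> sqrt (C0 * (\<mu> + B))" if "x \<in> UNIV \<times> {0..1}" for n and x :: "grid_edge \<times> rat"
  proof -
    have "0 \<le> (of_rat (snd x) :: real)" "(of_rat (snd x) :: real) \<le> 1" using that by (auto simp: of_rat_le_1_iff)
    then have t: "eps * of_rat (snd x) \<in> {0..eps}" using eps_pos by (auto simp: mult_left_le)
    have "(ef (U n) (fst x) (eps * of_rat (snd x)))\<^sup>2 \<le> C0 * (em (U n) (fst x) + ed (U n) (fst x))"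
      by (rule edge_sup_bound'[OF H1D(1)[OF U(1)] t])
    also have "\<dots> \<le> C0 * (\<mu> + B)"
      using em_le_M[OF U(1), of n "fst x"] ed_le_D[OF U(1), of n "fst x"] U(2)[of n] UD[of n] C0_pos by (intro mult_left_mono) auto
    finally show ?thesis by (intro real_le_rsqrt) simp
  qed
  \<comment> \<open>A diagonal argument over the countable set of edges and rational parameters. It
    contains the equally spaced sample points for every \<open>k\<close> at once.\<close>
  obtain r where r: "strict_mono (r :: nat \<Rightarrow> nat)"
    and rlim: "\<And>x. x \<in> UNIV \<times> {0..1} \<Longrightarrow> \<exists>l. (\<lambda>n. ef (U (r n)) (fst x) (eps * of_rat (snd x))) \<longlonglongrightarrow> l"
    using function_convergent_subsequence[of "UNIV \<times> {0..1} :: (grid_edge \<times> rat) set" 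
        "\<lambda>n x. ef (U n) (fst x) (eps * of_rat (snd x))" "sqrt (C0 * (\<mu> + B))"] bound countableI_type by blast
  define v where "v n = U (r n)" for n
  have v: "v n \<in> H1 eps" "M (v n) = \<mu>" "D (v n) \<le> B" for n unfolding v_def using U UD by auto
  have Elim: "(\<lambda>n. E (v n)) \<longlonglongrightarrow> I"
  proof -
    have "(\<lambda>n. I + (- I / 2) * inverse (real (Suc n))) \<longlonglongrightarrow> I + (- I / 2) * 0"
      by (intro tendsto_intros LIMSEQ_inverse_real_of_nat)
    then have lim: "(\<lambda>n. I + (- I / 2) * inverse (real (Suc n))) \<longlonglongrightarrow> I" by (simp only: mult_zero_right add_0_right)
    have "(\<lambda>n. E (U n)) \<longlonglongrightarrow> I"
    proof (rule tendsto_sandwich[OF _ _ tendsto_const lim])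
      show "\<forall>\<^sub>F n in sequentially. I \<le> E (U n)" by (intro always_eventually allI I(2) U)
      show "\<forall>\<^sub>F n in sequentially. E (U n) \<le> I + (- I / 2) * inverse (real (Suc n))"
      proof (intro always_eventually allI)
        fix n
        have "real (Suc n) = real n + 1" by simp
        then show "E (U n) \<le> I + (- I / 2) * inverse (real (Suc n))" using U(3)[of n] by (simp only: divide_inverse)
      qed
    qed
    from LIMSEQ_subseq_LIMSEQ[OF this r] show ?thesis unfolding v_def o_def .
  qed
  \<comment> \<open>Cauchy conditions become statements about differences along the product filter,
    so that eventuality arguments apply to pairs of indices.\<close>
  define G where "G = (sequentially \<times>\<^sub>F sequentially :: (nat \<times> nat) filter)"
  define w where "w z = (\<lambda>x. v (fst z) x - v (snd z) x)" for z
  have fstG: "filterlim fst sequentially G" and sndG: "filterlim snd sequentially G"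
    unfolding G_def by (rule filterlim_fst, rule filterlim_snd)
  have wH: "w z \<in> H1 eps" for z unfolding w_def by (rule H1_diff[OF v(1) v(1)])
  have wD: "D (w z) \<le> 4 * B" for z
    using D_parallelogram[OF v(1) v(1), of "fst z" "snd z"] D_nonneg[of "\<lambda>x. v (fst z) x + v (snd z) x"] v(3)[of "fst z"] v(3)[of "snd z"]
    unfolding w_def by simp
  have sample: "((\<lambda>z. ef (w z) e (eps * (real i / real k))) \<longlongrightarrow> 0) G" if "i \<le> k" "1 \<le> k" for e i k
  proof -
    have "of_rat (of_nat i / of_nat k) = real i / real k" by (simp add: of_rat_divide)
    moreover have "(e, of_nat i / of_nat k) \<in> UNIV \<times> {0..1 :: rat}" using that by simp
    ultimately obtain l where l: "(\<lambda>n. ef (v n) e (eps * (real i / real k))) \<longlonglongrightarrow> l"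
      using rlim[of "(e, of_nat i / of_nat k)"] by (auto simp: v_def)
    have "((\<lambda>z. ef (v (fst z)) e (eps * (real i / real k)) - ef (v (snd z)) e (eps * (real i / real k))) \<longlongrightarrow> l - l) G"
      by (intro tendsto_diff filterlim_compose[OF l] fstG sndG)
    then show ?thesis by (simp add: w_def edge_fun_def)
  qed
  have em0: "((\<lambda>z. em (w z) e) \<longlongrightarrow> 0) G" for e
  proof (rule order_tendstoI)
    fix c :: real assume "c < 0"
    then show "\<forall>\<^sub>F z in G. c < em (w z) e" by (intro always_eventually) (auto intro: less_le_trans edge_Lr_nonneg)
  next
    fix c :: real assume c: "0 < c"
    \<comment> \<open>With \<open>D (w z) \<le> 4 * B\<close> the sampling error is
      \<open>8 * eps\<^sup>2 * B / k\<close>, independent of \<open>z\<close>. Only finitely many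
      sample values then have to become small.\<close>
    obtain k where k': "max 1 (8 * eps\<^sup>2 * B / c) < real k" using reals_Archimedean2 by blast
    then have k: "1 \<le> k" "8 * eps\<^sup>2 * B / k < c" using c by (auto simp: field_simps)
    let ?b = "\<lambda>z. eps * (2 * (\<Sum>i\<le>k. (ef (w z) e (eps * (real i / real k)))\<^sup>2) + 2 * (eps / k) * (4 * B))"
    have "(?b \<longlongrightarrow> eps * (2 * (\<Sum>i\<le>k. 0\<^sup>2) + 2 * (eps / k) * (4 * B))) G"
      using k(1) by (intro tendsto_intros sample) auto
    moreover have "eps * (2 * (\<Sum>i\<le>k. 0\<^sup>2) + 2 * (eps / k) * (4 * B)) < c" using k(2) by (simp add: power2_eq_square mult_ac)
    ultimately have "\<forall>\<^sub>F z in G. ?b z < c" by (rule order_tendstoD(2))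
    then show "\<forall>\<^sub>F z in G. em (w z) e < c"
    proof eventually_elim
      case (elim z)
      have "em (w z) e \<le> eps * (2 * (\<Sum>i\<le>k. (ef (w z) e (eps * (real i / real k)))\<^sup>2) + 2 * (eps / k) * ed (w z) e)"
        by (rule edge_mass_sample[OF H1D(1)[OF wH] k(1)])
      also have "\<dots> \<le> ?b z" using eps_pos order_trans[OF ed_le_D[OF wH] wD, of z e]
        by (intro mult_left_mono add_left_mono) auto
      finally show ?case using elim by linarith
    qed
  qed
  have M0: "\<forall>\<^sub>F z in G. M (w z) < c" if c: "0 < c" for c
  proof -
    \<comment> \<open>The tails of both members enter twice, giving 4 * (c / 8) = c / 2; the finite
      part supplies the other half.\<close>
    have "0 < c / 8" using c by simp
    obtain F \<eta> where F: "finite F" "0 < \<eta>" and tight: "\<And>u k b. u \<in> H1 eps \<Longrightarrow> M u = \<mu> \<Longrightarrow> E u \<le> I + \<eta> \<Longrightarrow> 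
        k \<in> {0..<d} \<times> {0..<d} \<Longrightarrow> \<delta> \<le> em u (k, b) \<Longrightarrow> infsum (em u) (- F) \<le> c / 8"
      by (rule tightness[OF I \<delta> \<open>0 < c / 8\<close>]) blast+
    have "\<forall>\<^sub>F n in sequentially. E (v n) < I + \<eta>" using F by (intro order_tendstoD(2)[OF Elim]) simp
    then have tail: "\<forall>\<^sub>F n in sequentially. infsum (em (v n)) (- F) \<le> c / 8"
    proof eventually_elim
      case (elim n)
      obtain k b where "k \<in> {0..<d} \<times> {0..<d}" "\<delta> \<le> em (v n) (k, b)" using Uc[of "r n"] unfolding v_def by blast
      then show ?case using elim tight[OF v(1,2)] by simp
    qed
    have "((\<lambda>z. \<Sum>e\<in>F. em (w z) e) \<longlongrightarrow> (\<Sum>e\<in>F. 0)) G" by (intro tendsto_sum em0)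
    then have "\<forall>\<^sub>F z in G. (\<Sum>e\<in>F. em (w z) e) < c / 2" using c by (intro order_tendstoD(2)) auto
    then show ?thesis
      using eventually_compose_filterlim[OF tail fstG] eventually_compose_filterlim[OF tail sndG]
    proof eventually_elim
      case (elim z)
      then show ?case using M_le_split[OF v(1) v(1) F(1), of "fst z" "snd z"] unfolding w_def by linarith
    qed
  qed
  obtain A where A: "0 \<le> A"
    "\<And>u v y. u \<in> H1 eps \<Longrightarrow> M u = \<mu> \<Longrightarrow> v \<in> H1 eps \<Longrightarrow> M v = \<mu> \<Longrightarrow> D u \<le> B \<Longrightarrow> D v \<le> B \<Longrightarrow>
       0 < y \<Longrightarrow> y \<le> 1 \<Longrightarrow> y\<^sup>2 \<le> eps \<Longrightarrow> y ^ 4 < 4 * \<mu> \<Longrightarrow> M (\<lambda>x. u x - v x) \<le> y ^ 4 \<Longrightarrow>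
       D (\<lambda>x. u x - v x) \<le> 4 * (E u + E v - 2 * I) + A * y"
    by (rule midpoint_estimate[OF I, of B]) blast+
  have D0: "\<forall>\<^sub>F z in G. D (w z) < c" if c: "0 < c" for c
  proof -
    \<comment> \<open>The last entry gives \<open>A * y < c / 2\<close>, also for
      \<open>A = 0\<close>; the excess energies, each below c/16, contribute less than 4 * (c / 8) =
      c / 2.\<close>
    define y where "y = Min {1, eps, \<mu>, c / (2 * A + 1) / 2}"
    have y: "0 < y" unfolding y_def using eps_pos \<mu> c A(1) by simp
    have yle: "y \<le> 1" "y \<le> eps" "y \<le> \<mu>" "y \<le> c / (2 * A + 1) / 2" unfolding y_def by (rule Min_le; simp)+
    have "y\<^sup>2 \<le> y" using y yle(1) by (simp add: power2_eq_square mult_left_le)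
    then have y2: "y\<^sup>2 \<le> eps" using yle by simp
    have "y ^ 4 \<le> y" using y yle(1) power_decreasing[of 1 4 y] by simp
    then have y4: "y ^ 4 < 4 * \<mu>" using yle \<mu> by simp
    have Ay: "A * y < c / 2"
    proof -
      have "A * y \<le> A * (c / (2 * A + 1) / 2)" using yle(4) A(1) by (rule mult_left_mono)
      also have "\<dots> < c / 2" using A(1) c by (simp add: field_simps add_pos_nonneg)
      finally show ?thesis .
    qed
    have e: "\<forall>\<^sub>F n in sequentially. E (v n) < I + c / 16" using c by (intro order_tendstoD(2)[OF Elim]) simp
    have "0 < y ^ 4" using y by simp
    from M0[OF this] show ?thesis
      using eventually_compose_filterlim[OF e fstG] eventually_compose_filterlim[OF e sndG]
    proof eventually_elim
      case (elim z)
      have "D (w z) \<le> 4 * (E (v (fst z)) + E (v (snd z)) - 2 * I) + A * y"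
        unfolding w_def using elim(1) unfolding w_def by (intro A(2) v y yle(1) y2 y4) simp
      then show ?case using elim(2,3) Ay by argo
    qed
  qed
  have cauchy: "\<exists>N. \<forall>m\<ge>N. \<forall>n\<ge>N. M (\<lambda>x. v m x - v n x) \<le> \<kappa> \<and> D (\<lambda>x. v m x - v n x) \<le> \<kappa>" if \<kappa>: "0 < \<kappa>" for \<kappa>
  proof -
    have "\<forall>\<^sub>F z in G. M (w z) < \<kappa> \<and> D (w z) < \<kappa>" using M0[OF \<kappa>] D0[OF \<kappa>] by (rule eventually_conj)
    then obtain N where "\<forall>m\<ge>N. \<forall>n\<ge>N. M (w (n, m)) < \<kappa> \<and> D (w (n, m)) < \<kappa>"
      unfolding G_def eventually_prod_sequentially by blast
    then show ?thesis by (intro exI[of _ N]) (auto simp: w_def intro: less_imp_le)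
  qed
  obtain u where u: "u \<in> H1 eps" "\<And>e t. t \<in> {0..eps} \<Longrightarrow> (\<lambda>n. ef (v n) e t) \<longlonglongrightarrow> ef u e t"
    "(\<lambda>n. M (\<lambda>x. v n x - u x)) \<longlonglongrightarrow> 0" "(\<lambda>n. D (\<lambda>x. v n x - u x)) \<longlonglongrightarrow> 0"
    by (rule H1_complete[OF v(1) cauchy]) blast+
  have "M u = \<mu>" "(\<lambda>n. E (v n)) \<longlonglongrightarrow> E u"
    using energy_continuous[of v B u] v u by blast+
  moreover then have "E u = I" using LIMSEQ_unique[OF _ Elim] by blast
  ultimately show ?thesis using that u(1) by blast
qed

lemma ground_state_exists:
  "ground_level eps p q \<alpha> \<beta> (vtx eps ` V) \<mu> < 0 \<and>
   (\<exists>u. ground_state eps p q \<alpha> \<beta> (vtx eps ` V) \<mu> u \<and>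
      (\<forall>w\<in>H1_mass eps \<mu>. energy eps p q \<alpha> \<beta> (vtx eps ` V) u \<le> energy eps p q \<alpha> \<beta> (vtx eps ` V) w))"
proof -
  define I where "I = (INF u\<in>H1_mass eps \<mu>. E u)"
  have mass: "u \<in> H1_mass eps \<mu> \<longleftrightarrow> u \<in> H1 eps \<and> M u = \<mu>" for u by (auto simp: H1_mass_def)
  obtain B where B: "0 \<le> B" "\<And>u. u \<in> H1 eps \<Longrightarrow> M u = \<mu> \<Longrightarrow> D u \<le> 4 * E u + B"
    by (rule coercive) blast
  \<comment> \<open>A real-valued \<open>INF\<close> is meaningful only for a nonempty set that is
    bounded below; coercivity supplies the bound.\<close>
  have "- B / 4 \<le> E u" if "u \<in> H1_mass eps \<mu>" for u
    using B(2)[of u] D_nonneg[of u] that unfolding mass by simp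
  then have bdd: "bdd_below (E ` H1_mass eps \<mu>)" by (intro bdd_belowI2)
  have Imin: "I \<le> E u" if "u \<in> H1 eps" "M u = \<mu>" for u
    unfolding I_def by (rule cINF_lower[OF bdd]) (use that mass in blast)
  obtain u0 where u0: "u0 \<in> H1 eps" "M u0 = \<mu>" "E u0 < 0" by (rule negative_energy)
  have I0: "I < 0" using Imin[OF u0(1,2)] u0(3) by simp
  have ne: "H1_mass eps \<mu> \<noteq> {}" using u0 mass by blast
  have approx: "\<exists>u\<in>H1 eps. M u = \<mu> \<and> E u < I + \<eta>" if "0 < \<eta>" for \<eta>
    using cINF_less_iff[OF ne bdd, of "I + \<eta>"] that mass unfolding I_def[symmetric] by auto
  obtain u where u: "u \<in> H1 eps" "M u = \<mu>" "E u = I"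
    by (rule minimizer_exists[OF I0 Imin approx])
  show ?thesis
    unfolding ground_state_def ground_level_def energy_eq I_def[symmetric]
    using u I0 Imin mass by auto
qed

end

text \<open>Cramer's rule over the integers: multiples of the determinant \<Delta> along the axes
  are integral combinations of the two periods.\<close>

lemma periodic_axes:
  assumes "Z2_periodic V"
  obtains d :: int where "0 < d" "\<And>k i j. k \<in> V \<Longrightarrow> k + (d * i, d * j) \<in> V"
proof -
  obtain v1 v2 :: "int \<times> int" where det: "fst v1 * snd v2 - snd v1 * fst v2 \<noteq> 0"
    and per: "\<And>k1 k2. V = (\<lambda>x. x + (k1 * fst v1 + k2 * fst v2, k1 * snd v1 + k2 * snd v2)) ` V"
    using assms unfolding Z2_periodic_def by blast
  define \<Delta> where "\<Delta> = fst v1 * snd v2 - snd v1 * fst v2"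
  have *: "k + (\<Delta> * i, \<Delta> * j) \<in> V" if k: "k \<in> V" for k i j
  proof -
    define k1 where "k1 = i * snd v2 - j * fst v2"
    define k2 where "k2 = j * fst v1 - i * snd v1"
    have "k + (k1 * fst v1 + k2 * fst v2, k1 * snd v1 + k2 * snd v2) \<in> V"
      using per[of k1 k2] k by blast
    moreover have "k1 * fst v1 + k2 * fst v2 = \<Delta> * i" "k1 * snd v1 + k2 * snd v2 = \<Delta> * j"
      by (simp_all add: k1_def k2_def \<Delta>_def algebra_simps)
    ultimately show ?thesis by simp
  qed
  have "k + (\<bar>\<Delta>\<bar> * i, \<bar>\<Delta>\<bar> * j) \<in> V" if "k \<in> V" for k i j
    using *[OF that, of "sgn \<Delta> * i" "sgn \<Delta> * j"] by (simp add: mult.assoc[symmetric] mult_sgn_abs abs_sgn)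
  then show ?thesis using that[of "\<bar>\<Delta>\<bar>"] det by (simp add: \<Delta>_def)
qed

text \<open>The empty set satisfies \<open>Z2_periodic\<close>, so nonemptiness is stated
  separately. Minimality is spelled out as well, so that the conclusion does not rest on the
  conventions for a real-valued \<open>INF\<close>.\<close>

theorem theorem1p3:
  fixes p q \<alpha> \<beta> eps \<mu> :: real and V :: "(real \<times> real) set"
  assumes "2 < p" "p < 6" "2 < q" "q < 4" "\<alpha> > 0" "\<beta> > 0" "eps > 0"
    and "grid_periodic eps V" and "V \<noteq> {}"
    and "\<mu> > 0"
  shows "ground_level eps p q \<alpha> \<beta> V \<mu> < 0 \<and>
         (\<exists>u. ground_state eps p q \<alpha> \<beta> V \<mu> u \<and>
              (\<forall>w\<in>H1_mass eps \<mu>. energy eps p q \<alpha> \<beta> V u \<le> energy eps p q \<alpha> \<beta> V w))"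
proof -
  obtain V' where V': "Z2_periodic V'" "V = vtx eps ` V'"
    using \<open>grid_periodic eps V\<close> unfolding grid_periodic_def by blast
  obtain d :: int where d: "0 < d" "\<And>k i j. k \<in> V' \<Longrightarrow> k + (d * i, d * j) \<in> V'"
    by (rule periodic_axes[OF V'(1)]) blast
  have "nls_periodic eps p q \<alpha> \<beta> \<mu> V' d"
    using assms d V'(2) by unfold_locales auto
  then show ?thesis unfolding V'(2) by (rule nls_periodic.ground_state_exists)
qed

end
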